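(* Let $p\in(2,6)$ and $q=\frac{p}{2}+1$. Then there exists a critical number of half-lines, an integer $N_p\ge 2$, such that for every positive integer $N$: (i) if $N\le N_p$, then ground states of $F_{p,q}$ on $S_N$ at mass $\mu$ exist for every $\mu>0$; (ii) if $N>N_p$, then ground states of $F_{p,q}$ on $S_N$ at mass $\mu$ do not exist for any $\mu>0$. Furthermore, whenever ground states at mass $\mu$ exist, the positive ground state at mass $\mu$ is unique, and it is radial and decreasing on $S_N$, in the sense that its restriction to each half-line of the graph corresponds to the same decreasing function on $\mathbb{R}^+$.
   Context: $S_N$ is the star graph made of $N$ half-lines $\mathcal{H}_1,\dots,\mathcal{H}_N$, each with a coordinate $x_i\in[0,+\infty)$, glued together at their common origin (the vertex), denoted by $0$. A (complex-valued) function $u$ on $S_N$ is a collection $(u_i)_{i=1}^N$ of functions on $\mathcal{H}_i\cong[0,+\infty)$; integrals and $L^p$ norms on $S_N$ are sums over the half-lines, i.e. $\|u\|_{L^p(S_N)}^p=\sum_i\|u_i\|_{L^p(0,\infty)}^p$. $H^1(S_N)$ is the space of functions $u$ continuous on $S_N$ (in particular at the vertex, $u_i(0)=u_j(0)=:u(0)$) with $u_i\in H^1(0,\infty)$ for every $i$. For $\mu>0$, $H^1_\mu(S_N)=\{u\in H^1(S_N):\|u\|_{L^2(S_N)}^2=\mu\}$. The energy is $$F_{p,q}(u)=\frac12\int_{S_N}|u'|^2\,dx-\frac1p\int_{S_N}|u|^p\,dx-\frac1q|u(0)|^q .$$ A ground state of $F_{p,q}$ at mass $\mu$ is a function $u\in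 H^1_\mu(S_N)$ with $F_{p,q}(u)=\inf_{v\in H^1_\mu(S_N)}F_{p,q}(v)$. *)

theory Defs
  imports "HOL-Analysis.Analysis"
begin

section \<open>The Sobolev space of the half-line\<close>

text \<open>
  Square integrability on \<open>(0,\<infinity>)\<close>. Measurability of \<open>f\<close> is not implied by integrability
  of its squared modulus, so it is required separately.
\<close>

definition L2_halfline :: "(real \<Rightarrow> complex) \<Rightarrow> bool" where
  "L2_halfline f \<longleftrightarrow> set_borel_measurable lborel {0<..} f \<and>
     set_integrable lborel {0<..} (\<lambda>x. (norm (f x))\<^sup>2)"

text \<open>
  Test functions are real-valued, of class \<open>C\<^sup>1\<close>, with compact support in the open half-line,
  as in Brezis' definition of Sobolev spaces on an interval; smooth test functions give
  the same weak derivatives.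
\<close>

definition test_function :: "(real \<Rightarrow> real) \<Rightarrow> bool" where
  "test_function \<phi> \<longleftrightarrow> \<phi> C1_differentiable_on UNIV \<and>
     (\<exists>a b. 0 < a \<and> (\<forall>x. x \<notin> {a..b} \<longrightarrow> \<phi> x = 0))"

text \<open>
  Local integrability must be demanded explicitly, since the Bochner integral of a
  non-integrable function is 0 by convention.
\<close>

definition locally_integrable_halfline :: "(real \<Rightarrow> complex) \<Rightarrow> bool" where
  "locally_integrable_halfline f \<longleftrightarrow> (\<forall>a b. 0 < a \<longrightarrow> set_integrable lborel {a..b} f)"

definition has_weak_deriv :: "(real \<Rightarrow> complex) \<Rightarrow> (real \<Rightarrow> complex) \<Rightarrow> bool" where
  "has_weak_deriv f g \<longleftrightarrow>
     locally_integrable_halfline f \<and> locally_integrable_halfline g \<and>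
     (\<forall>\<phi>. test_function \<phi> \<longrightarrow>
       (LBINT x:{0<..}. deriv \<phi> x *\<^sub>R f x) = - (LBINT x:{0<..}. \<phi> x *\<^sub>R g x))"

text \<open>
  The weak derivative is determined only almost everywhere on \<open>(0,\<infinity>)\<close>; this picks one
  representative.
\<close>

definition weak_deriv :: "(real \<Rightarrow> complex) \<Rightarrow> real \<Rightarrow> complex" where
  "weak_deriv f = (SOME g. has_weak_deriv f g)"

definition H1_halfline :: "(real \<Rightarrow> complex) \<Rightarrow> bool" where
  "H1_halfline f \<longleftrightarrow> L2_halfline f \<and> (\<exists>g. has_weak_deriv f g \<and> L2_halfline g)"

section \<open>Functions on the star graph\<close>

text \<open>
  A function \<open>u\<close> on the star graph with \<open>N \<ge> 1\<close> half-lines is given by its components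
  \<open>u i x\<close> for \<open>i \<in> {1..N}\<close> and \<open>x \<ge> 0\<close>. Values at other arguments are irrelevant to all
  the notions below, and two functions are identified if they agree on the graph.
  The common value at the vertex is \<open>u 1 0\<close>.
\<close>

type_synonym star_fun = "nat \<Rightarrow> real \<Rightarrow> complex"

definition eq_on_star :: "nat \<Rightarrow> star_fun \<Rightarrow> star_fun \<Rightarrow> bool" where
  "eq_on_star N u v \<longleftrightarrow> (\<forall>i\<in>{1..N}. \<forall>x\<ge>0. u i x = v i x)"

definition continuous_on_star :: "nat \<Rightarrow> star_fun \<Rightarrow> bool" where
  "continuous_on_star N u \<longleftrightarrow> (\<forall>i\<in>{1..N}. continuous_on {0..} (u i)) \<and>
     (\<forall>i\<in>{1..N}. \<forall>j\<in>{1..N}. u i 0 = u j 0)"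

definition H1_star :: "nat \<Rightarrow> star_fun set" where
  "H1_star N = {u. continuous_on_star N u \<and> (\<forall>i\<in>{1..N}. H1_halfline (u i))}"

definition star_mass :: "nat \<Rightarrow> star_fun \<Rightarrow> real" where
  "star_mass N u = (\<Sum>i=1..N. LBINT x:{0<..}. (norm (u i x))\<^sup>2)"

definition H1_star_mass :: "nat \<Rightarrow> real \<Rightarrow> star_fun set" where
  "H1_star_mass N \<mu> = {u \<in> H1_star N. star_mass N u = \<mu>}"

definition energy :: "real \<Rightarrow> real \<Rightarrow> nat \<Rightarrow> star_fun \<Rightarrow> real" where
  "energy p q N u =
     (1/2) * (\<Sum>i=1..N. LBINT x:{0<..}. (norm (weak_deriv (u i) x))\<^sup>2)
     - (1/p) * (\<Sum>i=1..N. LBINT x:{0<..}. norm (u i x) powr p)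
     - (1/q) * norm (u 1 0) powr q"

text \<open>
  The infimum is taken in the extended reals, so that it is \<open>-\<infinity>\<close> (and there is no ground
  state) if the energy is unbounded below.
\<close>

definition ground_state :: "real \<Rightarrow> real \<Rightarrow> nat \<Rightarrow> real \<Rightarrow> star_fun \<Rightarrow> bool" where
  "ground_state p q N \<mu> u \<longleftrightarrow> u \<in> H1_star_mass N \<mu> \<and>
     ereal (energy p q N u) = (INF v\<in>H1_star_mass N \<mu>. ereal (energy p q N v))"

definition positive_on_star :: "nat \<Rightarrow> star_fun \<Rightarrow> bool" where
  "positive_on_star N u \<longleftrightarrow> (\<forall>i\<in>{1..N}. \<forall>x\<ge>0. u i x \<in> \<real> \<and> Re (u i x) > 0)"

definition radial_decreasing :: "nat \<Rightarrow> star_fun \<Rightarrow> bool" where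
  "radial_decreasing N u \<longleftrightarrow> (\<exists>f :: real \<Rightarrow> real. strict_antimono_on {0..} f \<and>
     (\<forall>i\<in>{1..N}. \<forall>x\<ge>0. u i x = of_real (f x)))"

end

theory Submission
  imports Defs "HOL-Real_Asymp.Real_Asymp"
begin

text \<open>
  Ground states are found, excluded and identified by completing a square at a well chosen
  frequency. For \<omega> > 0 let g(r) = sqrt (\<omega> r^2 - (2/p) r^p), which is real as long as r is at most
  the height of the soliton of frequency \<omega>, and let G be its primitive. If M = max |u| is at most
  that height, then at mass \<mu>
    F(u) = - \<omega> \<mu> / 2 + (\<Sum>i. \<integral> g(|u_i|) |u_i'|) + 1/2 (\<Sum>i. \<integral> (|u_i'| - g(|u_i|))^2) - |u(0)|^q / q,
  and the flux term, the first of the two sums, is at least 2 G(M) + (N - 2) G(|u(0)|): the half-line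
  carrying the maximum has to climb from the vertex value to M and to descend to 0, and all the
  others have to descend from the vertex value. This replaces a rearrangement argument.

  The frequency is then adapted to u. There are two model profiles for each \<omega>: N equal decreasing
  pieces of a soliton that satisfy the Kirchhoff condition N |u_i'(0)| = |u(0)|^(q-1) at the vertex,
  and a full soliton sitting at infinity. If |u(0)| is large compared with M, one takes the \<omega>
  whose radial profile has vertex value |u(0)| (lemma energy_vertex_dominated); otherwise the \<omega> whose
  soliton has height M (lemma energy_peak_dominated). As q = p/2 + 1, all quantities are homogeneous
  in \<omega>. The first choice bounds the energy below by - (\<omega> \<mu> - \<beta> k \<omega>^(1/\<beta>)) / 2, where k is the mass of
  the radial profile at frequency 1; the second choice gives this bound for the radial profile or for
  the full soliton. Bernoulli's inequality minimises such a bound over \<omega>, and the minimal value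
  level \<mu> k is the energy of the model profile rescaled to mass \<mu>; it increases with k.

  So everything depends on two numbers that do not involve \<mu>: the mass radial_mass N of the radial
  profile and the mass 2 \<kappa>(0) of the full soliton, both at frequency 1. The former is increasing and
  unbounded in N and at most the latter for N = 2; this gives the critical number. If the radial mass
  is not the larger one, the radial profile attains the bound. If it is, a soliton moved to infinity
  along one half-line approaches the soliton level (lemma escaping_soliton), and no function reaches
  that level because the bound in energy_peak_dominated is strict.

  A positive ground state must give equality everywhere, that is u_i' = - g(u_i) on each half-line,
  with a known frequency and vertex value. Then \<theta> = sqrt (\<omega> - (2/p) u_i^(p-2)) solves the Riccati
  equation \<theta>' = \<alpha> (\<omega> - \<theta>^2), whose nonnegative solutions are determined by their initial value.
\<close>

section \<open>The du Bois-Reymond lemma on the half-line\<close>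

text \<open>
  A step of class C1 from 0 to 1 over the unit interval, built from squares of positive parts so that
  its derivative is the tent function.
\<close>

definition quad_step :: "real \<Rightarrow> real" where
  "quad_step t = 2 * ((max 0 t)\<^sup>2 - 2 * (max 0 (t - 1/2))\<^sup>2 + (max 0 (t - 1))\<^sup>2)"

definition tent :: "real \<Rightarrow> real" where
  "tent t = 4 * (max 0 t - 2 * max 0 (t - 1/2) + max 0 (t - 1))"

lemma DERIV_max_square: "((\<lambda>t::real. (max 0 t)\<^sup>2) has_real_derivative 2 * max 0 t) (at t)"
proof -
  consider "t > 0" | "t < 0" | "t = 0" by linarith
  then show ?thesis
  proof cases
    case 1
    have "((\<lambda>t::real. t\<^sup>2) has_real_derivative 2 * max 0 t) (at t)"
      using 1 by (auto intro!: derivative_eq_intros)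
    then show ?thesis
      by (rule has_field_derivative_transform_within_open[where S = "{0<..}"]) (use 1 in auto)
  next
    case 2
    have "((\<lambda>t::real. 0) has_real_derivative 2 * max 0 t) (at t)"
      using 2 by (auto intro!: derivative_eq_intros)
    then show ?thesis
      by (rule has_field_derivative_transform_within_open[where S = "{..<0}"]) (use 2 in auto)
  next
    case 3
    have "((\<lambda>h. ((max 0 (0 + h))\<^sup>2 - (max 0 (0::real))\<^sup>2) / h) \<longlongrightarrow> 0) (at 0)"
    proof (rule Lim_null_comparison)
      show "\<forall>\<^sub>F h in at 0. norm (((max 0 (0 + h))\<^sup>2 - (max 0 (0::real))\<^sup>2) / h) \<le> \<bar>h\<bar>"
        by (rule always_eventually) (auto simp: max_def power2_eq_square)
      show "((\<lambda>h::real. \<bar>h\<bar>) \<longlongrightarrow> 0) (at 0)"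
        by (intro tendsto_rabs_zero tendsto_ident_at)
    qed
    then show ?thesis using 3 by (simp add: DERIV_def)
  qed
qed

lemma DERIV_quad_step: "(quad_step has_real_derivative tent t) (at t)"
  unfolding quad_step_def[abs_def] tent_def
  by (rule derivative_eq_intros DERIV_max_square DERIV_chain2[OF DERIV_max_square] refl)+ simp

lemma continuous_tent: "continuous_on S tent"
  unfolding tent_def[abs_def] by (intro continuous_intros)

lemma quad_step_0: "t \<le> 0 \<Longrightarrow> quad_step t = 0"
  by (simp add: quad_step_def max_def)

lemma quad_step_1: "t \<ge> 1 \<Longrightarrow> quad_step t = 1"
  by (simp add: quad_step_def max_def power2_eq_square algebra_simps)

lemma tent_0: "t \<notin> {0..1} \<Longrightarrow> tent t = 0"
  by (auto simp: tent_def max_def)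

lemma tent_bounds: "0 \<le> tent t" "tent t \<le> 2"
  by (auto simp: tent_def max_def)

lemma quad_step_bounds: "0 \<le> quad_step t" "quad_step t \<le> 1"
proof -
  have mono: "quad_step s \<le> quad_step t" if "s \<le> t" for s t
    by (rule DERIV_nonneg_imp_nondecreasing[OF that]) (use DERIV_quad_step tent_bounds in blast)
  show "0 \<le> quad_step t" using mono[of "min 0 t" t] quad_step_0[of "min 0 t"] by simp
  show "quad_step t \<le> 1" using mono[of t "max 1 t"] quad_step_1[of "max 1 t"] by simp
qed

lemma integral_tent: "(LBINT t. tent t) = 1"
proof -
  have "(LBINT t. tent t * indicator {0..1} t) = quad_step 1 - quad_step 0"
    by (rule integral_FTC_Icc_real)
       (use DERIV_quad_step continuous_tent[of UNIV] in \<open>auto simp: continuous_on_eq_continuous_at\<close>)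
  moreover have "(\<lambda>t. tent t * indicator {0..1} t) = tent"
    using tent_0 by (auto simp: fun_eq_iff indicator_def)
  ultimately show ?thesis by (simp add: quad_step_0 quad_step_1)
qed

text \<open>
  The test function used against the weak derivative: it tends to the indicator of the interval
  from x to y, while its derivative tends to the difference of two Dirac masses. Its rises start at x
  and at y, to the right, so that the support stays away from the origin.
\<close>

definition trapezoid :: "real \<Rightarrow> real \<Rightarrow> real \<Rightarrow> real \<Rightarrow> real" where
  "trapezoid k x y t = quad_step ((t - x) * k) - quad_step ((t - y) * k)"

lemma DERIV_trapezoid:
  "(trapezoid k x y has_real_derivative (tent ((t - x) * k) * k - tent ((t - y) * k) * k)) (at t)"
  unfolding trapezoid_def[abs_def]
  by (rule derivative_eq_intros DERIV_chain2[OF DERIV_quad_step] refl)+ simp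

lemma trapezoid_support:
  assumes "1 \<le> k" "x \<le> y" "t \<notin> {x..y + 1}"
  shows "trapezoid k x y t = 0"
proof -
  consider "t < x" | "t > y + 1" using assms(3) by fastforce
  then show ?thesis
  proof cases
    case 1
    then have "(t - x) * k \<le> 0" "(t - y) * k \<le> 0"
      using assms by (auto simp: mult_le_0_iff)
    then show ?thesis by (simp add: trapezoid_def quad_step_0)
  next
    case 2
    have *: "1 * 1 \<le> (t - y) * k" by (rule mult_mono) (use 2 assms in auto)
    have "1 * 1 \<le> (t - x) * k" by (rule mult_mono) (use 2 assms in auto)
    then show ?thesis using * by (simp add: trapezoid_def quad_step_1)
  qed
qed

lemma abs_trapezoid_le: "\<bar>trapezoid k x y t\<bar> \<le> 1"
  using quad_step_bounds[of "(t - x) * k"] quad_step_bounds[of "(t - y) * k"]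
  by (simp add: trapezoid_def)

lemma test_function_trapezoid:
  assumes "1 \<le> k" "0 < x" "x \<le> y"
  shows "test_function (trapezoid k x y)"
  unfolding test_function_def
proof
  show "trapezoid k x y C1_differentiable_on UNIV"
    unfolding C1_differentiable_on_def
  proof (intro exI conjI ballI)
    show "(trapezoid k x y has_vector_derivative (tent ((t - x) * k) * k - tent ((t - y) * k) * k)) (at t)" for t
      using DERIV_trapezoid by (simp add: has_real_derivative_iff_has_vector_derivative)
    show "continuous_on UNIV (\<lambda>t. tent ((t - x) * k) * k - tent ((t - y) * k) * k)"
      by (intro continuous_intros continuous_on_compose2[OF continuous_tent[of UNIV]]) auto
  qed
  show "\<exists>a b. 0 < a \<and> (\<forall>t. t \<notin> {a..b} \<longrightarrow> trapezoid k x y t = 0)"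
    using trapezoid_support assms by blast
qed

lemma tendsto_trapezoid:
  assumes "x \<le> y"
  shows "(\<lambda>n. trapezoid (real (Suc n)) x y t) \<longlonglongrightarrow> indicator {x<..y} t"
proof -
  have ev: "(\<lambda>n. quad_step ((t - z) * real (Suc n))) \<longlonglongrightarrow> indicator {z<..} t" for z
  proof (cases "t \<le> z")
    case True
    then have "(t - z) * real (Suc n) \<le> 0" for n by (auto simp: mult_le_0_iff)
    then show ?thesis using True by (simp add: quad_step_0)
  next
    case False
    then have "filterlim (\<lambda>n. (t - z) * real (Suc n)) at_top sequentially"
      by real_asymp
    then have "\<forall>\<^sub>F n in sequentially. (t - z) * real (Suc n) \<ge> 1"
      by (simp add: filterlim_at_top)
    then have "\<forall>\<^sub>F n in sequentially. quad_step ((t - z) * real (Suc n)) = 1"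
      by eventually_elim (rule quad_step_1)
    then show ?thesis using False by (simp add: tendsto_eventually)
  qed
  have "indicator {x<..} t - indicator {y<..} t = (indicator {x<..y} t :: real)"
    using assms by (auto simp: indicator_def)
  then show ?thesis
    using tendsto_diff[OF ev[of x] ev[of y]] by (simp add: trapezoid_def)
qed

text \<open>
  Rescaling turns the average of f against the concentrating tent into an average of the values of
  f at points tending to x, and dominated convergence applies.
\<close>

lemma tendsto_tent_average:
  fixes f :: "real \<Rightarrow> complex"
  assumes f: "continuous_on {0..} f" and x: "0 < x"
  shows "(\<lambda>n. LBINT t:{0<..}. (tent ((t - x) * real (Suc n)) * real (Suc n)) *\<^sub>R f t) \<longlonglongrightarrow> f x"
proof -
  define F where "F t = indicator {0<..} t *\<^sub>R f t" for t
  have F[measurable]: "F \<in> borel_measurable borel"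
    unfolding F_def by (rule borel_measurable_continuous_on_indicator)
      (auto intro: continuous_on_subset[OF f])
  have tent_meas[measurable]: "tent \<in> borel_measurable borel"
    by (rule borel_measurable_continuous_onI) (rule continuous_tent)
  have "compact (f ` {x..x+1})"
    by (intro compact_continuous_image continuous_on_subset[OF f]) (use x in auto)
  then obtain B where B: "\<And>t. t \<in> {x..x+1} \<Longrightarrow> norm (f t) \<le> B"
    using compact_imp_bounded bounded_iff by (metis image_eqI)
  have eq': "(LBINT t:{0<..}. (tent ((t - x) * k) * k) *\<^sub>R f t) = (LBINT s. tent s *\<^sub>R F (x + (1 / k) * s))"
    if k: "k > 0" for k :: real
  proof -
    have "(LBINT t:{0<..}. (tent ((t - x) * k) * k) *\<^sub>R f t)
      = (1 / k) *\<^sub>R (LBINT s. (tent ((x + (1 / k) * s - x) * k) * k) *\<^sub>R F (x + (1 / k) * s))"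
      unfolding set_lebesgue_integral_def
      by (subst lborel_integral_real_affine[where c = "1 / k" and t = x])
         (use k in \<open>auto simp: F_def mult.commute\<close>)
    also have "\<dots> = (LBINT s. (1 / k) *\<^sub>R (tent ((x + (1 / k) * s - x) * k) * k) *\<^sub>R F (x + (1 / k) * s))"
      by (rule integral_scaleR_right[symmetric])
    also have "\<dots> = (LBINT s. tent s *\<^sub>R F (x + (1 / k) * s))"
      using k by (intro Bochner_Integration.integral_cong) auto
    finally show ?thesis .
  qed
  have eq: "(LBINT t:{0<..}. (tent ((t - x) * real (Suc n)) * real (Suc n)) *\<^sub>R f t)
     = (LBINT s. tent s *\<^sub>R F (x + (1 / real (Suc n)) * s))" for n
    by (rule eq') simp
  have "(\<lambda>n. LBINT s. tent s *\<^sub>R F (x + (1 / real (Suc n)) * s)) \<longlonglongrightarrow> (LBINT s. tent s *\<^sub>R f x)"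
  proof (rule integral_dominated_convergence[where w = "\<lambda>s. indicator {0..1} s *\<^sub>R (2 * B)"])
    show "integrable lborel (\<lambda>s. indicator {0..1::real} s *\<^sub>R (2 * B))"
      by (intro integrable_scaleR_left) auto
    have cf: "isCont f x" using f x by (simp add: continuous_on_interior)
    show "AE s in lborel. (\<lambda>n. tent s *\<^sub>R F (x + 1 / real (Suc n) * s)) \<longlonglongrightarrow> tent s *\<^sub>R f x"
    proof (intro AE_I2)
      fix s :: real
      have l: "(\<lambda>n. x + 1 / real (Suc n) * s) \<longlonglongrightarrow> x" by real_asymp
      have "(\<lambda>n. f (x + 1 / real (Suc n) * s)) \<longlonglongrightarrow> f x"
        by (rule isCont_tendsto_compose[OF cf l])
      moreover have "\<forall>\<^sub>F n in sequentially. x + 1 / real (Suc n) * s > 0"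
        using order_tendstoD(1)[OF l x] .
      then have "\<forall>\<^sub>F n in sequentially. f (x + 1 / real (Suc n) * s) = F (x + 1 / real (Suc n) * s)"
        by eventually_elim (simp add: F_def)
      ultimately have "(\<lambda>n. F (x + 1 / real (Suc n) * s)) \<longlonglongrightarrow> f x"
        by (rule Lim_transform_eventually)
      then show "(\<lambda>n. tent s *\<^sub>R F (x + 1 / real (Suc n) * s)) \<longlonglongrightarrow> tent s *\<^sub>R f x"
        by (intro tendsto_intros)
    qed
    show "AE s in lborel. norm (tent s *\<^sub>R F (x + 1 / real (Suc n) * s)) \<le> indicator {0..1} s *\<^sub>R (2 * B)" for n
    proof (intro AE_I2)
      fix s :: real
      show "norm (tent s *\<^sub>R F (x + 1 / real (Suc n) * s)) \<le> indicator {0..1} s *\<^sub>R (2 * B)"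
      proof (cases "s \<in> {0..1}")
        case True
        have "1 / real (Suc n) * s \<le> 1 * 1" by (rule mult_mono) (use True in auto)
        then have "x + 1 / real (Suc n) * s \<in> {x..x+1}" using True by auto
        from B[OF this] have "norm (F (x + 1 / real (Suc n) * s)) \<le> B"
          using order_trans[OF norm_ge_zero B[OF \<open>_ \<in> {x..x+1}\<close>]] by (auto simp: F_def indicator_def)
        then show ?thesis using True tent_bounds[of s]
          by (auto intro!: mult_mono simp: abs_of_nonneg)
      qed (simp add: tent_0)
    qed
  qed (auto intro!: measurable_compose[OF _ F])
  moreover have "(LBINT s. tent s *\<^sub>R f x) = f x"
  proof -
    have "integrable lborel tent" using integral_tent not_integrable_integral_eq by fastforce
    then have "(LBINT s. tent s *\<^sub>R f x) = (LBINT s. tent s) *\<^sub>R f x"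
      by (rule integral_scaleR_left)
    then show ?thesis by (simp add: integral_tent)
  qed
  ultimately show ?thesis by (simp only: eq)
qed

text \<open>
  Testing with trapezoids: one side of the weak formulation tends to f x - f y by continuity, the
  other to the integral of h by dominated convergence.
\<close>

lemma du_Bois_Reymond:
  assumes w: "has_weak_deriv f h" and f: "continuous_on {0..} f" and xy: "0 < x" "x \<le> y"
  shows "f y - f x = (LBINT t:{x<..y}. h t)"
proof -
  let ?\<phi> = "\<lambda>n. trapezoid (real (Suc n)) x y"
  have lf: "set_integrable lborel {a..b} f" and lh: "set_integrable lborel {a..b} h" if "0 < a" for a b
    using w that by (auto simp: has_weak_deriv_def locally_integrable_halfline_def)
  have tf: "test_function (?\<phi> n)" for n by (rule test_function_trapezoid) (use xy in auto)
  have d: "deriv (?\<phi> n) t = tent ((t - x) * real (Suc n)) * real (Suc n) - tent ((t - y) * real (Suc n)) * real (Suc n)" for n t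
    using DERIV_trapezoid by (rule DERIV_imp_deriv)
  have int: "set_integrable lborel {0<..} (\<lambda>t. (tent ((t - z) * real (Suc n)) * real (Suc n)) *\<^sub>R f t)"
    if "0 < z" for n z
  proof -
    have fm: "(\<lambda>t. indicator {0<..} t *\<^sub>R f t) \<in> borel_measurable borel"
      by (rule borel_measurable_continuous_on_indicator) (auto intro: continuous_on_subset[OF f])
    have tent_meas[measurable]: "tent \<in> borel_measurable borel"
      by (rule borel_measurable_continuous_onI) (rule continuous_tent)
    have m: "(\<lambda>t. (tent ((t - z) * real (Suc n)) * real (Suc n)) *\<^sub>R (indicator {0<..} t *\<^sub>R f t)) \<in> borel_measurable borel"
      using fm by measurable
    have "integrable lborel (\<lambda>t. (tent ((t - z) * real (Suc n)) * real (Suc n)) *\<^sub>R (indicator {0<..} t *\<^sub>R f t))"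
    proof (rule Bochner_Integration.integrable_bound[where f = "\<lambda>t. (2 * real (Suc n)) *\<^sub>R (indicator {z..z+1} t *\<^sub>R f t)"])
      show "integrable lborel (\<lambda>t. (2 * real (Suc n)) *\<^sub>R (indicator {z..z+1} t *\<^sub>R f t))"
        using lf[OF that, of "z+1"] unfolding set_integrable_def by (rule integrable_scaleR_right)
      show "AE t in lborel. norm ((tent ((t - z) * real (Suc n)) * real (Suc n)) *\<^sub>R indicator {0<..} t *\<^sub>R f t)
          \<le> norm ((2 * real (Suc n)) *\<^sub>R indicator {z..z + 1} t *\<^sub>R f t)"
      proof (intro AE_I2)
        fix t
        show "norm ((tent ((t - z) * real (Suc n)) * real (Suc n)) *\<^sub>R indicator {0<..} t *\<^sub>R f t)
          \<le> norm ((2 * real (Suc n)) *\<^sub>R indicator {z..z + 1} t *\<^sub>R f t)"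
        proof (cases "t \<in> {z..z+1}")
          case True
          have "\<bar>tent ((t - z) * real (Suc n)) * real (Suc n)\<bar> \<le> 2 * real (Suc n)"
            using tent_bounds[of "(t - z) * real (Suc n)"] by (simp add: abs_mult mult_right_mono del: of_nat_Suc)
          from mult_right_mono[OF this norm_ge_zero[of "f t"]] show ?thesis
            using True that by (simp add: indicator_def del: of_nat_Suc)
        next
          case False
          have "tent ((t - z) * real (Suc n)) = 0"
          proof (rule tent_0, rule notI)
            assume a: "(t - z) * real (Suc n) \<in> {0..1}"
            then have "t \<ge> z" by (simp add: zero_le_mult_iff)
            then have "(t - z) * 1 \<le> (t - z) * real (Suc n)" by (intro mult_left_mono) auto
            moreover have "(t - z) * real (Suc n) \<le> 1" using a by simp
            ultimately have "(t - z) * 1 \<le> 1" by (rule order_trans)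
            with \<open>t \<ge> z\<close> False show False by auto
          qed
          then show ?thesis by simp
        qed
      qed
    qed (use m in simp)
    then show ?thesis unfolding set_integrable_def
      by (rule Bochner_Integration.integrable_cong[THEN iffD1, rotated 2]) (auto simp: mult.commute)
  qed
  have "(\<lambda>n. LBINT t:{0<..}. deriv (?\<phi> n) t *\<^sub>R f t) \<longlonglongrightarrow> f x - f y"
  proof -
    have "(LBINT t:{0<..}. deriv (?\<phi> n) t *\<^sub>R f t) =
       (LBINT t:{0<..}. (tent ((t - x) * real (Suc n)) * real (Suc n)) *\<^sub>R f t)
       - (LBINT t:{0<..}. (tent ((t - y) * real (Suc n)) * real (Suc n)) *\<^sub>R f t)" for n
      using int[of x n] int[of y n] xy unfolding d scaleR_diff_left by (intro set_integral_diff) auto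
    then show ?thesis using xy by (auto intro!: tendsto_diff tendsto_tent_average f simp del: of_nat_Suc)
  qed
  moreover have "(LBINT t:{0<..}. deriv (?\<phi> n) t *\<^sub>R f t) = - (LBINT t:{0<..}. ?\<phi> n t *\<^sub>R h t)" for n
    using w tf by (auto simp: has_weak_deriv_def)
  ultimately have 1: "(\<lambda>n. - (LBINT t:{0<..}. ?\<phi> n t *\<^sub>R h t)) \<longlonglongrightarrow> f x - f y" by simp
  have "(\<lambda>n. LBINT t:{0<..}. ?\<phi> n t *\<^sub>R h t) \<longlonglongrightarrow> (LBINT t:{x<..y}. h t)"
  proof -
    let ?H = "\<lambda>t. indicator {x..y+1} t *\<^sub>R h t"
    have H: "integrable lborel ?H" using lh[of x "y+1"] xy by (simp add: set_integrable_def)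
    then have Hm[measurable]: "?H \<in> borel_measurable borel" by auto
    have "(LBINT t:{0<..}. ?\<phi> n t *\<^sub>R h t) = (LBINT t. ?\<phi> n t *\<^sub>R ?H t)" for n
      unfolding set_lebesgue_integral_def
    proof (intro Bochner_Integration.integral_cong refl)
      fix t show "indicator {0<..} t *\<^sub>R ?\<phi> n t *\<^sub>R h t = ?\<phi> n t *\<^sub>R ?H t"
        using trapezoid_support[of "real (Suc n)" x y t] xy by (auto simp: indicator_def)
    qed
    moreover have "(LBINT t:{x<..y}. h t) = (LBINT t. indicator {x<..y} t *\<^sub>R ?H t)"
      unfolding set_lebesgue_integral_def by (intro Bochner_Integration.integral_cong) (auto simp: indicator_def)
    moreover have "(\<lambda>n. LBINT t. ?\<phi> n t *\<^sub>R ?H t) \<longlonglongrightarrow> (LBINT t. indicator {x<..y} t *\<^sub>R ?H t)"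
    proof (rule integral_dominated_convergence[where w = "\<lambda>t. norm (?H t)"])
      have "?\<phi> n \<in> borel_measurable borel" for n
        by (intro borel_measurable_continuous_onI continuous_at_imp_continuous_on ballI
              DERIV_isCont[OF DERIV_trapezoid])
      then show "(\<lambda>t. ?\<phi> n t *\<^sub>R ?H t) \<in> borel_measurable lborel" for n
        using Hm unfolding measurable_lborel2 by - (rule borel_measurable_scaleR)
      show "AE t in lborel. (\<lambda>n. ?\<phi> n t *\<^sub>R ?H t) \<longlonglongrightarrow> indicator {x<..y} t *\<^sub>R ?H t"
        by (intro AE_I2 tendsto_intros tendsto_trapezoid xy)
      show "AE t in lborel. norm (?\<phi> n t *\<^sub>R ?H t) \<le> norm (?H t)" for n
      proof (intro AE_I2)
        fix t
        have "norm (?\<phi> n t *\<^sub>R ?H t) = \<bar>?\<phi> n t\<bar> * norm (?H t)" by (rule norm_scaleR)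
        also have "\<dots> \<le> 1 * norm (?H t)"
          by (intro mult_right_mono abs_trapezoid_le norm_ge_zero)
        finally show "norm (?\<phi> n t *\<^sub>R ?H t) \<le> norm (?H t)" by simp
      qed
      show "integrable lborel (\<lambda>t. norm (?H t))" by (rule integrable_norm[OF H])
      show "(\<lambda>t. indicator {x<..y} t *\<^sub>R ?H t) \<in> borel_measurable lborel"
        unfolding measurable_lborel2 by (rule borel_measurable_scaleR[OF _ Hm]) simp
    qed
    ultimately show ?thesis by simp
  qed
  from tendsto_minus[OF this] have "- (LBINT t:{x<..y}. h t) = f x - f y"
    using 1 LIMSEQ_unique by blast
  then show ?thesis by (metis minus_diff_eq minus_minus)
qed

section \<open>Weak derivatives and absolutely continuous primitives\<close>

text \<open>
  Half-open intervals split disjointly; primitives are expressed with them for this reason.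
\<close>

lemma set_integral_Ioc_add:
  fixes f :: "real \<Rightarrow> 'a::{banach,second_countable_topology}"
  assumes "set_integrable lborel {a<..c} f" "a \<le> b" "b \<le> c"
  shows "(LBINT t:{a<..c}. f t) = (LBINT t:{a<..b}. f t) + (LBINT t:{b<..c}. f t)"
proof -
  have "{a<..c} = {a<..b} \<union> {b<..c}" using assms by auto
  moreover have "set_integrable lborel {a<..b} f" "set_integrable lborel {b<..c} f"
    using assms by (auto intro: set_integrable_subset)
  ultimately show ?thesis by (simp add: set_integral_Un)
qed

lemma set_integral_Ioc_Ioi_add:
  fixes f :: "real \<Rightarrow> 'a::{banach,second_countable_topology}"
  assumes "set_integrable lborel {a<..} f" "a \<le> b"
  shows "(LBINT t:{a<..}. f t) = (LBINT t:{a<..b}. f t) + (LBINT t:{b<..}. f t)"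
proof -
  have "{a<..} = {a<..b} \<union> {b<..}" using assms by auto
  moreover have "{a<..b} \<inter> {b<..} = {}" by auto
  moreover have "set_integrable lborel {a<..b} f" "set_integrable lborel {b<..} f"
    using assms by (auto intro: set_integrable_subset)
  ultimately show ?thesis using set_integral_Un by metis
qed

lemma set_integral_Ioc_eq_Icc:
  fixes f :: "real \<Rightarrow> 'a::{banach,second_countable_topology}"
  assumes "set_integrable lborel {a..b} f"
  shows "(LBINT t:{a<..b}. f t) = (LBINT t:{a..b}. f t)"
  unfolding set_lebesgue_integral_def
proof (rule integral_cong_AE)
  show "(\<lambda>t. indicator {a..b} t *\<^sub>R f t) \<in> borel_measurable lborel"
    using assms unfolding set_integrable_def by auto
  have "set_integrable lborel {a<..b} f"
    using assms by (rule set_integrable_subset) auto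
  then show "(\<lambda>t. indicator {a<..b} t *\<^sub>R f t) \<in> borel_measurable lborel"
    unfolding set_integrable_def by auto
  have "AE t in lborel. t \<noteq> a" by (rule AE_lborel_singleton)
  then show "AE t in lborel. indicator {a<..b} t *\<^sub>R f t = indicator {a..b} t *\<^sub>R f t"
    by eventually_elim (auto simp: indicator_def)
qed

lemma tendsto_set_integral_Ioc_at_top:
  fixes f :: "real \<Rightarrow> 'a::{banach,second_countable_topology}"
  assumes "set_integrable lborel {a<..} f"
  shows "((\<lambda>y. LBINT t:{a<..y}. f t) \<longlongrightarrow> (LBINT t:{a<..}. f t)) at_top"
proof -
  have "((\<lambda>y. LBINT t. indicator {..y} t *\<^sub>R (indicator {a<..} t *\<^sub>R f t)) \<longlongrightarrow>
      (LBINT t. indicator {a<..} t *\<^sub>R f t)) at_top"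
    by (rule tendsto_integral_at_top) (use assms in \<open>auto simp: set_integrable_def\<close>)
  moreover have "(LBINT t. indicator {..y} t *\<^sub>R (indicator {a<..} t *\<^sub>R f t)) = (LBINT t:{a<..y}. f t)" for y
    unfolding set_lebesgue_integral_def
    by (intro Bochner_Integration.integral_cong) (auto simp: indicator_def)
  ultimately show ?thesis by (simp add: set_lebesgue_integral_def)
qed

lemma set_integrable_continuous_Icc:
  fixes f :: "real \<Rightarrow> 'a::{banach,second_countable_topology}"
  assumes "continuous_on {a..b} f"
  shows "set_integrable lborel {a..b} f"
  using borel_integrable_compact[OF compact_Icc assms] unfolding set_integrable_def .

lemma set_integrable_mult_continuous:
  fixes k :: "real \<Rightarrow> real"
  assumes k: "set_integrable lborel {a<..b} k" and c: "continuous_on {a..b} c"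
  shows "set_integrable lborel {a<..b} (\<lambda>t. c t * k t)"
proof -
  have "bounded (c ` {a..b})"
    by (intro compact_imp_bounded compact_continuous_image c compact_Icc)
  then obtain B where B: "\<And>t. t \<in> {a..b} \<Longrightarrow> norm (c t) \<le> B"
    unfolding bounded_iff by blast
  have cm[measurable]: "(\<lambda>t. indicator {a..b} t *\<^sub>R c t) \<in> borel_measurable borel"
    by (rule borel_measurable_continuous_on_indicator) (use c in auto)
  have km[measurable]: "(\<lambda>t. indicator {a<..b} t *\<^sub>R k t) \<in> borel_measurable borel"
    using k by (auto simp: set_integrable_def)
  have eq: "(\<lambda>t. indicator {a<..b} t *\<^sub>R (c t * k t)) = (\<lambda>t. (indicator {a..b} t *\<^sub>R c t) * (indicator {a<..b} t *\<^sub>R k t))"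
    by (auto simp: indicator_def fun_eq_iff)
  show ?thesis unfolding set_integrable_def
  proof (rule Bochner_Integration.integrable_bound[where f = "\<lambda>t. B * (indicator {a<..b} t *\<^sub>R k t)"])
    show "integrable lborel (\<lambda>t. B * (indicator {a<..b} t *\<^sub>R k t))"
      using k by (simp add: set_integrable_def)
    show "(\<lambda>t. indicator {a<..b} t *\<^sub>R (c t * k t)) \<in> borel_measurable lborel"
      unfolding eq using cm km by measurable
    show "AE t in lborel. norm (indicator {a<..b} t *\<^sub>R (c t * k t)) \<le> norm (B * (indicator {a<..b} t *\<^sub>R k t))"
    proof (intro AE_I2)
      fix t show "norm (indicator {a<..b} t *\<^sub>R (c t * k t)) \<le> norm (B * (indicator {a<..b} t *\<^sub>R k t))"
        using order_trans[OF B abs_ge_self[of B], of t] by (auto simp: indicator_def abs_mult intro: mult_right_mono)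
    qed
  qed
qed

text \<open>
  Absolute continuity in integrated form, up to and including the origin.
\<close>

definition ac_primitive :: "(real \<Rightarrow> 'a::{banach,second_countable_topology}) \<Rightarrow> (real \<Rightarrow> 'a) \<Rightarrow> bool" where
  "ac_primitive f h \<longleftrightarrow> (\<forall>x y. 0 \<le> x \<longrightarrow> x \<le> y \<longrightarrow>
     set_integrable lborel {x<..y} h \<and> f y - f x = (LBINT t:{x<..y}. h t))"

lemma ac_primitiveD:
  assumes "ac_primitive f h" "0 \<le> x" "x \<le> y"
  shows "set_integrable lborel {x<..y} h" "f y - f x = (LBINT t:{x<..y}. h t)"
  using assms by (auto simp: ac_primitive_def)

lemma L2_halfline_integrable:
  assumes "L2_halfline h" "0 \<le> x"
  shows "set_integrable lborel {x<..y} h"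
proof -
  have m: "(\<lambda>t. indicator {x<..y} t *\<^sub>R h t) \<in> borel_measurable lborel"
  proof -
    have "(\<lambda>t. indicator {x<..y} t *\<^sub>R (indicator {0<..} t *\<^sub>R h t)) \<in> borel_measurable lborel"
      using assms(1) unfolding L2_halfline_def set_borel_measurable_def measurable_lborel2
      by (elim conjE) (rule borel_measurable_scaleR, simp)
    then show ?thesis
      by (rule measurable_cong[THEN iffD1, rotated]) (use assms(2) in \<open>auto simp: indicator_def\<close>)
  qed
  have "integrable lborel (indicat_real {x<..y})"
    by (cases "x \<le> y") (auto intro!: integrable_real_indicator)
  then have "integrable lborel (\<lambda>t. indicator {x<..y} t + indicator {0<..} t *\<^sub>R (norm (h t))\<^sup>2)"
    using assms(1) unfolding L2_halfline_def set_integrable_def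
    by (intro Bochner_Integration.integrable_add) auto
  then show ?thesis unfolding set_integrable_def
  proof (rule Bochner_Integration.integrable_bound[OF _ m], intro AE_I2)
    fix t
    have "2 * norm (h t) \<le> 1 + (norm (h t))\<^sup>2"
      using zero_le_power2[of "norm (h t) - 1"] unfolding power2_diff by simp
    then have "norm (h t) \<le> 1 + (norm (h t))\<^sup>2" using norm_ge_zero[of "h t"] by linarith
    then show "norm (indicator {x<..y} t *\<^sub>R h t) \<le> norm (indicator {x<..y} t + indicator {0<..} t *\<^sub>R (norm (h t))\<^sup>2)"
      using assms(2) by (auto simp: indicator_def)
  qed
qed

text \<open>
  Square integrability of h up to the origin allows the left end point to tend to 0.
\<close>

lemma weak_deriv_ac_primitive:
  assumes w: "has_weak_deriv f h" and f: "continuous_on {0..} f" and h: "L2_halfline h"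
  shows "ac_primitive f h"
  unfolding ac_primitive_def
proof (intro allI impI conjI)
  fix x y :: real assume xy: "0 \<le> x" "x \<le> y"
  show i: "set_integrable lborel {x<..y} h" by (rule L2_halfline_integrable) fact+
  show "f y - f x = (LBINT t:{x<..y}. h t)"
  proof (cases "0 < x")
    case True then show ?thesis using du_Bois_Reymond w f xy by blast
  next
    case False
    then have x: "x = 0" using xy by simp
    show ?thesis
    proof (cases "y = 0")
      case True
      then show ?thesis using x by (simp add: set_lebesgue_integral_def)
    next
      case False
      then have y: "0 < y" using xy by simp
      have "((\<lambda>a. LBINT t:{a..y}. h t) \<longlongrightarrow> (LBINT t:{0<..y}. h t)) (at_right 0)"
        using i x by (intro tendsto_set_lebesgue_integral_at_right y) auto
      moreover have "((\<lambda>a. LBINT t:{a..y}. h t) \<longlongrightarrow> f y - f 0) (at_right 0)"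
      proof (rule Lim_transform_eventually)
        have "(f \<longlongrightarrow> f 0) (at 0 within {0..})" using f by (simp add: continuous_on)
        then have "(f \<longlongrightarrow> f 0) (at_right 0)" by (rule tendsto_within_subset) auto
        then show "((\<lambda>a. f y - f a) \<longlongrightarrow> f y - f 0) (at_right 0)" by (intro tendsto_intros)
        show "\<forall>\<^sub>F a in at_right 0. f y - f a = (LBINT t:{a..y}. h t)"
          using eventually_at_right_real[OF y]
        proof eventually_elim
          case (elim a)
          then have "set_integrable lborel {a..y} h"
            using w by (simp add: has_weak_deriv_def locally_integrable_halfline_def)
          then show ?case using du_Bois_Reymond[OF w f, of a y] elim by (simp add: set_integral_Ioc_eq_Icc)
        qed
      qed
      ultimately show ?thesis using x tendsto_unique trivial_limit_at_right_real by metis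
    qed
  qed
qed

text \<open>
  Half-open intervals are stable under intersection and generate the Borel sets, so the integral
  vanishes over every Borel set.
\<close>

lemma AE_zero_of_Ioc_integrals:
  fixes d :: "real \<Rightarrow> complex"
  assumes d: "integrable lborel d" and supp: "\<And>t. t \<notin> {a0<..b0} \<Longrightarrow> d t = 0"
    and 0: "\<And>a b. (LBINT t:{a<..b}. d t) = 0"
  shows "AE t in lborel. d t = 0"
proof (rule sigma_finite_measure.density_zero[OF _ d])
  show "sigma_finite_measure (lborel :: real measure)" by (rule sigma_finite_lborel)
  have si: "set_integrable lborel A d" if "A \<in> sets borel" for A
    using that d unfolding set_integrable_def by (intro integrable_mult_indicator) auto
  have UN: "(LBINT t:(\<Union>i. A i). d t) = (\<Sum>i. LBINT t:A i. d t)"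
    if "range A \<subseteq> sets borel" "disjoint_family A" for A :: "nat \<Rightarrow> real set"
    using that by (intro lebesgue_integral_countable_add si) (auto simp: disjoint_family_on_def)
  have "(LBINT t:UNIV. d t) = (LBINT t:{a0<..b0}. d t)"
    unfolding set_lebesgue_integral_def
    by (intro Bochner_Integration.integral_cong) (use supp in \<open>auto simp: indicator_def\<close>)
  then have tot: "(LBINT t:UNIV. d t) = 0" using 0 by simp
  fix A :: "real set" assume "A \<in> sets lborel"
  then have A: "A \<in> sigma_sets UNIV (range (\<lambda>(a::real,b). {a<..b}))"
    by (simp add: borel_sigma_sets_Ioc)
  have stable: "Int_stable (range (\<lambda>(a::real,b). {a<..b}))"
  proof (rule Int_stableI)
    fix S T assume "S \<in> range (\<lambda>(a::real,b). {a<..b})" "T \<in> range (\<lambda>(a::real,b). {a<..b})"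
    then obtain a b c e where "S = {a<..b}" "T = {c<..e}" by auto
    then have "S \<inter> T = (\<lambda>(a,b). {a<..b}) (max a c, min b e)" by auto
    then show "S \<inter> T \<in> range (\<lambda>(a::real,b). {a<..b})" by blast
  qed
  have "range (\<lambda>(a::real,b). {a<..b}) \<subseteq> Pow UNIV" by simp
  from stable this A show "(LBINT t:A. d t) = 0"
  proof (induction rule: sigma_sets_induct_disjoint)
    case (basic A) then show ?case using 0 by auto
  next
    case empty then show ?case by (simp add: set_lebesgue_integral_def)
  next
    case (compl A)
    then have A: "A \<in> sets borel" by (simp add: borel_sigma_sets_Ioc)
    have "(UNIV :: real set) = A \<union> (UNIV - A)" by auto
    then have "(LBINT t:UNIV. d t) = (LBINT t:A. d t) + (LBINT t:(UNIV - A). d t)"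
      using A set_integral_Un[of A "UNIV - A" lborel d] si by auto
    then show ?case using tot compl by simp
  next
    case (union A)
    have "range A \<subseteq> sets borel" using union(2) by (simp add: borel_sigma_sets_Ioc)
    then show ?case using UN union by simp
  qed
qed

lemma weak_deriv_AE_unique:
  assumes g: "has_weak_deriv f g" and h: "has_weak_deriv f h" and f: "continuous_on {0..} f"
  shows "AE t in lborel. 0 < t \<longrightarrow> g t = h t"
proof -
  have *: "AE t in lborel. t \<in> {1 / real (Suc n)<..real (Suc n)} \<longrightarrow> g t = h t" for n
  proof -
    let ?A = "{1 / real (Suc n)<..real (Suc n)}"
    let ?d = "\<lambda>t. indicator ?A t *\<^sub>R (g t - h t)"
    have loc: "set_integrable lborel {a<..b} g" "set_integrable lborel {a<..b} h" if "0 < a" for a b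
      using g h that
      by (auto simp: has_weak_deriv_def locally_integrable_halfline_def
               intro: set_integrable_subset[of _ "{a..b}"])
    have "AE t in lborel. ?d t = 0"
    proof (rule AE_zero_of_Ioc_integrals)
      have pos: "0 < 1 / real (Suc n)" by simp
      show "integrable lborel ?d"
        using set_integral_diff(1)[OF loc[OF pos, of "real (Suc n)"]] by (simp add: set_integrable_def)
      show "t \<notin> ?A \<Longrightarrow> ?d t = 0" for t by simp
      fix a b
      define x y where "x = max a (1 / real (Suc n))" and "y = min b (real (Suc n))"
      have x: "0 < x" unfolding x_def using pos by linarith
      have "(LBINT t:{a<..b}. ?d t) = (LBINT t:{x<..y}. g t - h t)"
        unfolding set_lebesgue_integral_def
        by (intro Bochner_Integration.integral_cong) (auto simp: indicator_def x_def y_def)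
      also have "\<dots> = (LBINT t:{x<..y}. g t) - (LBINT t:{x<..y}. h t)"
        by (intro set_integral_diff loc x)
      also have "\<dots> = 0"
        using du_Bois_Reymond[OF g f x] du_Bois_Reymond[OF h f x]
        by (cases "x \<le> y") (metis right_minus_eq, simp add: set_lebesgue_integral_def)
      finally show "(LBINT t:{a<..b}. ?d t) = 0" .
    qed
    then show ?thesis by eventually_elim auto
  qed
  have "AE t in lborel. \<forall>n. t \<in> {1 / real (Suc n)<..real (Suc n)} \<longrightarrow> g t = h t"
    using * by (simp only: AE_all_countable simp_thms)
  then show ?thesis
  proof eventually_elim
    case (elim t)
    show ?case
    proof
      assume t: "0 < t"
      obtain n where n: "max (1 / t) t < real n" using reals_Archimedean2 by blast
      then have "1 / t < real (Suc n)" "t \<le> real (Suc n)" by auto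
      moreover from this t have "1 / real (Suc n) < t" by (simp add: field_simps)
      ultimately show "g t = h t" using elim by auto
    qed
  qed
qed

text \<open>
  Local integrability provides measurability only on compact intervals; these exhaust the half-line.
\<close>

lemma locally_integrable_imp_measurable:
  assumes "locally_integrable_halfline h"
  shows "set_borel_measurable lborel {0<..} h"
  unfolding set_borel_measurable_def
proof (rule borel_measurable_LIMSEQ_metric)
  show "(\<lambda>t. indicator {1 / real (Suc n)..real (Suc n)} t *\<^sub>R h t) \<in> borel_measurable lborel" for n
    using assms unfolding locally_integrable_halfline_def set_integrable_def
    by (intro borel_measurable_integrable) (metis divide_pos_pos of_nat_0_less_iff zero_less_Suc zero_less_one)
  fix t :: real
  have "\<forall>\<^sub>F n in sequentially. indicat_real {1 / real (Suc n)..real (Suc n)} t = indicator {0<..} t"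
  proof (cases "0 < t")
    case True
    have "(\<lambda>n. 1 / real (Suc n)) \<longlonglongrightarrow> 0" by real_asymp
    from order_tendstoD(2)[OF this True] have 1: "\<forall>\<^sub>F n in sequentially. 1 / real (Suc n) < t" .
    have "filterlim (\<lambda>n. real (Suc n)) at_top sequentially" by real_asymp
    then have 2: "\<forall>\<^sub>F n in sequentially. t \<le> real (Suc n)" by (simp add: filterlim_at_top)
    show ?thesis using 1 2 by eventually_elim (use True in \<open>auto simp: indicator_def\<close>)
  next
    case False
    have "0 < 1 / real (Suc n)" for n by simp
    then have "t \<notin> {1 / real (Suc n)..real (Suc n)}" for n using False by (meson atLeastAtMost_iff less_le_trans)
    then show ?thesis using False by simp
  qed
  then have "\<forall>\<^sub>F n in sequentially. indicat_real {1 / real (Suc n)..real (Suc n)} t *\<^sub>R h t = indicator {0<..} t *\<^sub>R h t"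
    by eventually_elim simp
  then show "(\<lambda>n. indicat_real {1 / real (Suc n)..real (Suc n)} t *\<^sub>R h t) \<longlonglongrightarrow> indicator {0<..} t *\<^sub>R h t"
    by (rule tendsto_eventually)
qed

text \<open>
  The weak derivative is an arbitrary choice among all weak derivatives, so its square
  integrability has to be transferred from the one that is known to be square integrable.
\<close>

lemma H1_weak_deriv:
  assumes H: "H1_halfline f" and f: "continuous_on {0..} f"
  shows "has_weak_deriv f (weak_deriv f)" "L2_halfline (weak_deriv f)" "ac_primitive f (weak_deriv f)"
proof -
  obtain g where g: "has_weak_deriv f g" "L2_halfline g" using H by (auto simp: H1_halfline_def)
  show w: "has_weak_deriv f (weak_deriv f)" unfolding weak_deriv_def by (rule someI[of "has_weak_deriv f", OF g(1)])
  have m: "set_borel_measurable lborel {0<..} (weak_deriv f)"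
    using w by (intro locally_integrable_imp_measurable) (auto simp: has_weak_deriv_def)
  have m2: "(\<lambda>t. indicator {0<..} t *\<^sub>R (norm (weak_deriv f t))\<^sup>2) \<in> borel_measurable lborel"
  proof -
    have "(\<lambda>t. (norm (indicator {0<..} t *\<^sub>R weak_deriv f t))\<^sup>2) \<in> borel_measurable lborel"
      using m unfolding set_borel_measurable_def by measurable
    then show ?thesis
      by (rule measurable_cong[THEN iffD1, rotated]) (auto simp: indicator_def)
  qed
  have "integrable lborel (\<lambda>t. indicator {0<..} t *\<^sub>R (norm (weak_deriv f t))\<^sup>2)"
  proof (rule integrable_cong_AE_imp[OF _ m2])
    show "integrable lborel (\<lambda>t. indicator {0<..} t *\<^sub>R (norm (g t))\<^sup>2)"
      using g by (simp add: L2_halfline_def set_integrable_def)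
    show "AE t in lborel. indicator {0<..} t *\<^sub>R (norm (g t))\<^sup>2 = indicator {0<..} t *\<^sub>R (norm (weak_deriv f t))\<^sup>2"
      using weak_deriv_AE_unique[OF g(1) w f] by eventually_elim (auto simp: indicator_def)
  qed
  with m show L: "L2_halfline (weak_deriv f)"
    by (simp add: L2_halfline_def set_integrable_def)
  show "ac_primitive f (weak_deriv f)" by (rule weak_deriv_ac_primitive) fact+
qed

lemma set_integral_norm_sq_AE_cong:
  assumes "AE t in lborel. 0 < t \<longrightarrow> g t = h t" "L2_halfline g" "L2_halfline h"
  shows "(LBINT t:{0<..}. (norm (g t))\<^sup>2) = (LBINT t:{0<..}. (norm (h t :: complex))\<^sup>2)"
  unfolding set_lebesgue_integral_def
proof (rule integral_cong_AE)
  show "AE t in lborel. indicator {0<..} t *\<^sub>R (norm (g t))\<^sup>2 = indicator {0<..} t *\<^sub>R (norm (h t))\<^sup>2"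
    using assms(1) by eventually_elim (auto simp: indicator_def)
qed (use assms(2,3) in \<open>auto simp: L2_halfline_def set_integrable_def\<close>)

text \<open>
  Integration by parts; the interval is taken slightly larger than the support of the test function,
  so that the boundary terms vanish.
\<close>

lemma C1_has_weak_deriv:
  assumes D: "\<And>x. (f has_vector_derivative f' x) (at x)" and c: "continuous_on UNIV f'"
  shows "has_weak_deriv f f'"
proof -
  have cf: "continuous_on S f" for S
    using D by (meson continuous_at_imp_continuous_on has_vector_derivative_continuous)
  have cf': "continuous_on S f'" for S using c continuous_on_subset by blast
  show ?thesis unfolding has_weak_deriv_def locally_integrable_halfline_def
  proof (intro conjI allI impI)
    show "set_integrable lborel {a..b} f" "set_integrable lborel {a..b} f'" for a b
      by (intro set_integrable_continuous_Icc cf cf')+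
    fix \<phi> assume "test_function \<phi>"
    then obtain a b where ab: "0 < a" "\<And>x. x \<notin> {a..b} \<Longrightarrow> \<phi> x = 0" and C1: "\<phi> C1_differentiable_on UNIV"
      by (auto simp: test_function_def)
    from C1 obtain D' where D': "\<And>x. (\<phi> has_vector_derivative D' x) (at x)" and cD': "continuous_on UNIV D'"
      by (auto simp: C1_differentiable_on_def)
    have dD: "deriv \<phi> x = D' x" for x
      using D' by (intro DERIV_imp_deriv) (simp add: has_real_derivative_iff_has_vector_derivative)
    have D'0: "D' x = 0" if "x \<notin> {a..b}" for x
    proof -
      have "((\<lambda>_. 0) has_vector_derivative D' x) (at x)"
        by (rule has_vector_derivative_transform_within_open[OF D', where S = "- {a..b}"])
           (use that ab in auto)
      then show ?thesis
        using vector_derivative_unique_at has_vector_derivative_const by blast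
    qed
    define A B where "A = a / 2" and "B = max a b + 1"
    have AB: "0 < A" "A < a" "b < B" "A < B" using ab(1) unfolding A_def B_def by auto
    have c1: "continuous_on {A..B} (\<lambda>x. D' x *\<^sub>R f x)" "continuous_on {A..B} (\<lambda>x. \<phi> x *\<^sub>R f' x)"
      using D' by (auto intro!: continuous_intros cf cf' continuous_on_subset[OF cD']
            intro: continuous_at_imp_continuous_on has_vector_derivative_continuous)
    have "(LBINT x. indicator {A..B} x *\<^sub>R (D' x *\<^sub>R f x + \<phi> x *\<^sub>R f' x)) = \<phi> B *\<^sub>R f B - \<phi> A *\<^sub>R f A"
    proof (rule integral_FTC_Icc)
      show "((\<lambda>x. \<phi> x *\<^sub>R f x) has_vector_derivative D' x *\<^sub>R f x + \<phi> x *\<^sub>R f' x) (at x within {A..B})" for x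
        using has_vector_derivative_scaleR[OF D'[of x, THEN has_vector_derivative_at_within, unfolded has_real_derivative_iff_has_vector_derivative[symmetric]] D[of x, THEN has_vector_derivative_at_within]]
        by (simp add: add.commute)
      show "continuous_on {A..B} (\<lambda>x. D' x *\<^sub>R f x + \<phi> x *\<^sub>R f' x)"
        by (intro continuous_intros c1)
    qed (use AB in auto)
    also have "\<dots> = 0" using ab(2)[of A] ab(2)[of B] AB by simp
    finally have "(LBINT x:{A..B}. D' x *\<^sub>R f x + \<phi> x *\<^sub>R f' x) = 0"
      by (simp add: set_lebesgue_integral_def)
    then have "(LBINT x:{A..B}. D' x *\<^sub>R f x) + (LBINT x:{A..B}. \<phi> x *\<^sub>R f' x) = 0"
      using c1 by (subst (asm) set_integral_add(2)) (auto intro: set_integrable_continuous_Icc)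
    moreover have "(LBINT x:{0<..}. D' x *\<^sub>R f x) = (LBINT x:{A..B}. D' x *\<^sub>R f x)"
      unfolding set_lebesgue_integral_def
      by (intro Bochner_Integration.integral_cong) (use AB D'0 in \<open>auto simp: indicator_def\<close>)
    moreover have "(LBINT x:{0<..}. \<phi> x *\<^sub>R f' x) = (LBINT x:{A..B}. \<phi> x *\<^sub>R f' x)"
      unfolding set_lebesgue_integral_def
      by (intro Bochner_Integration.integral_cong) (use AB ab in \<open>auto simp: indicator_def\<close>)
    ultimately show "(LBINT x:{0<..}. deriv \<phi> x *\<^sub>R f x) = - (LBINT x:{0<..}. \<phi> x *\<^sub>R f' x)"
      by (simp add: dD eq_neg_iff_add_eq_0)
  qed
qed

lemma C1_H1_halfline:
  assumes D: "\<And>x. (f has_vector_derivative f' x) (at x)" and c: "continuous_on UNIV f'"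
    and L: "L2_halfline f" "L2_halfline f'"
  shows "H1_halfline f"
    "(LBINT t:{0<..}. (norm (weak_deriv f t))\<^sup>2) = (LBINT t:{0<..}. (norm (f' t))\<^sup>2)"
proof -
  have w: "has_weak_deriv f f'" by (rule C1_has_weak_deriv) fact+
  show H: "H1_halfline f" using w L by (auto simp: H1_halfline_def)
  have cf: "continuous_on {0..} f"
    using D by (meson continuous_at_imp_continuous_on has_vector_derivative_continuous)
  show "(LBINT t:{0<..}. (norm (weak_deriv f t))\<^sup>2) = (LBINT t:{0<..}. (norm (f' t))\<^sup>2)"
    by (intro set_integral_norm_sq_AE_cong weak_deriv_AE_unique[OF _ w cf] H1_weak_deriv[OF H cf] L)
qed

section \<open>The chain rule without pointwise derivatives\<close>

lemma continuous_on_realD: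
  fixes f :: "real \<Rightarrow> real"
  assumes "continuous_on S f" "x \<in> S" "0 < e"
  obtains d where "0 < d" "\<And>s. s \<in> S \<Longrightarrow> \<bar>s - x\<bar> < d \<Longrightarrow> \<bar>f s - f x\<bar> < e"
proof -
  have "\<exists>d>0. \<forall>s\<in>S. \<bar>s - x\<bar> < d \<longrightarrow> \<bar>f s - f x\<bar> < e"
    using assms unfolding continuous_on_iff dist_real_def by (elim ballE allE impE) auto
  then show ?thesis using that by (elim exE conjE) auto
qed

text \<open>
  By bisection the local estimates add up to the same estimate on the whole interval, and then the
  factor \<epsilon> tends to 0.
\<close>

lemma additive_nonpos_from_local:
  fixes \<Phi> :: "real \<Rightarrow> real \<Rightarrow> real" and k :: "real \<Rightarrow> real"
  assumes add: "\<And>a b c. x \<le> a \<Longrightarrow> a \<le> b \<Longrightarrow> b \<le> c \<Longrightarrow> c \<le> y \<Longrightarrow> \<Phi> a c = \<Phi> a b + \<Phi> b c"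
    and k: "set_integrable lborel {x<..y} k" and xy: "x \<le> y"
    and loc: "\<And>\<epsilon> z. 0 < \<epsilon> \<Longrightarrow> x \<le> z \<Longrightarrow> z \<le> y \<Longrightarrow>
      \<exists>d>0. \<forall>a b. x \<le> a \<and> b \<le> y \<and> a \<le> z \<and> z \<le> b \<and> b - a < d \<longrightarrow> \<Phi> a b \<le> \<epsilon> * (LBINT t:{a<..b}. k t)"
  shows "\<Phi> x y \<le> 0"
proof -
  have *: "\<Phi> x y \<le> \<epsilon> * (LBINT t:{x<..y}. k t)" if e: "0 < \<epsilon>" for \<epsilon>
  proof -
    define P where "P a b \<longleftrightarrow> (x \<le> a \<and> b \<le> y \<longrightarrow> \<Phi> a b \<le> \<epsilon> * (LBINT t:{a<..b}. k t))" for a b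
    have "P x y" using xy
    proof (induction rule: Bolzano)
      case (trans a b c)
      show ?case unfolding P_def
      proof
        assume ac: "x \<le> a \<and> c \<le> y"
        have "set_integrable lborel {a<..c} k"
          by (rule set_integrable_subset[OF k]) (use ac in auto)
        then have "(LBINT t:{a<..c}. k t) = (LBINT t:{a<..b}. k t) + (LBINT t:{b<..c}. k t)"
          using trans(3,4) by (rule set_integral_Ioc_add)
        moreover have "\<Phi> a b \<le> \<epsilon> * (LBINT t:{a<..b}. k t)" "\<Phi> b c \<le> \<epsilon> * (LBINT t:{b<..c}. k t)"
          using trans(1,2)[unfolded P_def] ac trans(3,4) by auto
        moreover have "\<Phi> a c = \<Phi> a b + \<Phi> b c" using ac trans(3,4) by (intro add) auto
        ultimately show "\<Phi> a c \<le> \<epsilon> * (LBINT t:{a<..c}. k t)" by (simp add: distrib_left)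
      qed
    next
      case (local z)
      from loc[OF e local] obtain d where d: "d > 0"
        and "\<forall>a b. x \<le> a \<and> b \<le> y \<and> a \<le> z \<and> z \<le> b \<and> b - a < d \<longrightarrow> \<Phi> a b \<le> \<epsilon> * (LBINT t:{a<..b}. k t)"
        by (elim exE conjE)
      then have "\<forall>a b. a \<le> z \<and> z \<le> b \<and> b - a < d \<longrightarrow> P a b" unfolding P_def by simp
      with d show ?case by (intro exI[of _ d] conjI)
    qed
    then show ?thesis unfolding P_def by simp
  qed
  show ?thesis
  proof (rule field_le_epsilon)
    fix e :: real assume "0 < e"
    define K where "K = \<bar>LBINT t:{x<..y}. k t\<bar> + 1"
    have K: "K > 0" by (simp add: K_def)
    have "\<Phi> x y \<le> (e / K) * (LBINT t:{x<..y}. k t)" using \<open>0 < e\<close> K by (intro *) simp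
    also have "\<dots> \<le> (e / K) * K" using \<open>0 < e\<close> K by (intro mult_left_mono) (auto simp: K_def)
    finally show "\<Phi> x y \<le> 0 + e" using K by simp
  qed
qed

lemma mean_value_halfline:
  fixes G g :: "real \<Rightarrow> real"
  assumes G: "\<And>t. 0 \<le> t \<Longrightarrow> (G has_real_derivative g t) (at t within {0..})"
    and s: "0 \<le> s" "0 \<le> t"
  obtains \<xi> where "min s t \<le> \<xi>" "\<xi> \<le> max s t" "G t - G s = g \<xi> * (t - s)"
proof -
  have *: "\<exists>\<xi>\<in>{a<..<b}. G b - G a = g \<xi> * (b - a)" if ab: "0 \<le> a" "a < b" for a b
  proof (rule mvt_simple[OF ab(2)])
    fix x assume x: "a \<le> x" "x \<le> b"
    have "(G has_real_derivative g x) (at x within {0..})" by (rule G) (use x ab in auto)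
    then have "(G has_real_derivative g x) (at x within {a..b})"
      by (rule DERIV_subset) (use ab in auto)
    then show "(G has_derivative (*) (g x)) (at x within {a..b})"
      by (simp add: has_field_derivative_def)
  qed
  consider "s < t" | "t < s" | "s = t" by linarith
  then show ?thesis
  proof cases
    case 1
    from *[OF s(1) 1] obtain \<xi> where "\<xi> \<in> {s<..<t}" "G t - G s = g \<xi> * (t - s)" by (elim bexE)
    then show ?thesis by (intro that[of \<xi>]) simp_all
  next
    case 2
    from *[OF s(2) 2] obtain \<xi> where \<xi>: "\<xi> \<in> {t<..<s}" "G s - G t = g \<xi> * (s - t)" by (elim bexE)
    have "G t - G s = - (g \<xi> * (s - t))" using \<xi>(2) by linarith
    also have "\<dots> = g \<xi> * (t - s)" by (simp add: right_diff_distrib)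
    finally show ?thesis using \<xi>(1) by (intro that[of \<xi>]) simp_all
  next
    case 3
    then show ?thesis by (intro that[of s]) simp_all
  qed
qed

text \<open>
  The chain rule as an inequality, for increments of r bounded on one side by an integral. On a
  short interval the mean value theorem replaces g by a nearby value of g along r, with an error that
  the previous lemma absorbs. The factor \<sigma> is used with the values 1 and -1.
\<close>

lemma chain_rule_one_sided:
  fixes r \<phi> g G :: "real \<Rightarrow> real" and \<sigma> :: real
  assumes G: "\<And>t. 0 \<le> t \<Longrightarrow> (G has_real_derivative g t) (at t within {0..})"
    and g: "continuous_on {0..} g" "\<And>t. 0 \<le> t \<Longrightarrow> 0 \<le> g t"
    and r: "continuous_on {x..y} r" "\<And>t. t \<in> {x..y} \<Longrightarrow> 0 \<le> r t"
    and \<phi>: "set_integrable lborel {x<..y} \<phi>"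
    and r\<phi>: "\<And>s t. x \<le> s \<Longrightarrow> s \<le> t \<Longrightarrow> t \<le> y \<Longrightarrow> \<sigma> * (r t - r s) \<le> (LBINT \<tau>:{s<..t}. \<phi> \<tau>)"
    and xy: "x \<le> y"
  shows "\<sigma> * (G (r y) - G (r x)) \<le> (LBINT t:{x<..y}. g (r t) * \<phi> t)"
proof -
  let ?k = "\<lambda>t. \<bar>\<phi> t\<bar>"
  have \<phi>i: "set_integrable lborel {a<..b} \<phi>" if "x \<le> a" "b \<le> y" for a b
    by (rule set_integrable_subset[OF \<phi>]) (use that in auto)
  have cgr: "continuous_on {x..y} (\<lambda>t. g (r t))"
    by (rule continuous_on_compose2[OF g(1) r(1)]) (use r in auto)
  have g\<phi>i: "set_integrable lborel {a<..b} (\<lambda>t. g (r t) * \<phi> t)" if "x \<le> a" "b \<le> y" for a b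
    by (rule set_integrable_mult_continuous[OF \<phi>i[OF that]])
       (rule continuous_on_subset[OF cgr], use that in auto)
  have "\<sigma> * (G (r y) - G (r x)) - (LBINT t:{x<..y}. g (r t) * \<phi> t) \<le> 0"
  proof (rule additive_nonpos_from_local[where k = ?k
        and \<Phi> = "\<lambda>a b. \<sigma> * (G (r b) - G (r a)) - (LBINT t:{a<..b}. g (r t) * \<phi> t)"])
    fix a b c assume "x \<le> a" "a \<le> b" "b \<le> c" "c \<le> y"
    then show "\<sigma> * (G (r c) - G (r a)) - (LBINT t:{a<..c}. g (r t) * \<phi> t) =
       \<sigma> * (G (r b) - G (r a)) - (LBINT t:{a<..b}. g (r t) * \<phi> t)
       + (\<sigma> * (G (r c) - G (r b)) - (LBINT t:{b<..c}. g (r t) * \<phi> t))"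
      using set_integral_Ioc_add[OF g\<phi>i, of a c b] by (simp add: algebra_simps)
  next
    fix \<epsilon> z :: real assume e: "0 < \<epsilon>" and z: "x \<le> z" "z \<le> y"
    have rz: "0 \<le> r z" using r z by auto
    obtain e1 where e1: "e1 > 0" "\<And>s. s \<in> {0..} \<Longrightarrow> \<bar>s - r z\<bar> < e1 \<Longrightarrow> \<bar>g s - g (r z)\<bar> < \<epsilon> / 2"
      by (rule continuous_on_realD[OF g(1), of "r z" "\<epsilon> / 2"]) (use rz e in auto)
    obtain d where d: "d > 0" "\<And>t. t \<in> {x..y} \<Longrightarrow> \<bar>t - z\<bar> < d \<Longrightarrow> \<bar>r t - r z\<bar> < e1"
      by (rule continuous_on_realD[OF r(1) _ e1(1), of z]) (use z in auto)
    show "\<exists>d>0. \<forall>a b. x \<le> a \<and> b \<le> y \<and> a \<le> z \<and> z \<le> b \<and> b - a < d \<longrightarrow>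
        \<sigma> * (G (r b) - G (r a)) - (LBINT t:{a<..b}. g (r t) * \<phi> t) \<le> \<epsilon> * (LBINT t:{a<..b}. ?k t)"
    proof (intro exI conjI allI impI)
      show "d > 0" by fact
      fix a b assume ab: "x \<le> a \<and> b \<le> y \<and> a \<le> z \<and> z \<le> b \<and> b - a < d"
      have near: "\<bar>r t - r z\<bar> < e1" if "t \<in> {a..b}" for t
        by (rule d(2)) (use that ab in auto)
      have pos: "0 \<le> r a" "0 \<le> r b" using r ab by auto
      obtain \<xi> where \<xi>: "min (r a) (r b) \<le> \<xi>" "\<xi> \<le> max (r a) (r b)" "G (r b) - G (r a) = g \<xi> * (r b - r a)"
        by (rule mean_value_halfline[OF G pos])
      have \<xi>0: "0 \<le> \<xi>" using \<xi>(1) pos by linarith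
      have "\<bar>\<xi> - r z\<bar> < e1" using near[of a] near[of b] ab \<xi>(1,2) by (auto simp: min_def max_def split: if_splits)
      then have gx: "\<bar>g \<xi> - g (r z)\<bar> < \<epsilon> / 2" using e1(2)[of \<xi>] \<xi>0 by simp
      have gt: "\<bar>g \<xi> - g (r t)\<bar> \<le> \<epsilon>" if "t \<in> {a..b}" for t
      proof -
        have "r t \<in> {0..}" using r(2)[of t] that ab by auto
        from e1(2)[OF this near[OF that]] gx show ?thesis by linarith
      qed
      have "\<sigma> * (G (r b) - G (r a)) = g \<xi> * (\<sigma> * (r b - r a))" unfolding \<xi>(3) by simp
      also have "\<dots> \<le> g \<xi> * (LBINT t:{a<..b}. \<phi> t)"
        using r\<phi>[of a b] ab g(2)[OF \<xi>0] by (intro mult_left_mono) auto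
      also have "\<dots> = (LBINT t:{a<..b}. g \<xi> * \<phi> t)" by simp
      also have "\<dots> \<le> (LBINT t:{a<..b}. g (r t) * \<phi> t + \<epsilon> * ?k t)"
      proof (rule set_integral_mono)
        show "set_integrable lborel {a<..b} (\<lambda>t. g \<xi> * \<phi> t)" using \<phi>i[of a b] ab by auto
        show "set_integrable lborel {a<..b} (\<lambda>t. g (r t) * \<phi> t + \<epsilon> * ?k t)"
          using \<phi>i[of a b] g\<phi>i[of a b] ab
          by (intro set_integral_add set_integrable_mult_right set_integrable_abs) auto
        fix t assume "t \<in> {a<..b}"
        then have "\<bar>g \<xi> - g (r t)\<bar> * \<bar>\<phi> t\<bar> \<le> \<epsilon> * \<bar>\<phi> t\<bar>" by (intro mult_right_mono gt) auto
        moreover have "(g \<xi> - g (r t)) * \<phi> t \<le> \<bar>g \<xi> - g (r t)\<bar> * \<bar>\<phi> t\<bar>"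
          by (metis abs_ge_self abs_mult)
        ultimately show "g \<xi> * \<phi> t \<le> g (r t) * \<phi> t + \<epsilon> * ?k t" by (simp add: left_diff_distrib)
      qed
      also have "\<dots> = (LBINT t:{a<..b}. g (r t) * \<phi> t) + \<epsilon> * (LBINT t:{a<..b}. ?k t)"
        using \<phi>i[of a b] g\<phi>i[of a b] ab
        by (subst set_integral_add(2)) (auto intro: set_integrable_abs)
      finally show "\<sigma> * (G (r b) - G (r a)) - (LBINT t:{a<..b}. g (r t) * \<phi> t) \<le> \<epsilon> * (LBINT t:{a<..b}. ?k t)"
        by simp
    qed
  qed (use xy \<phi> in \<open>auto intro: set_integrable_abs\<close>)
  then show ?thesis by simp
qed

text \<open>
  The version for moduli: r will be the modulus of a complex function and k the modulus of its
  weak derivative; the triangle inequality then gives the hypothesis on increments.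
\<close>

lemma chain_rule_le:
  fixes r k g G :: "real \<Rightarrow> real"
  assumes G: "\<And>t. 0 \<le> t \<Longrightarrow> (G has_real_derivative g t) (at t within {0..})"
    and g: "continuous_on {0..} g" "\<And>t. 0 \<le> t \<Longrightarrow> 0 \<le> g t"
    and r: "continuous_on {x..y} r" "\<And>t. t \<in> {x..y} \<Longrightarrow> 0 \<le> r t"
    and k: "set_integrable lborel {x<..y} k"
    and rk: "\<And>s t. x \<le> s \<Longrightarrow> s \<le> t \<Longrightarrow> t \<le> y \<Longrightarrow> \<bar>r t - r s\<bar> \<le> (LBINT \<tau>:{s<..t}. k \<tau>)"
    and xy: "x \<le> y"
  shows "\<bar>G (r y) - G (r x)\<bar> \<le> (LBINT t:{x<..y}. g (r t) * k t)"
proof -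
  have "\<sigma> * (G (r y) - G (r x)) \<le> (LBINT t:{x<..y}. g (r t) * k t)" if "\<bar>\<sigma>\<bar> = 1" for \<sigma>
  proof (rule chain_rule_one_sided[OF G g r k _ xy])
    fix s t assume "x \<le> s" "s \<le> t" "t \<le> y"
    then have "\<bar>\<sigma> * (r t - r s)\<bar> \<le> (LBINT \<tau>:{s<..t}. k \<tau>)" using rk that by (simp add: abs_mult)
    then show "\<sigma> * (r t - r s) \<le> (LBINT \<tau>:{s<..t}. k \<tau>)" by linarith
  qed
  from this[of 1] this[of "-1"] show ?thesis by simp
qed

lemma chain_rule_eq:
  fixes r h g G :: "real \<Rightarrow> real"
  assumes G: "\<And>t. 0 \<le> t \<Longrightarrow> (G has_real_derivative g t) (at t within {0..})"
    and g: "continuous_on {0..} g" "\<And>t. 0 \<le> t \<Longrightarrow> 0 \<le> g t"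
    and r: "continuous_on {x..y} r" "\<And>t. t \<in> {x..y} \<Longrightarrow> 0 \<le> r t"
    and h: "set_integrable lborel {x<..y} h"
    and rh: "\<And>s t. x \<le> s \<Longrightarrow> s \<le> t \<Longrightarrow> t \<le> y \<Longrightarrow> r t - r s = (LBINT \<tau>:{s<..t}. h \<tau>)"
    and xy: "x \<le> y"
  shows "G (r y) - G (r x) = (LBINT t:{x<..y}. g (r t) * h t)"
proof -
  have "\<sigma> * (G (r y) - G (r x)) \<le> (LBINT t:{x<..y}. g (r t) * (\<sigma> * h t))" for \<sigma>
  proof (rule chain_rule_one_sided[OF G g r set_integrable_mult_right[OF h] _ xy])
    fix s t assume st: "x \<le> s" "s \<le> t" "t \<le> y"
    show "\<sigma> * (r t - r s) \<le> (LBINT \<tau>:{s<..t}. \<sigma> * h \<tau>)"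
      by (simp only: rh[OF st] set_integral_mult_right order_refl)
  qed
  from this[of 1] this[of "-1"] show ?thesis by (simp add: set_lebesgue_integral_def)
qed

section \<open>Functions of finite energy on the half-line\<close>

text \<open>
  Continuous functions in H1 together with a choice h of the weak derivative.
\<close>

definition H1_pair :: "(real \<Rightarrow> complex) \<Rightarrow> (real \<Rightarrow> complex) \<Rightarrow> bool" where
  "H1_pair u h \<longleftrightarrow> continuous_on {0..} u \<and> L2_halfline u \<and> L2_halfline h \<and> ac_primitive u h"

lemma H1_pair_weak_deriv:
  assumes "H1_halfline f" "continuous_on {0..} f"
  shows "H1_pair f (weak_deriv f)"
  using H1_weak_deriv[OF assms] assms by (auto simp: H1_pair_def H1_halfline_def)

lemma set_integral_Ioc_le_Ioi:
  fixes f :: "real \<Rightarrow> real"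
  assumes "set_integrable lborel {0<..} f" "\<And>t. 0 \<le> f t" "0 \<le> x"
  shows "(LBINT t:{x<..y}. f t) \<le> (LBINT t:{x<..}. f t)" "(LBINT t:{x<..}. f t) \<le> (LBINT t:{0<..}. f t)"
    "0 \<le> (LBINT t:{x<..y}. f t)"
proof -
  have 1: "set_integrable lborel {x<..} f" "set_integrable lborel {x<..y} f"
    using assms by (auto intro: set_integrable_subset)
  show "(LBINT t:{x<..y}. f t) \<le> (LBINT t:{x<..}. f t)"
    unfolding set_lebesgue_integral_def
    by (intro integral_mono) (use 1 assms in \<open>auto simp: set_integrable_def indicator_def\<close>)
  show "(LBINT t:{x<..}. f t) \<le> (LBINT t:{0<..}. f t)"
    unfolding set_lebesgue_integral_def
    by (intro integral_mono) (use 1 assms in \<open>auto simp: set_integrable_def indicator_def\<close>)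
  show "0 \<le> (LBINT t:{x<..y}. f t)"
    unfolding set_lebesgue_integral_def
    by (intro Bochner_Integration.integral_nonneg) (use assms in auto)
qed

context
  fixes u h :: "real \<Rightarrow> complex"
  assumes uh: "H1_pair u h"
begin

lemma H1_pair_continuous: "continuous_on {0..} u"
  and H1_pair_L2: "set_integrable lborel {0<..} (\<lambda>t. (norm (u t))\<^sup>2)"
  and H1_pair_L2_deriv: "set_integrable lborel {0<..} (\<lambda>t. (norm (h t))\<^sup>2)"
  and H1_pair_primitive: "ac_primitive u h"
  using uh by (auto simp: H1_pair_def L2_halfline_def)

lemma H1_pair_norm_integrable: "0 \<le> x \<Longrightarrow> x \<le> y \<Longrightarrow> set_integrable lborel {x<..y} (\<lambda>t. norm (h t))"
  using ac_primitiveD(1)[OF H1_pair_primitive] by (intro set_integrable_norm)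

lemma H1_pair_norm_increment:
  assumes "0 \<le> s" "s \<le> t"
  shows "\<bar>norm (u t) - norm (u s)\<bar> \<le> (LBINT \<tau>:{s<..t}. norm (h \<tau>))"
proof -
  have "\<bar>norm (u t) - norm (u s)\<bar> \<le> norm (u t - u s)" by (rule norm_triangle_ineq3)
  also have "u t - u s = (LBINT \<tau>:{s<..t}. h \<tau>)"
    by (rule ac_primitiveD(2)[OF H1_pair_primitive assms])
  also have "norm (LBINT \<tau>:{s<..t}. h \<tau>) \<le> (LBINT \<tau>:{s<..t}. norm (h \<tau>))"
    by (rule set_integral_norm_bound) (rule ac_primitiveD(1)[OF H1_pair_primitive assms])
  finally show ?thesis .
qed

lemma H1_pair_measurable:
  assumes c: "continuous_on {0..} c"
  shows "(\<lambda>t. indicator {0<..} t *\<^sub>R (c (norm (u t)) :: real)) \<in> borel_measurable borel"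
    "(\<lambda>t. indicator {0<..} t *\<^sub>R (c (norm (u t)) * norm (h t))) \<in> borel_measurable borel"
proof -
  have "continuous_on {0<..} (\<lambda>t. c (norm (u t)))"
    by (rule continuous_on_compose2[OF c, of _ "\<lambda>t. norm (u t)"])
       (auto intro!: continuous_intros continuous_on_subset[OF H1_pair_continuous])
  then show 1: "(\<lambda>t. indicator {0<..} t *\<^sub>R (c (norm (u t)) :: real)) \<in> borel_measurable borel"
    by (intro borel_measurable_continuous_on_indicator) auto
  have 2: "(\<lambda>t. norm (indicator {0<..} t *\<^sub>R h t)) \<in> borel_measurable borel"
    using uh by (auto simp: H1_pair_def L2_halfline_def set_borel_measurable_def simp del: norm_scaleR)
  have "(\<lambda>t. indicator {0<..} t *\<^sub>R (c (norm (u t)) * norm (h t))) =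
     (\<lambda>t. (indicator {0<..} t *\<^sub>R c (norm (u t))) * norm (indicator {0<..} t *\<^sub>R h t))"
    by (auto simp: fun_eq_iff indicator_def)
  then show "(\<lambda>t. indicator {0<..} t *\<^sub>R (c (norm (u t)) * norm (h t))) \<in> borel_measurable borel"
    using borel_measurable_times[OF 1 2] by simp
qed

lemma H1_pair_integrable_comp:
  assumes c: "continuous_on {0..} c" and b: "\<And>t. 0 < t \<Longrightarrow> \<bar>c (norm (u t))\<bar> \<le> C * (norm (u t))\<^sup>2"
  shows "set_integrable lborel {0<..} (\<lambda>t. c (norm (u t)))"
  unfolding set_integrable_def
proof (rule Bochner_Integration.integrable_bound)
  show "integrable lborel (\<lambda>t. C * (indicator {0<..} t *\<^sub>R (norm (u t))\<^sup>2))"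
    using H1_pair_L2 by (simp add: set_integrable_def)
  show "(\<lambda>t. indicator {0<..} t *\<^sub>R c (norm (u t))) \<in> borel_measurable lborel"
    using H1_pair_measurable(1)[OF c] by simp
  show "AE t in lborel. norm (indicator {0<..} t *\<^sub>R c (norm (u t))) \<le> norm (C * (indicator {0<..} t *\<^sub>R (norm (u t))\<^sup>2))"
    using b by (intro AE_I2) (auto simp: indicator_def intro: order_trans[OF _ abs_ge_self])
qed

lemma H1_pair_integrable_weighted:
  assumes c: "continuous_on {0..} c" and b: "\<And>t. 0 < t \<Longrightarrow> \<bar>c (norm (u t))\<bar> \<le> C * norm (u t)" and C: "0 \<le> C"
  shows "set_integrable lborel {0<..} (\<lambda>t. c (norm (u t)) * norm (h t))"
  unfolding set_integrable_def
proof (rule Bochner_Integration.integrable_bound)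
  show "integrable lborel (\<lambda>t. C * (indicator {0<..} t *\<^sub>R (norm (u t))\<^sup>2 + indicator {0<..} t *\<^sub>R (norm (h t))\<^sup>2))"
    using H1_pair_L2 H1_pair_L2_deriv unfolding set_integrable_def
    by (intro integrable_mult_right Bochner_Integration.integrable_add)
  show "(\<lambda>t. indicator {0<..} t *\<^sub>R (c (norm (u t)) * norm (h t))) \<in> borel_measurable lborel"
    using H1_pair_measurable(2)[OF c] by simp
  show "AE t in lborel. norm (indicator {0<..} t *\<^sub>R (c (norm (u t)) * norm (h t))) \<le>
      norm (C * (indicator {0<..} t *\<^sub>R (norm (u t))\<^sup>2 + indicator {0<..} t *\<^sub>R (norm (h t))\<^sup>2))"
  proof (intro AE_I2)
    fix t :: real
    have "\<bar>c (norm (u t)) * norm (h t)\<bar> \<le> C * ((norm (u t))\<^sup>2 + (norm (h t))\<^sup>2)" if "0 < t"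
    proof -
      have "\<bar>c (norm (u t)) * norm (h t)\<bar> \<le> (C * norm (u t)) * norm (h t)"
        unfolding abs_mult by (rule order_trans[OF mult_right_mono[OF b[OF that]]]) auto
      also have "\<dots> = C * (norm (u t) * norm (h t))" by simp
      also have "\<dots> \<le> C * ((norm (u t))\<^sup>2 + (norm (h t))\<^sup>2)"
      proof (rule mult_left_mono[OF _ C])
        have "0 \<le> norm (u t) * norm (h t)" by simp
        moreover have "2 * (norm (u t) * norm (h t)) \<le> (norm (u t))\<^sup>2 + (norm (h t))\<^sup>2"
          using sum_squares_bound[of "norm (u t)" "norm (h t)"] by simp
        ultimately show "norm (u t) * norm (h t) \<le> (norm (u t))\<^sup>2 + (norm (h t))\<^sup>2" by linarith
      qed
      finally show ?thesis .
    qed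
    then show "norm (indicator {0<..} t *\<^sub>R (c (norm (u t)) * norm (h t))) \<le>
      norm (C * (indicator {0<..} t *\<^sub>R (norm (u t))\<^sup>2 + indicator {0<..} t *\<^sub>R (norm (h t))\<^sup>2))"
      by (auto simp: indicator_def intro: order_trans[OF _ abs_ge_self])
  qed
qed

lemma H1_pair_chain_le:
  assumes G: "\<And>t. 0 \<le> t \<Longrightarrow> (G has_real_derivative g t) (at t within {0..})"
    and g: "continuous_on {0..} g" "\<And>t. 0 \<le> t \<Longrightarrow> 0 \<le> g t"
    and xy: "0 \<le> x" "x \<le> y"
  shows "\<bar>G (norm (u y)) - G (norm (u x))\<bar> \<le> (LBINT t:{x<..y}. g (norm (u t)) * norm (h t))"
  by (rule chain_rule_le[where r = "\<lambda>t. norm (u t)", OF G g])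
     (use xy in \<open>auto intro!: continuous_intros continuous_on_subset[OF H1_pair_continuous]
        H1_pair_norm_integrable H1_pair_norm_increment\<close>)

text \<open>
  The increments of |u|^2 are bounded by the integral of |u|^2 + |h|^2, whose tail tends to 0, and
  |u| is small somewhere far out because |u|^2 is integrable.
\<close>

lemma H1_pair_vanishes: "((\<lambda>t. norm (u t)) \<longlongrightarrow> 0) at_top"
proof -
  define W where "W t = (norm (u t))\<^sup>2 + (norm (h t))\<^sup>2" for t
  have W: "set_integrable lborel {0<..} W" unfolding W_def
    using H1_pair_L2 H1_pair_L2_deriv by (rule set_integral_add)
  have W0: "0 \<le> W t" for t by (simp add: W_def)
  define K where "K = (LBINT t:{0<..}. W t)"
  have inc: "(norm (u y))\<^sup>2 \<le> (norm (u x))\<^sup>2 + (LBINT t:{x<..}. W t)" if "0 \<le> x" "x \<le> y" for x y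
  proof -
    have "\<bar>(norm (u y))\<^sup>2 - (norm (u x))\<^sup>2\<bar> \<le> (LBINT t:{x<..y}. 2 * norm (u t) * norm (h t))"
      by (rule H1_pair_chain_le[where G = "\<lambda>s. s\<^sup>2"])
         (use that in \<open>auto intro!: continuous_intros derivative_eq_intros\<close>)
    also have "\<dots> \<le> (LBINT t:{x<..y}. W t)"
    proof (rule set_integral_mono)
      show "set_integrable lborel {x<..y} (\<lambda>t. 2 * norm (u t) * norm (h t))"
        using that by (intro set_integrable_mult_continuous H1_pair_norm_integrable)
          (auto intro!: continuous_intros continuous_on_subset[OF H1_pair_continuous])
      show "set_integrable lborel {x<..y} W"
        by (rule set_integrable_subset[OF W]) (use that in auto)
      show "2 * norm (u t) * norm (h t) \<le> W t" for t
        unfolding W_def using sum_squares_bound[of "norm (u t)" "norm (h t)"] by simp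
    qed
    also have "\<dots> \<le> (LBINT t:{x<..}. W t)"
      by (rule set_integral_Ioc_le_Ioi(1)[OF W W0 that(1)])
    finally show ?thesis by linarith
  qed
  have tail: "((\<lambda>x. LBINT t:{x<..}. W t) \<longlongrightarrow> 0) at_top"
  proof -
    have "((\<lambda>x. K - (LBINT t:{0<..x}. W t)) \<longlongrightarrow> K - K) at_top"
      unfolding K_def by (intro tendsto_intros tendsto_set_integral_Ioc_at_top W)
    moreover have "\<forall>\<^sub>F x in at_top. K - (LBINT t:{0<..x}. W t) = (LBINT t:{x<..}. W t)"
      using eventually_ge_at_top[of 0]
    proof eventually_elim
      case (elim x)
      then show ?case using set_integral_Ioc_Ioi_add[OF W, of x] by (simp add: K_def)
    qed
    ultimately show ?thesis using Lim_transform_eventually by fastforce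
  qed
  show ?thesis
  proof (rule tendstoI)
    fix e :: real assume e: "0 < e"
    \<comment> \<open>One half for the value at a point far out, one half for the increment beyond it.\<close>
    define \<epsilon> where "\<epsilon> = e\<^sup>2 / 2"
    have eps: "0 < \<epsilon>" using e by (simp add: \<epsilon>_def)
    from order_tendstoD(2)[OF tail eps] obtain X0 where X0: "\<And>x. X0 \<le> x \<Longrightarrow> (LBINT t:{x<..}. W t) < \<epsilon>"
      unfolding eventually_at_top_linorder by blast
    define X where "X = max 0 X0"
    \<comment> \<open>Otherwise |u|^2 would stay above a positive constant on a half-line.\<close>
    have "\<exists>x\<ge>X. (norm (u x))\<^sup>2 < \<epsilon>"
    proof (rule ccontr)
      assume "\<not> ?thesis"
      then have ge: "\<epsilon> \<le> (norm (u x))\<^sup>2" if "X \<le> x" for x using that by force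
      obtain n where n: "K / \<epsilon> < real n" using reals_Archimedean2 by blast
      have "\<epsilon> * real n = (LBINT t:{X<..X + real n}. \<epsilon>)"
        by (simp add: set_lebesgue_integral_def)
      also have "\<dots> \<le> (LBINT t:{X<..X + real n}. W t)"
      proof (rule set_integral_mono)
        show "set_integrable lborel {X<..X + real n} (\<lambda>t. \<epsilon>)"
          unfolding set_integrable_def by (intro integrable_scaleR_left integrable_real_indicator) auto
        show "set_integrable lborel {X<..X + real n} W"
          by (rule set_integrable_subset[OF W]) (auto simp: X_def)
        show "t \<in> {X<..X + real n} \<Longrightarrow> \<epsilon> \<le> W t" for t using ge[of t] by (simp add: W_def add_increasing2)
      qed
      also have "\<dots> \<le> (LBINT t:{X<..}. W t)"
        by (rule set_integral_Ioc_le_Ioi(1)[OF W W0]) (simp add: X_def)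
      also have "\<dots> \<le> K" unfolding K_def
        by (rule set_integral_Ioc_le_Ioi(2)[OF W W0]) (simp add: X_def)
      finally show False using n eps by (simp add: field_simps)
    qed
    then obtain x where x: "X \<le> x" "(norm (u x))\<^sup>2 < \<epsilon>" by blast
    have "norm (u y) < e" if "x \<le> y" for y
    proof -
      have "(norm (u y))\<^sup>2 < \<epsilon> + \<epsilon>"
        using inc[of x y] X0[of x] x that by (auto simp: X_def)
      also have "\<dots> = e\<^sup>2" by (simp add: \<epsilon>_def)
      finally show ?thesis using e by (simp add: power2_less_imp_less)
    qed
    then show "\<forall>\<^sub>F x in at_top. dist (norm (u x)) 0 < e"
      unfolding eventually_at_top_linorder by auto
  qed
qed

lemma H1_pair_max: "\<exists>x\<ge>0. \<forall>y\<ge>0. norm (u y) \<le> norm (u x)"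
proof (cases "\<forall>y\<ge>0. u y = 0")
  case True then show ?thesis by auto
next
  case False
  then obtain x1 where x1: "0 \<le> x1" "0 < norm (u x1)" by auto
  obtain X where X: "\<And>y. X \<le> y \<Longrightarrow> norm (u y) < norm (u x1)"
    using order_tendstoD(2)[OF H1_pair_vanishes x1(2)] unfolding eventually_at_top_linorder by blast
  have "\<exists>x\<in>{0..max X x1}. \<forall>y\<in>{0..max X x1}. norm (u y) \<le> norm (u x)"
    by (rule continuous_attains_sup)
       (use x1 in \<open>auto intro!: continuous_intros continuous_on_subset[OF H1_pair_continuous]\<close>)
  then obtain x where x: "x \<in> {0..max X x1}" "\<And>y. y \<in> {0..max X x1} \<Longrightarrow> norm (u y) \<le> norm (u x)" by blast
  have "norm (u y) \<le> norm (u x)" if "0 \<le> y" for y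
  proof (cases "y \<le> max X x1")
    case True then show ?thesis using x that by auto
  next
    case False
    then have "norm (u y) < norm (u x1)" by (intro X) auto
    also have "\<dots> \<le> norm (u x)" by (rule x) (use x1 in auto)
    finally show ?thesis by simp
  qed
  then show ?thesis using x(1) by auto
qed

text \<open>
  The weighted variation beyond x pays for the descent from the height at x to 0.
\<close>

lemma H1_pair_chain_tail:
  assumes G: "\<And>t. 0 \<le> t \<Longrightarrow> (G has_real_derivative g t) (at t within {0..})" and G0: "G 0 = 0"
    and g: "continuous_on {0..} g" "\<And>t. 0 \<le> t \<Longrightarrow> 0 \<le> g t"
    and i: "set_integrable lborel {0<..} (\<lambda>t. g (norm (u t)) * norm (h t))"
    and x: "0 \<le> x"
  shows "G (norm (u x)) \<le> (LBINT t:{x<..}. g (norm (u t)) * norm (h t))"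
proof -
  have "continuous_on {0..} G"
    using G by (auto simp: continuous_on_eq_continuous_within intro: DERIV_continuous)
  from continuous_on_tendsto_compose[OF this H1_pair_vanishes] have lim: "((\<lambda>y. G (norm (u y))) \<longlongrightarrow> 0) at_top"
    by (simp add: G0)
  have "((\<lambda>y. G (norm (u x)) - G (norm (u y))) \<longlongrightarrow> G (norm (u x)) - 0) at_top"
    by (intro tendsto_intros lim)
  moreover have "\<forall>\<^sub>F y in at_top. G (norm (u x)) - G (norm (u y)) \<le> (LBINT t:{x<..}. g (norm (u t)) * norm (h t))"
    using eventually_ge_at_top[of x]
  proof eventually_elim
    case (elim y)
    have "(LBINT t:{x<..y}. g (norm (u t)) * norm (h t)) \<le> (LBINT t:{x<..}. g (norm (u t)) * norm (h t))"
      using g by (intro set_integral_Ioc_le_Ioi(1)[OF i _ x]) auto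
    with H1_pair_chain_le[OF G g x elim] show ?case by linarith
  qed
  ultimately show ?thesis using tendsto_upperbound[of _ "G (norm (u x)) - 0" at_top] trivial_limit_at_top_linorder by force
qed

end

section \<open>Solitons\<close>

lemma set_integral_FTC_Ioi:
  fixes F f :: "real \<Rightarrow> real"
  assumes D: "\<And>x. a \<le> x \<Longrightarrow> (F has_real_derivative f x) (at x within {a..})"
    and c: "continuous_on {a..} f" and i: "set_integrable lborel {a<..} f" and l: "(F \<longlongrightarrow> L) at_top"
  shows "(LBINT t:{a<..}. f t) = L - F a"
proof -
  have eq: "(LBINT t:{a<..y}. f t) = F y - F a" if "a \<le> y" for y
  proof -
    have cy: "continuous_on {a..y} f" by (rule continuous_on_subset[OF c]) auto
    have "(LBINT t:{a..y}. f t) = F y - F a"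
      unfolding set_lebesgue_integral_def
    proof (rule integral_FTC_Icc[OF that _ cy])
      fix x assume "a \<le> x" "x \<le> y"
      then have "(F has_real_derivative f x) (at x within {a..y})"
        by (intro DERIV_subset[OF D]) auto
      then show "(F has_vector_derivative f x) (at x within {a..y})"
        by (simp add: has_real_derivative_iff_has_vector_derivative)
    qed
    then show ?thesis using set_integral_Ioc_eq_Icc[OF set_integrable_continuous_Icc[OF cy]] by simp
  qed
  have "((\<lambda>y. LBINT t:{a<..y}. f t) \<longlongrightarrow> (LBINT t:{a<..}. f t)) at_top"
    by (rule tendsto_set_integral_Ioc_at_top[OF i])
  moreover have "((\<lambda>y. LBINT t:{a<..y}. f t) \<longlongrightarrow> L - F a) at_top"
  proof (rule Lim_transform_eventually)
    show "((\<lambda>y. F y - F a) \<longlongrightarrow> L - F a) at_top" by (intro tendsto_intros l)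
    show "\<forall>\<^sub>F y in at_top. F y - F a = (LBINT t:{a<..y}. f t)"
      using eventually_ge_at_top[of a] by eventually_elim (simp add: eq)
  qed
  ultimately show ?thesis using tendsto_unique trivial_limit_at_top_linorder by blast
qed

lemma set_integrable_exp_decay:
  fixes a :: real
  shows "set_integrable lborel {a<..} (\<lambda>t. exp (-2 * t))"
proof -
  have "(\<integral>\<^sup>+t. ennreal (exp (-2 * t)) * indicator {a..} t \<partial>lborel) = ennreal (0 - (- exp (-2 * a) / 2))"
  proof (rule nn_integral_FTC_atLeast)
    show "((\<lambda>t. - exp (- 2 * t) / 2) has_real_derivative exp (-2 * x)) (at x)" for x :: real
      by (auto intro!: derivative_eq_intros)
    show "((\<lambda>t::real. - exp (- 2 * t) / 2) \<longlongrightarrow> 0) at_top" by real_asymp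
  qed auto
  then have "(\<integral>\<^sup>+t. ennreal (indicator {a..} t *\<^sub>R exp (-2 * t)) \<partial>lborel) < \<infinity>"
    by (subst nn_integral_cong[where v = "\<lambda>t. ennreal (exp (-2 * t)) * indicator {a..} t"])
       (auto simp: indicator_def)
  then have "set_integrable lborel {a..} (\<lambda>t. exp (-2 * t))"
    unfolding set_integrable_def by (intro integrableI_nonneg) auto
  then show ?thesis by (rule set_integrable_subset) auto
qed

locale subcritical =
  fixes p :: real
  assumes p_gt: "2 < p" and p_lt: "p < 6"
begin

text \<open>
  The homogeneity exponents: a soliton profile of frequency \<omega> has height proportional to
  \<omega> powr (1 / (2 * \<alpha>)), mass proportional to \<omega> powr \<gamma> and energy proportional to
  \<omega> powr (1 / \<beta>). Since p < 6, \<beta> is less than 1, and energy grows faster than linearly in \<omega>.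
\<close>

definition \<alpha> :: real where "\<alpha> = (p - 2) / 2"
definition q :: real where "q = p / 2 + 1"
definition \<beta> :: real where "\<beta> = 2 * \<alpha> / q"
definition \<gamma> :: real where "\<gamma> = 1 / \<alpha> - 1 / 2"

lemma alpha_pos: "0 < \<alpha>" and alpha_lt: "\<alpha> < 2" and q_eq: "q = \<alpha> + 2" and p_eq: "p - 2 = 2 * \<alpha>"
  using p_gt p_lt by (auto simp: \<alpha>_def q_def field_simps)

lemma q_pos: "0 < q" using alpha_pos q_eq by linarith

lemma beta_pos: "0 < \<beta>" and beta_lt: "\<beta> < 1" and gamma_pos: "0 < \<gamma>" and beta_gamma: "1 + \<gamma> = 1 / \<beta>"
  using alpha_pos alpha_lt by (auto simp: \<beta>_def \<gamma>_def q_eq field_simps)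

text \<open>
  The soliton of frequency 1: the even positive solution of Q'' = Q - Q^(p-1) that decays at infinity.
\<close>

definition Q :: "real \<Rightarrow> real" where
  "Q y = (p / 2) powr (1 / (2 * \<alpha>)) * cosh (\<alpha> * y) powr (- 1 / \<alpha>)"

lemma Q_pos: "0 < Q y" using p_gt by (simp add: Q_def)

lemma Q_even: "Q (- y) = Q y" by (simp add: Q_def)

lemma DERIV_Q: "(Q has_real_derivative - tanh (\<alpha> * y) * Q y) (at y)"
proof -
  define C where "C = (p / 2) powr (1 / (2 * \<alpha>))"
  define E where "E z = exp ((- 1 / \<alpha>) * ln (cosh (\<alpha> * z)))" for z
  define Z where "Z = (- 1 / \<alpha>) * (inverse (cosh (\<alpha> * y)) * (sinh (\<alpha> * y) * \<alpha>))"
  have Q: "Q = (\<lambda>z. C * E z)"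
    by (rule ext) (simp add: Q_def C_def E_def powr_def)
  have "((\<lambda>z. C * exp ((- 1 / \<alpha>) * ln (cosh (\<alpha> * z)))) has_real_derivative C * (E y * Z)) (at y)"
    unfolding E_def Z_def
  proof (intro DERIV_cmult DERIV_chain2[OF DERIV_exp] DERIV_chain2[OF DERIV_ln])
    show "((\<lambda>y. cosh (\<alpha> * y)) has_real_derivative sinh (\<alpha> * y) * \<alpha>) (at y)"
      by (auto intro!: derivative_eq_intros)
  qed simp
  then have D: "(Q has_real_derivative C * (E y * Z)) (at y)" unfolding Q E_def .
  have "Z = - tanh (\<alpha> * y)"
    unfolding Z_def using alpha_pos by (simp add: tanh_def divide_inverse)
  then have "C * (E y * Z) = - tanh (\<alpha> * y) * Q y" unfolding Q by (simp only: mult.left_commute mult.commute)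
  then show ?thesis by (rule DERIV_cong[OF D])
qed

lemma Q_powr: "Q y powr (p - 2) = (p / 2) * (1 - (tanh (\<alpha> * y))\<^sup>2)"
proof -
  have "Q y powr (p - 2) = ((p / 2) powr (1 / (2 * \<alpha>))) powr (2 * \<alpha>) * (cosh (\<alpha> * y) powr (- 1 / \<alpha>)) powr (2 * \<alpha>)"
    unfolding Q_def using p_gt by (subst powr_mult[symmetric]) (auto simp: p_eq)
  also have "\<dots> = (p / 2) * cosh (\<alpha> * y) powr (- 2)"
    using alpha_pos p_gt by (simp add: powr_powr)
  also have "cosh (\<alpha> * y) powr (- 2) = 1 / (cosh (\<alpha> * y))\<^sup>2"
    by (simp add: powr_minus powr_numeral divide_inverse)
  also have "\<dots> = 1 - (tanh (\<alpha> * y))\<^sup>2"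
  proof -
    have "(cosh (\<alpha> * y))\<^sup>2 \<noteq> 0" by simp
    moreover have "1 = (cosh (\<alpha> * y))\<^sup>2 - (sinh (\<alpha> * y))\<^sup>2" by (simp add: cosh_square_eq)
    ultimately have "1 / (cosh (\<alpha> * y))\<^sup>2 = (cosh (\<alpha> * y))\<^sup>2 / (cosh (\<alpha> * y))\<^sup>2 - (sinh (\<alpha> * y))\<^sup>2 / (cosh (\<alpha> * y))\<^sup>2"
      by (metis diff_divide_distrib)
    then show ?thesis by (simp add: tanh_def power_divide)
  qed
  finally show ?thesis .
qed

lemma Q_sq_le: "(Q y)\<^sup>2 \<le> ((p / 2) powr (1 / (2 * \<alpha>)) * 2 powr (1 / \<alpha>))\<^sup>2 * exp (- 2 * y)"
proof -
  have "exp (\<alpha> * y) / 2 \<le> cosh (\<alpha> * y)" by (simp add: cosh_field_def)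
  then have "cosh (\<alpha> * y) powr (- 1 / \<alpha>) \<le> (exp (\<alpha> * y) / 2) powr (- 1 / \<alpha>)"
    using alpha_pos by (intro powr_mono2') auto
  also have "\<dots> = 2 powr (1 / \<alpha>) * exp (- y)"
    using alpha_pos by (simp add: powr_def ln_div right_diff_distrib diff_divide_distrib mult_exp_exp)
  finally have "Q y \<le> (p / 2) powr (1 / (2 * \<alpha>)) * (2 powr (1 / \<alpha>) * exp (- y))"
    unfolding Q_def by (intro mult_left_mono) auto
  then have "(Q y)\<^sup>2 \<le> ((p / 2) powr (1 / (2 * \<alpha>)) * (2 powr (1 / \<alpha>) * exp (- y)))\<^sup>2"
    using Q_pos[of y] by (intro power_mono) auto
  also have "\<dots> = ((p / 2) powr (1 / (2 * \<alpha>)) * 2 powr (1 / \<alpha>))\<^sup>2 * exp (- 2 * y)"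
    by (simp add: power_mult_distrib mult.assoc flip: exp_double)
  finally show ?thesis .
qed

lemma continuous_on_Q: "continuous_on S Q"
  using DERIV_Q by (meson DERIV_isCont continuous_at_imp_continuous_on)

lemma Q_sq_integrable: "set_integrable lborel {a<..} (\<lambda>y. (Q y)\<^sup>2)"
proof -
  define C where "C = ((p / 2) powr (1 / (2 * \<alpha>)) * 2 powr (1 / \<alpha>))\<^sup>2"
  have m: "(\<lambda>y. indicator {a<..} y *\<^sub>R (Q y)\<^sup>2) \<in> borel_measurable borel"
    by (intro borel_measurable_continuous_on_indicator continuous_intros continuous_on_Q) auto
  have "integrable lborel (\<lambda>y. C * (indicator {a<..} y *\<^sub>R exp (- 2 * y)))"
    using set_integrable_exp_decay[of a] by (simp add: set_integrable_def)
  then show ?thesis unfolding set_integrable_def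
    by (rule Bochner_Integration.integrable_bound)
       (use m Q_sq_le[folded C_def] in \<open>auto intro!: AE_I2 simp: indicator_def intro: order_trans[OF _ abs_ge_self]\<close>)
qed

lemma Q_tendsto_0: "(Q \<longlongrightarrow> 0) at_top"
proof -
  define C where "C = ((p / 2) powr (1 / (2 * \<alpha>)) * 2 powr (1 / \<alpha>))\<^sup>2"
  have "((\<lambda>y. (Q y)\<^sup>2) \<longlongrightarrow> 0) at_top"
  proof (rule Lim_null_comparison)
    show "\<forall>\<^sub>F y in at_top. norm ((Q y)\<^sup>2) \<le> C * exp (- 2 * y)"
      using Q_sq_le[folded C_def] by (intro always_eventually) auto
    show "((\<lambda>y. C * exp (- 2 * y)) \<longlongrightarrow> 0) at_top" by real_asymp
  qed
  from tendsto_real_sqrt[OF this] show ?thesis using Q_pos by (simp add: abs_of_pos)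
qed

text \<open>
  The mass of the soliton to the right of a; the full soliton has mass 2 * \<kappa> 0.
\<close>

definition \<kappa> :: "real \<Rightarrow> real" where "\<kappa> a = (LBINT y:{a<..}. (Q y)\<^sup>2)"

lemma \<kappa>_diff: "a \<le> b \<Longrightarrow> \<kappa> a - \<kappa> b = (LBINT y:{a<..b}. (Q y)\<^sup>2)"
  unfolding \<kappa>_def using set_integral_Ioc_Ioi_add[OF Q_sq_integrable] by simp

lemma \<kappa>_strict: assumes "a < b" shows "\<kappa> b < \<kappa> a"
proof -
  have "\<exists>x\<in>{a..b}. \<forall>y\<in>{a..b}. Q x \<le> Q y"
    by (rule continuous_attains_inf) (use assms in \<open>auto intro: continuous_on_Q\<close>)
  then obtain x where x: "\<And>y. y \<in> {a..b} \<Longrightarrow> Q x \<le> Q y" by blast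
  have "0 < (b - a) * (Q x)\<^sup>2" using assms Q_pos[of x] by simp
  also have "\<dots> = (LBINT y:{a<..b}. (Q x)\<^sup>2)" using assms by (simp add: set_lebesgue_integral_def)
  also have "\<dots> \<le> (LBINT y:{a<..b}. (Q y)\<^sup>2)"
  proof (rule set_integral_mono)
    show "set_integrable lborel {a<..b} (\<lambda>y. (Q x)\<^sup>2)"
      using assms unfolding set_integrable_def by (intro integrable_scaleR_left integrable_real_indicator) auto
    show "set_integrable lborel {a<..b} (\<lambda>y. (Q y)\<^sup>2)"
      by (rule set_integrable_subset[OF Q_sq_integrable[of a]]) auto
    show "y \<in> {a<..b} \<Longrightarrow> (Q x)\<^sup>2 \<le> (Q y)\<^sup>2" for y
      using x[of y] Q_pos[of x] by (intro power_mono) auto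
  qed
  finally show ?thesis using \<kappa>_diff[of a b] assms by simp
qed

lemma \<kappa>_pos: "0 < \<kappa> a"
proof -
  have "0 \<le> \<kappa> (a + 1)" unfolding \<kappa>_def set_lebesgue_integral_def
    by (intro Bochner_Integration.integral_nonneg) auto
  then show ?thesis using \<kappa>_strict[of a "a + 1"] by simp
qed

lemma \<kappa>_reflect: assumes "0 \<le> a" shows "\<kappa> (- a) = 2 * \<kappa> 0 - \<kappa> a"
proof -
  have i: "set_integrable lborel {b..c} (\<lambda>y. (Q y)\<^sup>2)" for b c
    by (intro set_integrable_continuous_Icc continuous_intros continuous_on_Q)
  have "\<kappa> (- a) - \<kappa> 0 = (LBINT y:{-a..0}. (Q y)\<^sup>2)"
    using \<kappa>_diff[of "- a" 0] set_integral_Ioc_eq_Icc[OF i] assms by simp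
  also have "\<dots> = (LBINT y:{0..a}. (Q y)\<^sup>2)"
    unfolding set_lebesgue_integral_def
    by (subst lborel_integral_real_affine[where c = "-1" and t = 0])
       (auto simp: Q_even indicator_def intro!: Bochner_Integration.integral_cong)
  also have "\<dots> = \<kappa> 0 - \<kappa> a"
    using \<kappa>_diff[of 0 a] set_integral_Ioc_eq_Icc[OF i] assms by simp
  finally show ?thesis by simp
qed

lemma \<kappa>_tendsto_0: "(\<kappa> \<longlongrightarrow> 0) at_top"
proof (rule Lim_transform_eventually)
  have "((\<lambda>y. LBINT t:{0<..y}. (Q t)\<^sup>2) \<longlongrightarrow> \<kappa> 0) at_top"
    unfolding \<kappa>_def by (rule tendsto_set_integral_Ioc_at_top[OF Q_sq_integrable])
  then show "((\<lambda>y. \<kappa> 0 - (LBINT t:{0<..y}. (Q t)\<^sup>2)) \<longlongrightarrow> 0) at_top"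
    using tendsto_diff[OF tendsto_const[of "\<kappa> 0"]] by fastforce
  show "\<forall>\<^sub>F y in at_top. \<kappa> 0 - (LBINT t:{0<..y}. (Q t)\<^sup>2) = \<kappa> y"
    using eventually_ge_at_top[of 0] by eventually_elim (simp add: \<kappa>_diff[symmetric])
qed

text \<open>
  The soliton of frequency \<omega>, moved so that the parameter a is the position of the origin in the
  rescaled variable: the profile decreases on the half-line if a is nonnegative, and it has its
  maximum inside the half-line if a is negative.
\<close>

definition sol :: "real \<Rightarrow> real \<Rightarrow> real \<Rightarrow> real" where
  "sol \<omega> a x = \<omega> powr (1 / (2 * \<alpha>)) * Q (sqrt \<omega> * x + a)"

definition sol' :: "real \<Rightarrow> real \<Rightarrow> real \<Rightarrow> real" where
  "sol' \<omega> a x = - sqrt \<omega> * tanh (\<alpha> * (sqrt \<omega> * x + a)) * sol \<omega> a x"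

context
  fixes \<omega> a :: real
  assumes om: "0 < \<omega>"
begin

lemma sol_pos: "0 < sol \<omega> a x" using om Q_pos by (simp add: sol_def)

lemma DERIV_sol: "(sol \<omega> a has_real_derivative sol' \<omega> a x) (at x)"
  unfolding sol_def[abs_def] sol'_def
  by (rule derivative_eq_intros DERIV_chain2[OF DERIV_Q] refl)+ simp

lemma sol_powr: "sol \<omega> a x powr (p - 2) = \<omega> * (p / 2) * (1 - (tanh (\<alpha> * (sqrt \<omega> * x + a)))\<^sup>2)"
proof -
  have "sol \<omega> a x powr (p - 2) = (\<omega> powr (1 / (2 * \<alpha>))) powr (2 * \<alpha>) * Q (sqrt \<omega> * x + a) powr (p - 2)"
    unfolding sol_def using Q_pos[of "sqrt \<omega> * x + a"] by (subst powr_mult) (auto simp: p_eq)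
  then show ?thesis using alpha_pos om by (simp add: Q_powr powr_powr)
qed

lemma sol_powr_p: "sol \<omega> a x powr p = \<omega> * (p / 2) * (1 - (tanh (\<alpha> * (sqrt \<omega> * x + a)))\<^sup>2) * (sol \<omega> a x)\<^sup>2"
proof -
  have "sol \<omega> a x powr p = sol \<omega> a x powr (p - 2) * sol \<omega> a x powr 2"
    by (simp flip: powr_add)
  then show ?thesis using sol_pos[of x] by (simp add: sol_powr)
qed

lemma sol'_sq: "(sol' \<omega> a x)\<^sup>2 = \<omega> * (tanh (\<alpha> * (sqrt \<omega> * x + a)))\<^sup>2 * (sol \<omega> a x)\<^sup>2"
  using om by (simp add: sol'_def power_mult_distrib)

text \<open>
  The energy density is a combination of the same two squares, because sol powr p is one; integrating
  over the half-line gives identities of Pohozaev type for the integral of sol'^2 and for the energy.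
\<close>

lemma DERIV_sol_flux:
  "((\<lambda>x. sol \<omega> a x * sol' \<omega> a x) has_real_derivative (q * (sol' \<omega> a x)\<^sup>2 - \<alpha> * \<omega> * (sol \<omega> a x)\<^sup>2)) (at x)"
proof -
  let ?T = "\<lambda>x. tanh (\<alpha> * (sqrt \<omega> * x + a))"
  have T: "(?T has_real_derivative (1 - (?T x)\<^sup>2) * (\<alpha> * sqrt \<omega>)) (at x)"
    by (rule derivative_eq_intros refl | simp)+
  have eq: "(\<lambda>x. sol \<omega> a x * sol' \<omega> a x) = (\<lambda>x. - sqrt \<omega> * (?T x * (sol \<omega> a x * sol \<omega> a x)))"
    by (auto simp: sol'_def fun_eq_iff)
  have "((\<lambda>x. - sqrt \<omega> * (?T x * (sol \<omega> a x * sol \<omega> a x))) has_real_derivative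
     - sqrt \<omega> * (((1 - (?T x)\<^sup>2) * (\<alpha> * sqrt \<omega>)) * (sol \<omega> a x * sol \<omega> a x) + (sol' \<omega> a x * sol \<omega> a x + sol' \<omega> a x * sol \<omega> a x) * ?T x)) (at x)"
    by (intro DERIV_cmult DERIV_mult DERIV_sol T)
  moreover have "- sqrt \<omega> * (((1 - (?T x)\<^sup>2) * (\<alpha> * sqrt \<omega>)) * (sol \<omega> a x * sol \<omega> a x) + (sol' \<omega> a x * sol \<omega> a x + sol' \<omega> a x * sol \<omega> a x) * ?T x)
     = q * (sol' \<omega> a x)\<^sup>2 - \<alpha> * \<omega> * (sol \<omega> a x)\<^sup>2"
  proof -
    have s: "sqrt \<omega> * sqrt \<omega> = \<omega>" using om by simp
    define S T0 r where "S = sol \<omega> a x" and "T0 = ?T x" and "r = sqrt \<omega>"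
    have s: "\<omega> = r * r" using om by (simp add: r_def)
    show ?thesis unfolding sol'_sq unfolding sol'_def S_def[symmetric] T0_def[symmetric] r_def[symmetric]
      unfolding q_eq s by (simp add: power2_eq_square algebra_simps)
  qed
  ultimately show ?thesis unfolding eq by simp
qed

lemma sol_energy_density:
  "(1/2) * (sol' \<omega> a x)\<^sup>2 - (1/p) * sol \<omega> a x powr p + (1 - \<beta>) / 2 * \<omega> * (sol \<omega> a x)\<^sup>2 =
   (q * (sol' \<omega> a x)\<^sup>2 - \<alpha> * \<omega> * (sol \<omega> a x)\<^sup>2) / q"
proof -
  define S T0 where "S = (sol \<omega> a x)\<^sup>2" and "T0 = (tanh (\<alpha> * (sqrt \<omega> * x + a)))\<^sup>2"
  have e: "(1/p) * (\<omega> * (p / 2) * (1 - T0) * S) = \<omega> / 2 * (1 - T0) * S"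
    using p_gt by simp
  have "\<alpha> + 2 \<noteq> 0" using q_pos q_eq by simp
  then show ?thesis unfolding sol'_sq sol_powr_p S_def[symmetric] T0_def[symmetric] \<beta>_def e
    unfolding q_eq by (simp add: field_simps)
qed

lemma continuous_on_sol: "continuous_on A (sol \<omega> a)"
  using DERIV_sol by (meson DERIV_isCont continuous_at_imp_continuous_on)

lemma continuous_on_sol': "continuous_on A (sol' \<omega> a)"
  unfolding sol'_def[abs_def] by (intro continuous_intros continuous_on_sol) (simp add: cosh_real_nonzero)

lemma sol_sq_integrable: "set_integrable lborel {0<..} (\<lambda>x. (sol \<omega> a x)\<^sup>2)"
  and sol_mass: "(LBINT x:{0<..}. (sol \<omega> a x)\<^sup>2) = \<omega> powr \<gamma> * \<kappa> a"
proof -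
  let ?f = "\<lambda>y. indicator {a<..} y *\<^sub>R (Q y)\<^sup>2"
  have f: "integrable lborel ?f" using Q_sq_integrable by (simp add: set_integrable_def)
  have eq: "indicator {0<..} x *\<^sub>R (sol \<omega> a x)\<^sup>2 = (\<omega> powr (1 / \<alpha>)) * ?f (a + sqrt \<omega> * x)" for x
  proof -
    have "(\<omega> powr (1 / (2 * \<alpha>)))\<^sup>2 = \<omega> powr (1 / \<alpha>)"
      using om by (simp add: power2_eq_square flip: powr_add)
    moreover have "(indicator {0<..} x :: real) = indicator {a<..} (a + sqrt \<omega> * x)"
      using om by (simp add: indicator_def zero_less_mult_iff)
    ultimately show ?thesis by (simp add: sol_def power_mult_distrib add.commute)
  qed
  show "set_integrable lborel {0<..} (\<lambda>x. (sol \<omega> a x)\<^sup>2)"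
    unfolding set_integrable_def eq
    using lborel_integrable_real_affine[OF f, of "sqrt \<omega>" a] om by simp
  have "\<kappa> a = sqrt \<omega> * (LBINT x. ?f (a + sqrt \<omega> * x))"
    unfolding \<kappa>_def set_lebesgue_integral_def
    using lborel_integral_real_affine[of "sqrt \<omega>" ?f a] om by simp
  then have "(LBINT x. ?f (a + sqrt \<omega> * x)) = \<kappa> a / sqrt \<omega>" using om by simp
  then have "(LBINT x:{0<..}. (sol \<omega> a x)\<^sup>2) = \<omega> powr (1 / \<alpha>) * (\<kappa> a / sqrt \<omega>)"
    unfolding set_lebesgue_integral_def eq by simp
  also have "\<dots> = \<omega> powr \<gamma> * \<kappa> a"
    using om by (simp add: \<gamma>_def powr_diff powr_half_sqrt)
  finally show "(LBINT x:{0<..}. (sol \<omega> a x)\<^sup>2) = \<omega> powr \<gamma> * \<kappa> a" .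
qed

lemma tanh_sq_le_1: "(tanh (y::real))\<^sup>2 \<le> 1"
  using tanh_real_lt_1[of y] tanh_real_gt_neg1[of y] by (simp add: abs_square_le_1 less_imp_le)

lemma sol_bounded_integrable:
  assumes "continuous_on UNIV f" "\<And>x. \<bar>f x\<bar> \<le> C * (sol \<omega> a x)\<^sup>2"
  shows "set_integrable lborel {0<..} f"
  unfolding set_integrable_def
proof (rule Bochner_Integration.integrable_bound)
  show "integrable lborel (\<lambda>x. C * (indicator {0<..} x *\<^sub>R (sol \<omega> a x)\<^sup>2))"
    using sol_sq_integrable by (simp add: set_integrable_def)
  have "(\<lambda>x. indicator {0<..} x *\<^sub>R f x) \<in> borel_measurable borel"
    by (intro borel_measurable_continuous_on_indicator continuous_on_subset[OF assms(1)]) auto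
  then show "(\<lambda>x. indicator {0<..} x *\<^sub>R f x) \<in> borel_measurable lborel" by simp
  show "AE x in lborel. norm (indicator {0<..} x *\<^sub>R f x) \<le> norm (C * (indicator {0<..} x *\<^sub>R (sol \<omega> a x)\<^sup>2))"
    using assms(2) by (intro AE_I2) (auto simp: indicator_def intro: order_trans[OF _ abs_ge_self])
qed

lemma sol'_sq_integrable: "set_integrable lborel {0<..} (\<lambda>x. (sol' \<omega> a x)\<^sup>2)"
  by (rule sol_bounded_integrable[where C = \<omega>])
     (use om in \<open>auto intro!: continuous_intros continuous_on_sol continuous_on_sol'
        simp: sol'_sq mult_left_le_one_le tanh_sq_le_1\<close>)

lemma sol_powr_integrable: "set_integrable lborel {0<..} (\<lambda>x. sol \<omega> a x powr p)"
proof (rule sol_bounded_integrable[where C = "\<omega> * (p / 2)"])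
  show "continuous_on UNIV (\<lambda>x. sol \<omega> a x powr p)"
    using sol_pos by (intro continuous_intros continuous_on_sol) (auto simp: less_imp_neq[symmetric] dest: less_imp_neq)
  fix x
  have "0 \<le> 1 - (tanh (\<alpha> * (sqrt \<omega> * x + a)))\<^sup>2" "1 - (tanh (\<alpha> * (sqrt \<omega> * x + a)))\<^sup>2 \<le> 1"
    using tanh_sq_le_1 by auto
  then show "\<bar>sol \<omega> a x powr p\<bar> \<le> \<omega> * (p / 2) * (sol \<omega> a x)\<^sup>2"
    unfolding sol_powr_p using om p_gt by (auto simp: abs_mult mult_left_le_one_le)
qed

lemma sol_tendsto_0: "(sol \<omega> a \<longlongrightarrow> 0) at_top"
proof -
  have "filterlim (\<lambda>x. sqrt \<omega> * x + a) at_top at_top" using om by real_asymp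
  from tendsto_mult_right_zero[OF filterlim_compose[OF Q_tendsto_0 this]] show ?thesis
    unfolding sol_def[abs_def] by simp
qed

lemma sol_flux: "(LBINT x:{0<..}. q * (sol' \<omega> a x)\<^sup>2 - \<alpha> * \<omega> * (sol \<omega> a x)\<^sup>2) = sqrt \<omega> * tanh (\<alpha> * a) * (sol \<omega> a 0)\<^sup>2"
proof -
  have "(LBINT x:{0<..}. q * (sol' \<omega> a x)\<^sup>2 - \<alpha> * \<omega> * (sol \<omega> a x)\<^sup>2) = 0 - sol \<omega> a 0 * sol' \<omega> a 0"
  proof (rule set_integral_FTC_Ioi)
    show "((\<lambda>x. sol \<omega> a x * sol' \<omega> a x) has_real_derivative (q * (sol' \<omega> a x)\<^sup>2 - \<alpha> * \<omega> * (sol \<omega> a x)\<^sup>2)) (at x within {0..})" for x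
      using DERIV_sol_flux by (rule has_field_derivative_at_within)
    show "continuous_on {0..} (\<lambda>x. q * (sol' \<omega> a x)\<^sup>2 - \<alpha> * \<omega> * (sol \<omega> a x)\<^sup>2)"
      by (intro continuous_intros continuous_on_sol continuous_on_sol')
    show "set_integrable lborel {0<..} (\<lambda>x. q * (sol' \<omega> a x)\<^sup>2 - \<alpha> * \<omega> * (sol \<omega> a x)\<^sup>2)"
      using sol'_sq_integrable sol_sq_integrable by (intro set_integral_diff) auto
    have "((\<lambda>x. sqrt \<omega> * (sol \<omega> a x)\<^sup>2) \<longlongrightarrow> 0) at_top"
      using sol_tendsto_0 by (auto intro!: tendsto_eq_intros)
    then show "((\<lambda>x. sol \<omega> a x * sol' \<omega> a x) \<longlongrightarrow> 0) at_top"
    proof (rule Lim_null_comparison[rotated], intro always_eventually allI)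
      fix x
      have "\<bar>tanh (\<alpha> * (sqrt \<omega> * x + a))\<bar> \<le> 1" 
        using tanh_real_lt_1 tanh_real_gt_neg1 by (intro abs_leI) (auto intro: less_imp_le simp: minus_le_iff)
      then have "sqrt \<omega> * (sol \<omega> a x)\<^sup>2 * \<bar>tanh (\<alpha> * (sqrt \<omega> * x + a))\<bar> \<le> sqrt \<omega> * (sol \<omega> a x)\<^sup>2 * 1"
        using om by (intro mult_left_mono) auto
      then show "norm (sol \<omega> a x * sol' \<omega> a x) \<le> sqrt \<omega> * (sol \<omega> a x)\<^sup>2"
        using om by (simp add: sol'_def abs_mult power2_eq_square ac_simps)
    qed
  qed
  then show ?thesis by (simp add: sol'_def power2_eq_square)
qed

lemma sol_kinetic: "(LBINT x:{0<..}. (sol' \<omega> a x)\<^sup>2) = (sqrt \<omega> * tanh (\<alpha> * a) * (sol \<omega> a 0)\<^sup>2 + \<alpha> * \<omega> * (\<omega> powr \<gamma> * \<kappa> a)) / q"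
proof -
  have "q * (LBINT x:{0<..}. (sol' \<omega> a x)\<^sup>2) - \<alpha> * \<omega> * (\<omega> powr \<gamma> * \<kappa> a) = sqrt \<omega> * tanh (\<alpha> * a) * (sol \<omega> a 0)\<^sup>2"
    using sol_flux sol'_sq_integrable sol_sq_integrable by (subst (asm) set_integral_diff(2)) (auto simp: sol_mass)
  then show ?thesis using q_pos by (simp add: field_simps)
qed

text \<open>
  The first term is a boundary term at the vertex. Summed over the half-lines, these terms cancel the
  point nonlinearity when the Kirchhoff condition holds.
\<close>

lemma sol_energy: "(1/2) * (LBINT x:{0<..}. (sol' \<omega> a x)\<^sup>2) - (1/p) * (LBINT x:{0<..}. sol \<omega> a x powr p)
   = sqrt \<omega> * tanh (\<alpha> * a) * (sol \<omega> a 0)\<^sup>2 / q - (1 - \<beta>) / 2 * \<omega> * (\<omega> powr \<gamma> * \<kappa> a)"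
proof -
  have "(LBINT x:{0<..}. (1/2) * (sol' \<omega> a x)\<^sup>2 - (1/p) * sol \<omega> a x powr p + (1 - \<beta>) / 2 * \<omega> * (sol \<omega> a x)\<^sup>2)
     = (LBINT x:{0<..}. (1/2) * (sol' \<omega> a x)\<^sup>2 - (1/p) * sol \<omega> a x powr p) + (LBINT x:{0<..}. (1 - \<beta>) / 2 * \<omega> * (sol \<omega> a x)\<^sup>2)"
    using sol'_sq_integrable sol_sq_integrable sol_powr_integrable
    by (intro set_integral_add(2) set_integral_diff(1) set_integrable_mult_right)
  also have "(LBINT x:{0<..}. (1/2) * (sol' \<omega> a x)\<^sup>2 - (1/p) * sol \<omega> a x powr p)
     = (LBINT x:{0<..}. (1/2) * (sol' \<omega> a x)\<^sup>2) - (LBINT x:{0<..}. (1/p) * sol \<omega> a x powr p)"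
    using sol'_sq_integrable sol_powr_integrable
    by (intro set_integral_diff(2) set_integrable_mult_right)
  finally have "(LBINT x:{0<..}. (q * (sol' \<omega> a x)\<^sup>2 - \<alpha> * \<omega> * (sol \<omega> a x)\<^sup>2) / q) = (1/2) * (LBINT x:{0<..}. (sol' \<omega> a x)\<^sup>2) - (1/p) * (LBINT x:{0<..}. sol \<omega> a x powr p) + (1 - \<beta>) / 2 * \<omega> * (\<omega> powr \<gamma> * \<kappa> a)"
    unfolding sol_energy_density by (simp only: set_integral_mult_right sol_mass)
  then show ?thesis by (simp add: sol_flux)
qed

lemma sol_H1: "H1_halfline (\<lambda>x. of_real (sol \<omega> a x))"
  and sol_weak_deriv: "(LBINT x:{0<..}. (norm (weak_deriv (\<lambda>x. of_real (sol \<omega> a x)) x))\<^sup>2) = (LBINT x:{0<..}. (sol' \<omega> a x)\<^sup>2)"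
proof -
  have D: "((\<lambda>x. complex_of_real (sol \<omega> a x)) has_vector_derivative of_real (sol' \<omega> a x)) (at x)" for x
    using DERIV_sol by (intro has_vector_derivative_of_real) (simp add: has_real_derivative_iff_has_vector_derivative)
  have c: "continuous_on UNIV (\<lambda>x. complex_of_real (sol' \<omega> a x))"
    by (intro continuous_intros continuous_on_sol')
  have L1: "L2_halfline (\<lambda>x. complex_of_real (sol \<omega> a x))"
    unfolding L2_halfline_def set_borel_measurable_def
    using sol_sq_integrable borel_measurable_continuous_on_indicator[of "{0<..}" "\<lambda>x. complex_of_real (sol \<omega> a x)"]
    by (auto intro!: continuous_intros continuous_on_sol)
  have L2: "L2_halfline (\<lambda>x. complex_of_real (sol' \<omega> a x))"
    unfolding L2_halfline_def set_borel_measurable_def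
    using sol'_sq_integrable borel_measurable_continuous_on_indicator[of "{0<..}" "\<lambda>x. complex_of_real (sol' \<omega> a x)"]
    by (auto intro!: continuous_intros continuous_on_sol')
  show "H1_halfline (\<lambda>x. of_real (sol \<omega> a x))" by (rule C1_H1_halfline(1)[OF D c L1 L2])
  show "(LBINT x:{0<..}. (norm (weak_deriv (\<lambda>x. of_real (sol \<omega> a x)) x))\<^sup>2) = (LBINT x:{0<..}. (sol' \<omega> a x)\<^sup>2)"
    using C1_H1_halfline(2)[OF D c L1 L2] by simp
qed

end

end

section \<open>The energy as a completed square\<close>

lemma DERIV_integral_halfline:
  fixes k :: "real \<Rightarrow> real"
  assumes k: "continuous_on {0..} k" and x: "0 \<le> x"
  shows "((\<lambda>x. integral {0..x} k) has_real_derivative k x) (at x within {0..})"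
proof -
  have "((\<lambda>x. integral {0..x} k) has_real_derivative k x) (at x within {0..x+1})"
    by (rule integral_has_real_derivative) (use x in \<open>auto intro: continuous_on_subset[OF k]\<close>)
  moreover have "at x within {0..x+1} = at x within {0..}"
    by (rule at_within_nhd[where S = "{..<x+1}"]) auto
  ultimately show ?thesis by simp
qed

lemma nonneg_derivative_imp_le:
  fixes F f :: "real \<Rightarrow> real"
  assumes "\<And>t. 0 \<le> t \<Longrightarrow> (F has_real_derivative f t) (at t within {0..})"
    and "0 \<le> r" "r \<le> s" and "\<And>t. r \<le> t \<Longrightarrow> t \<le> s \<Longrightarrow> 0 \<le> f t"
  shows "F r \<le> F s"
proof -
  have "0 \<le> s" using assms by simp
  obtain \<xi> where "min r s \<le> \<xi>" "\<xi> \<le> max r s" "F s - F r = f \<xi> * (s - r)"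
    by (rule mean_value_halfline[OF assms(1) assms(2) \<open>0 \<le> s\<close>])
  moreover from this have "0 \<le> f \<xi>" using assms(3) by (intro assms(4)) auto
  ultimately show ?thesis using assms(3) by (metis diff_ge_0_iff_ge mult_nonneg_nonneg)
qed

context subcritical
begin

text \<open>
  The slope of the soliton of frequency \<omega> at height r. Above the height of the
  soliton, where the radicand is negative, the maximum makes it 0.
\<close>

definition g :: "real \<Rightarrow> real \<Rightarrow> real" where
  "g \<omega> r = sqrt (max 0 (\<omega> * r\<^sup>2 - (2 / p) * r powr p))"

definition G :: "real \<Rightarrow> real \<Rightarrow> real" where
  "G \<omega> r = integral {0..r} (g \<omega>)"

lemma powr_p_split: "0 \<le> r \<Longrightarrow> r powr p = r powr (p - 2) * r\<^sup>2"
proof (cases "r = 0")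
  case False
  assume "0 \<le> r"
  have "r powr p = r powr (p - 2) * r powr 2" by (simp flip: powr_add)
  then show ?thesis using False \<open>0 \<le> r\<close> by simp
qed simp

lemma continuous_on_g: "continuous_on {0..} (g \<omega>)"
  unfolding g_def[abs_def] using p_gt
  by (intro continuous_intros continuous_on_powr') auto

lemma g_nonneg: "0 \<le> g \<omega> r" and g_0: "g \<omega> 0 = 0"
  by (simp_all add: g_def)

lemma g_sq:
  assumes "0 \<le> r" "(2 / p) * r powr (p - 2) \<le> \<omega>"
  shows "(g \<omega> r)\<^sup>2 = \<omega> * r\<^sup>2 - (2 / p) * r powr p"
proof -
  have "\<omega> * r\<^sup>2 - (2 / p) * r powr p = (\<omega> - (2 / p) * r powr (p - 2)) * r\<^sup>2"
    unfolding powr_p_split[OF assms(1)] by (simp add: algebra_simps)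
  also have "\<dots> \<ge> 0" using assms by simp
  finally show ?thesis by (simp add: g_def)
qed

lemma g_pos:
  assumes "0 < r" "(2 / p) * r powr (p - 2) < \<omega>"
  shows "0 < g \<omega> r"
proof -
  have "(g \<omega> r)\<^sup>2 = (\<omega> - (2 / p) * r powr (p - 2)) * r\<^sup>2"
    using g_sq[of r \<omega>] assms by (simp add: powr_p_split algebra_simps)
  also have "\<dots> > 0" using assms by simp
  finally show ?thesis using g_nonneg[of \<omega> r] by (metis less_eq_real_def zero_less_power2)
qed

lemma g_le:
  assumes "0 \<le> \<omega>" "0 \<le> r"
  shows "g \<omega> r \<le> sqrt \<omega> * r"
proof -
  have "max 0 (\<omega> * r\<^sup>2 - (2 / p) * r powr p) \<le> \<omega> * r\<^sup>2" using assms p_gt by auto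
  then have "g \<omega> r \<le> sqrt (\<omega> * r\<^sup>2)" unfolding g_def by (rule real_sqrt_le_mono)
  then show ?thesis using assms by (simp add: real_sqrt_mult)
qed

lemma powr_threshold_mono:
  assumes "0 \<le> r" "r \<le> s" "(2 / p) * s powr (p - 2) \<le> \<omega>"
  shows "(2 / p) * r powr (p - 2) \<le> \<omega>"
proof -
  have "r powr (p - 2) \<le> s powr (p - 2)" using assms p_gt by (intro powr_mono2) auto
  then have "(2 / p) * r powr (p - 2) \<le> (2 / p) * s powr (p - 2)" using p_gt by (intro mult_left_mono) auto
  then show ?thesis using assms(3) by linarith
qed

lemma powr_threshold_strict:
  assumes "0 \<le> r" "r < s" "(2 / p) * s powr (p - 2) \<le> \<omega>"
  shows "(2 / p) * r powr (p - 2) < \<omega>"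
proof -
  have "r powr (p - 2) < s powr (p - 2)" using assms p_gt by (intro powr_less_mono2) auto
  then have "(2 / p) * r powr (p - 2) < (2 / p) * s powr (p - 2)" using p_gt by (intro mult_strict_left_mono) auto
  then show ?thesis using assms(3) by linarith
qed

lemma G_0: "G \<omega> 0 = 0" by (simp add: G_def)

lemma DERIV_G: "0 \<le> t \<Longrightarrow> (G \<omega> has_real_derivative g \<omega> t) (at t within {0..})"
  unfolding G_def[abs_def] by (rule DERIV_integral_halfline[OF continuous_on_g])

lemma continuous_on_G: "continuous_on {0..} (G \<omega>)"
  using DERIV_G by (auto simp: continuous_on_eq_continuous_within intro: DERIV_continuous)

lemma G_mono: "0 \<le> r \<Longrightarrow> r \<le> s \<Longrightarrow> G \<omega> r \<le> G \<omega> s"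
  by (rule nonneg_derivative_imp_le[OF DERIV_G]) (auto intro: g_nonneg)

lemma G_nonneg: "0 \<le> r \<Longrightarrow> 0 \<le> G \<omega> r"
  using G_mono[of 0 r \<omega>] by (simp add: G_0)

lemma G_strict_mono:
  assumes "0 \<le> r" "r < s" "(2 / p) * s powr (p - 2) \<le> \<omega>"
  shows "G \<omega> r < G \<omega> s"
proof -
  \<comment> \<open>Interior points, since the slope may vanish at both ends.\<close>
  define x y where "x = (2 * r + s) / 3" and "y = (r + 2 * s) / 3"
  have xy: "r < x" "x < y" "y < s" "0 < x" using assms by (auto simp: x_def y_def)
  obtain \<xi> where \<xi>: "min x y \<le> \<xi>" "\<xi> \<le> max x y" "G \<omega> y - G \<omega> x = g \<omega> \<xi> * (y - x)"
    by (rule mean_value_halfline[OF DERIV_G, of x y]) (use xy in auto)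
  have "0 < g \<omega> \<xi>"
    by (rule g_pos[OF _ powr_threshold_strict[OF _ _ assms(3)]]) (use \<xi> xy in auto)
  then have "G \<omega> x < G \<omega> y" using \<xi>(3) xy by (metis diff_gt_0_iff_gt mult_pos_pos)
  then show ?thesis using G_mono[of r x \<omega>] G_mono[of y s \<omega>] assms xy by linarith
qed

text \<open>
  Because c^2 is at least c^p, the slope satisfies g (c t) >= c powr (p/2) * g t; integration adds 1
  to the exponent and gives q.
\<close>

lemma G_scaling_le:
  assumes "0 \<le> R" "0 \<le> c" "c \<le> 1" "(2 / p) * R powr (p - 2) \<le> \<omega>"
  shows "c powr q * G \<omega> R \<le> G \<omega> (c * R)"
proof (cases "c = 0")
  case True then show ?thesis by (simp add: G_0)
next
  case False
  then have c: "0 < c" using assms by simp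
  have D: "((\<lambda>r. G \<omega> (c * r) - c powr q * G \<omega> r) has_real_derivative (g \<omega> (c * t) * c - c powr q * g \<omega> t)) (at t within {0..})"
    if "0 \<le> t" for t
  proof (intro DERIV_diff DERIV_cmult DERIV_G that)
    have "((\<lambda>r. c * r) has_real_derivative c) (at t within {0..})" by (auto intro!: derivative_eq_intros)
    moreover have "(G \<omega> has_real_derivative g \<omega> (c * t)) (at (c * t) within (\<lambda>r. c * r) ` {0..})"
      by (rule DERIV_subset[OF DERIV_G]) (use c that in auto)
    ultimately show "((\<lambda>r. G \<omega> (c * r)) has_real_derivative g \<omega> (c * t) * c) (at t within {0..})"
      by (intro DERIV_image_chain[unfolded comp_def])
  qed
  have "G \<omega> (c * 0) - c powr q * G \<omega> 0 \<le> G \<omega> (c * R) - c powr q * G \<omega> R"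
  proof (rule nonneg_derivative_imp_le[OF D])
    fix t assume t: "0 \<le> t" "t \<le> R"
    have th: "(2 / p) * t powr (p - 2) \<le> \<omega>" by (rule powr_threshold_mono[OF t assms(4)])
    have ct: "0 \<le> c * t" "c * t \<le> t" using c t assms by (auto simp: mult_left_le_one_le)
    have th2: "(2 / p) * (c * t) powr (p - 2) \<le> \<omega>" by (rule powr_threshold_mono[OF ct th])
    have w0: "0 \<le> \<omega>" using th p_gt by (smt (verit) powr_ge_zero zero_le_divide_iff zero_le_mult_iff)
    have cp: "c powr p \<le> c\<^sup>2"
      using powr_mono'[of 2 p c] p_gt c assms by simp
    have "(c powr (p / 2) * g \<omega> t)\<^sup>2 = c powr p * (\<omega> * t\<^sup>2) - (2 / p) * (c powr p * t powr p)"
      using c by (simp add: power_mult_distrib g_sq[OF t(1) th] right_diff_distrib flip: powr_add) (simp add: power2_eq_square flip: powr_add)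
    also have "\<dots> \<le> c\<^sup>2 * (\<omega> * t\<^sup>2) - (2 / p) * (c powr p * t powr p)"
      using mult_right_mono[OF cp, of "\<omega> * t\<^sup>2"] w0 by simp
    also have "\<dots> = (g \<omega> (c * t))\<^sup>2"
      using c t by (simp add: g_sq[OF ct(1) th2] powr_mult power_mult_distrib mult_ac)
    finally have "c powr (p / 2) * g \<omega> t \<le> g \<omega> (c * t)"
      using g_nonneg power2_le_imp_le by blast
    from mult_right_mono[OF this, of c] show "0 \<le> g \<omega> (c * t) * c - c powr q * g \<omega> t"
      using c by (simp add: q_def powr_add mult_ac)
  qed (use assms in auto)
  then show ?thesis by (simp add: G_0)
qed

text \<open>
  The slopes g and g' for the two frequencies satisfy (g' - g) (g' + g) = (\<omega>' - \<omega>) t^2, and both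
  are at most sqrt \<omega>' * t.
\<close>

lemma G_frequency_gain:
  assumes "0 < \<omega>" "\<omega> \<le> \<omega>'" "0 \<le> r" "(2 / p) * r powr (p - 2) \<le> \<omega>"
  shows "G \<omega> r + (\<omega>' - \<omega>) * r\<^sup>2 / (4 * sqrt \<omega>') \<le> G \<omega>' r"
proof -
  define D where "D s = G \<omega>' s - G \<omega> s - (\<omega>' - \<omega>) / (4 * sqrt \<omega>') * s\<^sup>2" for s
  have w': "0 < \<omega>'" using assms by simp
  have D': "(D has_real_derivative (g \<omega>' t - g \<omega> t - (\<omega>' - \<omega>) / (4 * sqrt \<omega>') * (2 * t))) (at t within {0..})"
    if "0 \<le> t" for t
    unfolding D_def[abs_def] using that
    by (intro DERIV_diff DERIV_G DERIV_cmult) (auto intro!: derivative_eq_intros)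
  have "D 0 \<le> D r"
  proof (rule nonneg_derivative_imp_le[OF D'])
    fix t assume t: "0 \<le> t" "t \<le> r"
    have th: "(2 / p) * t powr (p - 2) \<le> \<omega>" by (rule powr_threshold_mono[OF t assms(4)])
    show "0 \<le> g \<omega>' t - g \<omega> t - (\<omega>' - \<omega>) / (4 * sqrt \<omega>') * (2 * t)"
    proof (cases "t = 0")
      case False
      then have tp: "0 < t" using t by simp
      have "(g \<omega>' t - g \<omega> t) * (g \<omega>' t + g \<omega> t) = (\<omega>' - \<omega>) * t\<^sup>2"
        using g_sq[OF t(1) th] g_sq[OF t(1), of \<omega>'] th assms
        by (simp add: algebra_simps power2_eq_square)
      moreover have le: "g \<omega>' t + g \<omega> t \<le> 2 * sqrt \<omega>' * t"
      proof -
        have "g \<omega> t \<le> sqrt \<omega> * t" "g \<omega>' t \<le> sqrt \<omega>' * t" using assms t by (auto intro: g_le)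
        moreover have "sqrt \<omega> * t \<le> sqrt \<omega>' * t" using assms t by (intro mult_right_mono) auto
        ultimately show ?thesis by linarith
      qed
      moreover have "0 \<le> g \<omega>' t - g \<omega> t"
      proof -
        have "\<omega> * t\<^sup>2 \<le> \<omega>' * t\<^sup>2" using assms by (intro mult_right_mono) auto
        then show ?thesis unfolding g_def by (simp add: real_sqrt_le_mono)
      qed
      ultimately have "(\<omega>' - \<omega>) * t\<^sup>2 \<le> (g \<omega>' t - g \<omega> t) * (2 * sqrt \<omega>' * t)"
        using mult_left_mono by metis
      then have "(\<omega>' - \<omega>) * t * t \<le> (g \<omega>' t - g \<omega> t) * (2 * sqrt \<omega>') * t" by (simp add: power2_eq_square mult_ac)
      then have "(\<omega>' - \<omega>) * t \<le> (g \<omega>' t - g \<omega> t) * (2 * sqrt \<omega>')" using tp by (rule mult_right_le_imp_le)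
      then show ?thesis using w' by (simp add: field_simps)
    qed (simp add: g_0)
  qed (use assms in auto)
  then show ?thesis by (simp add: D_def G_0)
qed

text \<open>
  Along a decreasing soliton the slope equals minus the derivative, so G of the initial height is
  the integral of the squared derivative.
\<close>

lemma G_sol:
  assumes om: "0 < \<omega>" and a: "0 \<le> a"
  shows "G \<omega> (sol \<omega> a 0) = (sqrt \<omega> * tanh (\<alpha> * a) * (sol \<omega> a 0)\<^sup>2 + \<alpha> * \<omega> * (\<omega> powr \<gamma> * \<kappa> a)) / q"
proof -
  have gs: "g \<omega> (sol \<omega> a x) = - sol' \<omega> a x" if "0 \<le> x" for x
  proof -
    have "(2 / p) * sol \<omega> a x powr (p - 2) = \<omega> * (1 - (tanh (\<alpha> * (sqrt \<omega> * x + a)))\<^sup>2)"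
      using p_gt by (simp add: sol_powr[OF om])
    also have "\<dots> \<le> \<omega>" using om by (simp add: mult_left_le)
    finally have "(g \<omega> (sol \<omega> a x))\<^sup>2 = (sol' \<omega> a x)\<^sup>2"
      using g_sq[of "sol \<omega> a x" \<omega>] sol_pos[OF om, of a x] p_gt
      by (simp add: sol_powr_p[OF om] sol'_sq[OF om] algebra_simps)
    moreover have "sol' \<omega> a x \<le> 0"
      using sol_pos[OF om, of a x] om a that alpha_pos by (simp add: sol'_def mult_nonneg_nonneg)
    ultimately show ?thesis
      using g_nonneg[of \<omega> "sol \<omega> a x"] unfolding power2_eq_iff by (elim disjE) linarith+
  qed
  have "(LBINT x:{0<..}. - (sol' \<omega> a x)\<^sup>2) = 0 - G \<omega> (sol \<omega> a 0)"
  proof (rule set_integral_FTC_Ioi[where F = "\<lambda>x. G \<omega> (sol \<omega> a x)"])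
    fix x :: real assume x: "0 \<le> x"
    have "(G \<omega> has_real_derivative g \<omega> (sol \<omega> a x)) (at (sol \<omega> a x) within sol \<omega> a ` {0..})"
      by (rule DERIV_subset[OF DERIV_G]) (use sol_pos[OF om] in \<open>auto intro: less_imp_le\<close>)
    moreover have "(sol \<omega> a has_real_derivative sol' \<omega> a x) (at x within {0..})"
      by (rule has_field_derivative_at_within[OF DERIV_sol[OF om]])
    ultimately have "((\<lambda>x. G \<omega> (sol \<omega> a x)) has_real_derivative g \<omega> (sol \<omega> a x) * sol' \<omega> a x) (at x within {0..})"
      by (rule DERIV_image_chain[unfolded comp_def])
    then show "((\<lambda>x. G \<omega> (sol \<omega> a x)) has_real_derivative - (sol' \<omega> a x)\<^sup>2) (at x within {0..})"
      by (simp add: gs[OF x] power2_eq_square)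
  next
    show "continuous_on {0..} (\<lambda>x. - (sol' \<omega> a x)\<^sup>2)" by (intro continuous_intros continuous_on_sol'[OF om])
    show "set_integrable lborel {0<..} (\<lambda>x. - (sol' \<omega> a x)\<^sup>2)"
      using sol'_sq_integrable[OF om, of a] by (simp add: set_integrable_def)
    from continuous_on_tendsto_compose[OF continuous_on_G sol_tendsto_0[OF om]]
    show "((\<lambda>x. G \<omega> (sol \<omega> a x)) \<longlongrightarrow> 0) at_top"
      using sol_pos[OF om] by (simp add: G_0 less_imp_le)
  qed
  then have "G \<omega> (sol \<omega> a 0) = (LBINT x:{0<..}. (sol' \<omega> a x)\<^sup>2)"
    by (simp add: set_lebesgue_integral_def)
  then show ?thesis by (simp add: sol_kinetic[OF om])
qed

text \<open>
  The two parts of the completed square: \<open>edge_flux\<close> bounds the total variation of G along the modulus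
  of the profile, and \<open>edge_defect\<close> measures the deviation from the soliton equation.
\<close>

definition edge_flux :: "real \<Rightarrow> (real \<Rightarrow> complex) \<Rightarrow> real" where
  "edge_flux \<omega> f = (LBINT t:{0<..}. g \<omega> (norm (f t)) * norm (weak_deriv f t))"

definition edge_defect :: "real \<Rightarrow> (real \<Rightarrow> complex) \<Rightarrow> real" where
  "edge_defect \<omega> f = (LBINT t:{0<..}. (norm (weak_deriv f t) - g \<omega> (norm (f t)))\<^sup>2)"

context
  fixes f :: "real \<Rightarrow> complex" and \<omega> M :: real
  assumes f: "H1_pair f (weak_deriv f)" and M: "\<And>t. 0 \<le> t \<Longrightarrow> norm (f t) \<le> M"
    and om: "0 \<le> \<omega>" "(2 / p) * M powr (p - 2) \<le> \<omega>"
begin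

lemma edge_threshold: "0 \<le> t \<Longrightarrow> (2 / p) * norm (f t) powr (p - 2) \<le> \<omega>"
  using powr_threshold_mono[OF _ M om(2)] by simp

lemma edge_defect_density:
  assumes "0 \<le> t"
  shows "(norm (weak_deriv f t) - g \<omega> (norm (f t)))\<^sup>2 =
    ((norm (weak_deriv f t))\<^sup>2 - 2 * (g \<omega> (norm (f t)) * norm (weak_deriv f t)))
      + (\<omega> * (norm (f t))\<^sup>2 - (2 / p) * norm (f t) powr p)"
proof -
  have "(y - x)\<^sup>2 = y\<^sup>2 - 2 * (x * y) + x\<^sup>2" for x y :: real
    by (simp add: power2_eq_square algebra_simps)
  then show ?thesis using g_sq[OF norm_ge_zero edge_threshold[OF assms]] by simp
qed

lemma edge_integrable:
  "set_integrable lborel {0<..} (\<lambda>t. norm (f t) powr p)"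
  "set_integrable lborel {0<..} (\<lambda>t. g \<omega> (norm (f t)) * norm (weak_deriv f t))"
  "set_integrable lborel {0<..} (\<lambda>t. (norm (weak_deriv f t) - g \<omega> (norm (f t)))\<^sup>2)"
proof -
  show 1: "set_integrable lborel {0<..} (\<lambda>t. norm (f t) powr p)"
  proof (rule H1_pair_integrable_comp[OF f, where c = "\<lambda>r. r powr p" and C = "p / 2 * \<omega>"])
    show "continuous_on {0..} (\<lambda>r::real. r powr p)"
      using p_gt by (intro continuous_intros continuous_on_powr') auto
    fix t :: real assume "0 < t"
    then have "norm (f t) powr (p - 2) \<le> p / 2 * \<omega>"
      using edge_threshold[of t] p_gt by (simp add: field_simps)
    from mult_right_mono[OF this, of "(norm (f t))\<^sup>2"]
    show "\<bar>norm (f t) powr p\<bar> \<le> p / 2 * \<omega> * (norm (f t))\<^sup>2"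
      by (simp add: powr_p_split)
  qed
  show 2: "set_integrable lborel {0<..} (\<lambda>t. g \<omega> (norm (f t)) * norm (weak_deriv f t))"
    by (rule H1_pair_integrable_weighted[OF f continuous_on_g, where C = "sqrt \<omega>"])
       (use om in \<open>auto simp: abs_of_nonneg g_nonneg intro: g_le\<close>)
  have "set_integrable lborel {0<..} (\<lambda>t. ((norm (weak_deriv f t))\<^sup>2 - 2 * (g \<omega> (norm (f t)) * norm (weak_deriv f t)))
      + (\<omega> * (norm (f t))\<^sup>2 - (2 / p) * norm (f t) powr p))"
    by (intro set_integral_add(1) set_integral_diff(1) set_integrable_mult_right 1 2 H1_pair_L2[OF f] H1_pair_L2_deriv[OF f])
  moreover have "indicator {0<..} t *\<^sub>R (norm (weak_deriv f t) - g \<omega> (norm (f t)))\<^sup>2 =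
     indicator {0<..} t *\<^sub>R (((norm (weak_deriv f t))\<^sup>2 - 2 * (g \<omega> (norm (f t)) * norm (weak_deriv f t)))
      + (\<omega> * (norm (f t))\<^sup>2 - (2 / p) * norm (f t) powr p))" for t
    using edge_defect_density[of t] by (cases "0 < t") auto
  ultimately show "set_integrable lborel {0<..} (\<lambda>t. (norm (weak_deriv f t) - g \<omega> (norm (f t)))\<^sup>2)"
    unfolding set_integrable_def by presburger
qed

text \<open>
  Expanding the square in the defect, with the square of g given by \<open>g_sq\<close>.
\<close>

lemma edge_action:
  "(1/2) * (LBINT t:{0<..}. (norm (weak_deriv f t))\<^sup>2) - (1/p) * (LBINT t:{0<..}. norm (f t) powr p)
   = edge_flux \<omega> f + (1/2) * edge_defect \<omega> f - (\<omega> / 2) * (LBINT t:{0<..}. (norm (f t))\<^sup>2)"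
proof -
  have "edge_defect \<omega> f = (LBINT t:{0<..}. ((norm (weak_deriv f t))\<^sup>2 - 2 * (g \<omega> (norm (f t)) * norm (weak_deriv f t)))
      + (\<omega> * (norm (f t))\<^sup>2 - (2 / p) * norm (f t) powr p))"
    unfolding edge_defect_def
    by (intro set_lebesgue_integral_cong allI impI edge_defect_density) auto
  also have "\<dots> = ((LBINT t:{0<..}. (norm (weak_deriv f t))\<^sup>2) - (LBINT t:{0<..}. 2 * (g \<omega> (norm (f t)) * norm (weak_deriv f t))))
      + ((LBINT t:{0<..}. \<omega> * (norm (f t))\<^sup>2) - (LBINT t:{0<..}. (2 / p) * norm (f t) powr p))"
    using edge_integrable H1_pair_L2[OF f] H1_pair_L2_deriv[OF f]
    by (simp add: set_integral_add set_integral_diff)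
  also have "\<dots> = ((LBINT t:{0<..}. (norm (weak_deriv f t))\<^sup>2) - 2 * edge_flux \<omega> f)
      + (\<omega> * (LBINT t:{0<..}. (norm (f t))\<^sup>2) - (2 / p) * (LBINT t:{0<..}. norm (f t) powr p))"
    by (simp only: set_integral_mult_right edge_flux_def)
  finally show ?thesis by (simp add: field_simps)
qed

lemma edge_defect_nonneg: "0 \<le> edge_defect \<omega> f"
  unfolding edge_defect_def set_lebesgue_integral_def
  by (intro Bochner_Integration.integral_nonneg) auto

lemma edge_defect_zero:
  assumes "edge_defect \<omega> f = 0"
  shows "AE t in lborel. 0 < t \<longrightarrow> norm (weak_deriv f t) = g \<omega> (norm (f t))"
proof -
  have "integrable lborel (\<lambda>t. indicator {0<..} t *\<^sub>R (norm (weak_deriv f t) - g \<omega> (norm (f t)))\<^sup>2)"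
    using edge_integrable(3) by (simp add: set_integrable_def)
  then have "AE t in lborel. indicator {0<..} t *\<^sub>R (norm (weak_deriv f t) - g \<omega> (norm (f t)))\<^sup>2 = 0"
    using assms unfolding edge_defect_def set_lebesgue_integral_def
    by (subst (asm) integral_nonneg_eq_0_iff_AE) auto
  then show ?thesis by eventually_elim (auto simp: indicator_def)
qed

lemma edge_flux_ge: "G \<omega> (norm (f 0)) \<le> edge_flux \<omega> f"
  unfolding edge_flux_def
  by (rule H1_pair_chain_tail[OF f DERIV_G G_0 continuous_on_g g_nonneg edge_integrable(2)]) auto

text \<open>
  Climbing from the height at the vertex to the height at x, then descending to 0.
\<close>

lemma edge_flux_ge_peak:
  assumes x: "0 \<le> x"
  shows "2 * G \<omega> (norm (f x)) - G \<omega> (norm (f 0)) \<le> edge_flux \<omega> f"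
proof -
  have "edge_flux \<omega> f = (LBINT t:{0<..x}. g \<omega> (norm (f t)) * norm (weak_deriv f t)) + (LBINT t:{x<..}. g \<omega> (norm (f t)) * norm (weak_deriv f t))"
    unfolding edge_flux_def by (rule set_integral_Ioc_Ioi_add[OF edge_integrable(2) x])
  moreover have "\<bar>G \<omega> (norm (f x)) - G \<omega> (norm (f 0))\<bar> \<le> (LBINT t:{0<..x}. g \<omega> (norm (f t)) * norm (weak_deriv f t))"
    by (rule H1_pair_chain_le[OF f DERIV_G continuous_on_g g_nonneg]) (use x in auto)
  moreover have "G \<omega> (norm (f x)) \<le> (LBINT t:{x<..}. g \<omega> (norm (f t)) * norm (weak_deriv f t))"
    by (rule H1_pair_chain_tail[OF f DERIV_G G_0 continuous_on_g g_nonneg edge_integrable(2) x]) auto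
  ultimately show ?thesis by linarith
qed

end

lemma star_peak:
  assumes u: "u \<in> H1_star N" and N: "1 \<le> N"
  obtains j x where "j \<in> {1..N}" "0 \<le> x" "\<And>i t. i \<in> {1..N} \<Longrightarrow> 0 \<le> t \<Longrightarrow> norm (u i t) \<le> norm (u j x)"
proof -
  have H: "H1_pair (u i) (weak_deriv (u i))" if "i \<in> {1..N}" for i
    using u that by (intro H1_pair_weak_deriv) (auto simp: H1_star_def continuous_on_star_def)
  have "\<forall>i\<in>{1..N}. \<exists>x\<ge>0. \<forall>y\<ge>0. norm (u i y) \<le> norm (u i x)"
    using H1_pair_max[OF H] by blast
  then obtain X where X: "\<And>i. i \<in> {1..N} \<Longrightarrow> 0 \<le> X i" "\<And>i y. i \<in> {1..N} \<Longrightarrow> 0 \<le> y \<Longrightarrow> norm (u i y) \<le> norm (u i (X i))"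
    by metis
  let ?S = "(\<lambda>i. norm (u i (X i))) ` {1..N}"
  have "Max ?S \<in> ?S" by (rule Max_in) (use N in auto)
  then obtain j where j: "j \<in> {1..N}" "norm (u j (X j)) = Max ?S" by auto
  have "norm (u i t) \<le> norm (u j (X j))" if "i \<in> {1..N}" "0 \<le> t" for i t
  proof -
    have "norm (u i t) \<le> norm (u i (X i))" by (rule X(2)[OF that])
    also have "\<dots> \<le> Max ?S" using that by (intro Max_ge) auto
    finally show ?thesis using j(2) by simp
  qed
  then show ?thesis using that[of j "X j"] j X(1) by blast
qed

lemma star_energy:
  assumes u: "u \<in> H1_star_mass N \<mu>" and N: "1 \<le> N"
    and M: "\<And>i t. i \<in> {1..N} \<Longrightarrow> 0 \<le> t \<Longrightarrow> norm (u i t) \<le> M"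
    and om: "0 \<le> \<omega>" "(2 / p) * M powr (p - 2) \<le> \<omega>"
  shows "energy p q N u = (\<Sum>i=1..N. edge_flux \<omega> (u i)) + (1/2) * (\<Sum>i=1..N. edge_defect \<omega> (u i))
     - (\<omega> / 2) * \<mu> - (1/q) * norm (u 1 0) powr q"
proof -
  have H: "H1_pair (u i) (weak_deriv (u i))" if "i \<in> {1..N}" for i
    using u that by (intro H1_pair_weak_deriv) (auto simp: H1_star_mass_def H1_star_def continuous_on_star_def)
  have "(1/2) * (\<Sum>i=1..N. LBINT t:{0<..}. (norm (weak_deriv (u i) t))\<^sup>2) - (1/p) * (\<Sum>i=1..N. LBINT t:{0<..}. norm (u i t) powr p)
    = (\<Sum>i=1..N. (1/2) * (LBINT t:{0<..}. (norm (weak_deriv (u i) t))\<^sup>2) - (1/p) * (LBINT t:{0<..}. norm (u i t) powr p))"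
    by (simp only: sum_distrib_left sum_subtractf)
  also have "\<dots> = (\<Sum>i=1..N. edge_flux \<omega> (u i) + (1/2) * edge_defect \<omega> (u i) - (\<omega> / 2) * (LBINT t:{0<..}. (norm (u i t))\<^sup>2))"
    by (intro sum.cong refl edge_action[OF H M om])
  also have "\<dots> = (\<Sum>i=1..N. edge_flux \<omega> (u i)) + (1/2) * (\<Sum>i=1..N. edge_defect \<omega> (u i)) - (\<omega> / 2) * star_mass N u"
    by (simp only: sum_distrib_left sum_subtractf sum.distrib star_mass_def)
  finally show ?thesis using u by (simp add: energy_def H1_star_mass_def)
qed

lemma star_vertex:
  assumes "u \<in> H1_star N" "i \<in> {1..N}"
  shows "u i 0 = u 1 0"
proof -
  have "\<forall>i\<in>{1..N}. \<forall>j\<in>{1..N}. u i 0 = u j 0"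
    using assms(1) unfolding H1_star_def continuous_on_star_def by blast
  moreover have "1 \<in> {1..N}" using assms(2) by auto
  ultimately show ?thesis using assms(2) by blast
qed

text \<open>
  For a single half-line the second coefficient is -1: the climb starts at the vertex value.
\<close>

lemma star_flux_ge:
  assumes u: "u \<in> H1_star N" and N: "1 \<le> N" and j: "j \<in> {1..N}" "0 \<le> x"
    and M: "\<And>i t. i \<in> {1..N} \<Longrightarrow> 0 \<le> t \<Longrightarrow> norm (u i t) \<le> M"
    and om: "0 \<le> \<omega>" "(2 / p) * M powr (p - 2) \<le> \<omega>"
  shows "2 * G \<omega> (norm (u j x)) + (real N - 2) * G \<omega> (norm (u 1 0)) \<le> (\<Sum>i=1..N. edge_flux \<omega> (u i))"
proof -
  have H: "H1_pair (u i) (weak_deriv (u i))" if "i \<in> {1..N}" for i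
    using u that by (intro H1_pair_weak_deriv) (auto simp: H1_star_def continuous_on_star_def)
  note v = star_vertex[OF u]
  have "(\<Sum>i=1..N. edge_flux \<omega> (u i)) = edge_flux \<omega> (u j) + (\<Sum>i\<in>{1..N} - {j}. edge_flux \<omega> (u i))"
    using j by (simp add: sum.remove)
  moreover have "2 * G \<omega> (norm (u j x)) - G \<omega> (norm (u 1 0)) \<le> edge_flux \<omega> (u j)"
    using edge_flux_ge_peak[OF H[OF j(1)] M[OF j(1)] om j(2)] v[OF j(1)] by simp
  moreover have "(\<Sum>i\<in>{1..N} - {j}. G \<omega> (norm (u 1 0))) \<le> (\<Sum>i\<in>{1..N} - {j}. edge_flux \<omega> (u i))"
  proof (rule sum_mono)
    fix i assume "i \<in> {1..N} - {j}"
    then have i: "i \<in> {1..N}" by blast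
    show "G \<omega> (norm (u 1 0)) \<le> edge_flux \<omega> (u i)"
      using edge_flux_ge[OF H[OF i] M[OF i] om] v[OF i] by simp
  qed
  moreover have "(\<Sum>i\<in>{1..N} - {j}. G \<omega> (norm (u 1 0))) = (real N - 1) * G \<omega> (norm (u 1 0))"
    using j N by (simp add: of_nat_diff)
  ultimately show ?thesis by (simp add: algebra_simps)
qed

end

section \<open>The two model profiles and their energy levels\<close>

lemma tanh_artanh_real:
  fixes x :: real
  assumes "-1 < x" "x < 1"
  shows "tanh (artanh x) = x"
proof -
  have z: "0 < (1 + x) / (1 - x)" using assms by simp
  have "exp (- 2 * artanh x) = (1 - x) / (1 + x)"
    unfolding artanh_def using z by (simp add: exp_minus)
  then have "tanh (artanh x) = (1 - (1 - x) / (1 + x)) / (1 + (1 - x) / (1 + x))"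
    by (simp only: tanh_real_altdef)
  also have "\<dots> = x" using assms by (simp add: field_simps)
  finally show ?thesis .
qed

text \<open>
  Gronwall's inequality for the integral of the modulus.
\<close>

lemma zero_of_sublinear_derivative:
  assumes f: "H1_pair f h" and f0: "f 0 = 0" and C: "0 \<le> C"
    and h: "AE t in lborel. 0 < t \<longrightarrow> norm (h t) \<le> C * norm (f t)" and t: "0 \<le> t"
  shows "f t = 0"
proof -
  have cf: "continuous_on {0..} (\<lambda>t. norm (f t))"
    using f by (auto simp: H1_pair_def intro: continuous_intros)
  define I where "I x = integral {0..x} (\<lambda>t. norm (f t))" for x
  have I0: "0 \<le> I x" for x
    unfolding I_def by (rule Henstock_Kurzweil_Integration.integral_nonneg) 
      (auto intro!: integrable_continuous_interval continuous_on_subset[OF cf])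
  have DI: "(I has_real_derivative norm (f x)) (at x within {0..})" if "0 \<le> x" for x
    unfolding I_def[abs_def] by (rule DERIV_integral_halfline[OF cf that])
  have le: "norm (f x) \<le> C * I x" if x: "0 \<le> x" for x
  proof -
    have i: "set_integrable lborel {0<..x} (\<lambda>t. C * norm (f t))"
      by (intro set_integrable_subset[OF set_integrable_continuous_Icc[of 0 x]])
         (auto intro!: continuous_intros continuous_on_subset[OF cf])
    have ii: "set_integrable lborel {0..x} (\<lambda>t. norm (f t))"
      by (intro set_integrable_continuous_Icc continuous_on_subset[OF cf]) auto
    have "norm (f x) \<le> (LBINT t:{0<..x}. norm (h t))"
      using H1_pair_norm_increment[OF f, of 0 x] x f0 by simp
    also have "\<dots> \<le> (LBINT t:{0<..x}. C * norm (f t))"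
      unfolding set_lebesgue_integral_def
    proof (rule integral_mono_AE)
      show "integrable lborel (\<lambda>t. indicat_real {0<..x} t *\<^sub>R norm (h t))"
        using H1_pair_norm_integrable[OF f, of 0 x] x by (simp add: set_integrable_def)
      show "integrable lborel (\<lambda>t. indicat_real {0<..x} t *\<^sub>R (C * norm (f t)))"
        using i by (simp add: set_integrable_def)
      show "AE t in lborel. indicat_real {0<..x} t *\<^sub>R norm (h t) \<le> indicat_real {0<..x} t *\<^sub>R (C * norm (f t))"
        using h by eventually_elim (auto simp: indicator_def)
    qed
    also have "\<dots> = C * (LBINT t:{0..x}. norm (f t))"
      using set_integral_Ioc_eq_Icc[OF ii] by simp
    also have "(LBINT t:{0..x}. norm (f t)) = I x"
      unfolding I_def by (rule set_borel_integral_eq_integral(2)[OF ii])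
    finally show ?thesis .
  qed
  have "0 = - I 0 * exp (- C * 0)" by (simp add: I_def)
  also have "\<dots> \<le> - I t * exp (- C * t)"
  proof (rule nonneg_derivative_imp_le[where F = "\<lambda>x. - I x * exp (- C * x)"
        and f = "\<lambda>x. exp (- C * x) * (C * I x - norm (f x))"])
    fix x :: real assume x: "0 \<le> x"
    have "((\<lambda>x. - I x * exp (- C * x)) has_real_derivative
       (- norm (f x)) * exp (- C * x) + (exp (- C * x) * (- C)) * (- I x)) (at x within {0..})"
    proof (intro DERIV_mult DERIV_minus DI x)
      show "((\<lambda>x. exp (- C * x)) has_real_derivative exp (- C * x) * - C) (at x within {0..})"
        by (rule has_field_derivative_at_within) (auto intro!: derivative_eq_intros)
    qed
    then show "((\<lambda>x. - I x * exp (- C * x)) has_real_derivative exp (- C * x) * (C * I x - norm (f x))) (at x within {0..})"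
      by (simp add: algebra_simps)
  qed (use le t in auto)
  finally have "I t * exp (- C * t) \<le> 0" by simp
  then have "I t \<le> 0" by (simp add: mult_le_0_iff)
  then show ?thesis using le[OF t] I0[of t] by simp
qed

text \<open>
  The function x - x powr b / b has derivative 1 - x powr (b - 1), which changes sign exactly at 1.
\<close>

lemma Bernoulli_powr:
  fixes b x :: real
  assumes b: "1 < b" and x: "0 < x"
  shows "x - x powr b / b \<le> 1 - 1 / b" and "x - x powr b / b = 1 - 1 / b \<Longrightarrow> x = 1"
proof -
  let ?f = "\<lambda>x::real. x - x powr b / b"
  have D: "(?f has_real_derivative 1 - y powr (b - 1)) (at y)" if "0 < y" for y
    using that b by (auto intro!: derivative_eq_intros)
  have c: "continuous_on A ?f" if "A \<subseteq> {0<..}" for A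
    using that D by (meson DERIV_isCont continuous_at_imp_continuous_on greaterThan_iff subsetD)
  have strict: "?f x < ?f 1" if "x \<noteq> 1"
  proof (cases "x < 1")
    case True
    show ?thesis
    proof (rule DERIV_pos_imp_increasing_open[OF True])
      fix y assume y: "x < y" "y < 1"
      then have "y powr (b - 1) < 1 powr (b - 1)" using x b by (intro powr_less_mono2) auto
      then show "\<exists>d. (?f has_real_derivative d) (at y) \<and> 0 < d"
        using D[of y] x y by (intro exI[of _ "1 - y powr (b - 1)"]) auto
    qed (rule c, use x in auto)
  next
    case False
    then have gt: "1 < x" using that by simp
    show ?thesis
    proof (rule DERIV_neg_imp_decreasing_open[OF gt])
      fix y :: real assume y: "1 < y" "y < x"
      then have "1 powr (b - 1) < y powr (b - 1)" using b by (intro powr_less_mono2) auto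
      then show "\<exists>d. (?f has_real_derivative d) (at y) \<and> d < 0"
        using D[of y] y by (intro exI[of _ "1 - y powr (b - 1)"]) auto
    qed (rule c, auto)
  qed
  show "x - x powr b / b \<le> 1 - 1 / b" using strict by (cases "x = 1") auto
  show "x - x powr b / b = 1 - 1 / b \<Longrightarrow> x = 1" using strict by auto
qed

context subcritical
begin

text \<open>
  The position at which N equal pieces of a soliton satisfy the Kirchhoff condition at the vertex; in
  the rescaled variable it is the same for all frequencies, because q = p/2 + 1.
\<close>

definition shift :: "nat \<Rightarrow> real" where
  "shift N = artanh (1 / sqrt (1 + 2 * (real N)\<^sup>2 / p)) / \<alpha>"

definition radial_mass :: "nat \<Rightarrow> real" where "radial_mass N = real N * \<kappa> (shift N)"

text \<open>
  The frequency at which a profile of mass k at frequency 1 has mass \<mu>.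
\<close>

definition freq :: "real \<Rightarrow> real \<Rightarrow> real" where "freq \<mu> k = (\<mu> / k) powr (1 / \<gamma>)"

lemma freq_pos: "0 < \<mu> \<Longrightarrow> 0 < k \<Longrightarrow> 0 < freq \<mu> k" by (simp add: freq_def)

lemma freq_mass: "0 < \<mu> \<Longrightarrow> 0 < k \<Longrightarrow> freq \<mu> k powr \<gamma> * k = \<mu>"
  using gamma_pos by (simp add: freq_def powr_powr)

text \<open>
  The energy at mass \<mu> of a model profile that has mass k at frequency 1.
\<close>

definition level :: "real \<Rightarrow> real \<Rightarrow> real" where
  "level \<mu> k = - ((1 - \<beta>) / 2 * freq \<mu> k * \<mu>)"

lemma tanh_shift:
  assumes "1 \<le> N"
  shows "tanh (\<alpha> * shift N) = 1 / sqrt (1 + 2 * (real N)\<^sup>2 / p)"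
proof -
  have "0 < 2 * (real N)\<^sup>2 / p" using p_gt assms by simp
  then have s: "1 < sqrt (1 + 2 * (real N)\<^sup>2 / p)" by simp
  then have "0 < 1 / sqrt (1 + 2 * (real N)\<^sup>2 / p)" "1 / sqrt (1 + 2 * (real N)\<^sup>2 / p) < 1"
    by (simp_all add: divide_less_eq)
  moreover have "\<alpha> * shift N = artanh (1 / sqrt (1 + 2 * (real N)\<^sup>2 / p))"
    unfolding shift_def using alpha_pos by simp
  ultimately show ?thesis using tanh_artanh_real by (metis less_trans neg_less_0_iff_less zero_less_one)
qed

lemma tanh_shift_sq:
  assumes "1 \<le> N"
  shows "(tanh (\<alpha> * shift N))\<^sup>2 = 1 / (1 + 2 * (real N)\<^sup>2 / p)"
proof -
  have "0 \<le> 1 + 2 * (real N)\<^sup>2 / p" using p_gt by simp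
  then show ?thesis by (simp add: tanh_shift[OF assms] power_divide)
qed

lemma shift_pos: assumes "1 \<le> N" shows "0 < shift N"
proof -
  have "0 < 2 * (real N)\<^sup>2 / p" using p_gt assms by simp
  then have "0 < 1 + 2 * (real N)\<^sup>2 / p" by simp
  then have "0 < tanh (\<alpha> * shift N)" by (simp add: tanh_shift[OF assms])
  then show ?thesis using alpha_pos by (simp add: zero_less_mult_iff)
qed

lemma shift_strict_antimono: assumes "1 \<le> N" "N < N'" shows "shift N' < shift N"
proof -
  have "(real N)\<^sup>2 < (real N')\<^sup>2" using assms by (intro power_strict_mono) auto
  then have "1 + 2 * (real N)\<^sup>2 / p < 1 + 2 * (real N')\<^sup>2 / p" using p_gt by (simp add: divide_strict_right_mono)
  moreover have "0 < 1 + 2 * (real N)\<^sup>2 / p" using p_gt by (simp add: add_pos_nonneg)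
  ultimately have "tanh (\<alpha> * shift N') < tanh (\<alpha> * shift N)"
    using assms by (simp add: tanh_shift divide_strict_left_mono)
  then show ?thesis using alpha_pos by simp
qed

lemma radial_mass_pos: "1 \<le> N \<Longrightarrow> 0 < radial_mass N" by (simp add: radial_mass_def \<kappa>_pos)

lemma radial_mass_mono: assumes "1 \<le> N" "N \<le> N'" shows "radial_mass N \<le> radial_mass N'"
proof (cases "N = N'")
  case False
  then have "\<kappa> (shift N) \<le> \<kappa> (shift N')" using assms shift_strict_antimono[of N N'] \<kappa>_strict by (simp add: less_imp_le)
  then show ?thesis unfolding radial_mass_def using assms \<kappa>_pos[of "shift N"] by (intro mult_mono) auto
qed simp

text \<open>
  The shifts decrease with N, so the N pieces have masses bounded below by the mass of the piece for
  N = 1.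
\<close>

lemma radial_mass_unbounded: "\<exists>N\<ge>1. C < radial_mass N"
proof -
  obtain n where n: "C / \<kappa> (shift 1) < real n" using reals_Archimedean2 by blast
  define N where "N = max 2 n"
  have "\<kappa> (shift 1) < \<kappa> (shift N)" by (intro \<kappa>_strict shift_strict_antimono) (auto simp: N_def)
  moreover have "C < real N * \<kappa> (shift 1)"
    using n \<kappa>_pos[of "shift 1"] by (auto simp: N_def field_simps max_def intro: less_le_trans)
  ultimately have "C < radial_mass N" unfolding radial_mass_def N_def
    by (smt (verit) \<kappa>_pos mult_left_mono of_nat_0_le_iff)
  then show ?thesis by (intro exI[of _ N]) (auto simp: N_def)
qed

lemma radial_mass_2: "radial_mass 2 \<le> 2 * \<kappa> 0"
  using \<kappa>_strict[OF shift_pos, of 2] by (simp add: radial_mass_def)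

text \<open>
  The Kirchhoff condition fixes the ratio of the frequency to the power p - 2 of the vertex value, so
  each of the two determines the other.
\<close>

lemma sol_vertex_powr:
  assumes "0 < \<omega>" "1 \<le> N"
  shows "(1 / (real N)\<^sup>2 + 2 / p) * sol \<omega> (shift N) 0 powr (p - 2) = \<omega>"
proof -
  have "sol \<omega> (shift N) 0 powr (p - 2) = \<omega> * (p / 2) * (1 - 1 / (1 + 2 * (real N)\<^sup>2 / p))"
    using sol_powr[OF assms(1), of "shift N" 0] by (simp add: tanh_shift_sq[OF assms(2)])
  moreover have "(1 / n + 2 / P) * (P / 2 * (1 - 1 / (1 + 2 * n / P))) = 1" if "0 < n" "0 < P" for n P :: real
  proof -
    have "1 + 2 * n / P = (P + 2 * n) / P" using that by (simp add: field_simps)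
    moreover have "1 / n + 2 / P = (P + 2 * n) / (n * P)" using that by (simp add: field_simps)
    moreover have "1 - P / (P + 2 * n) = 2 * n / (P + 2 * n)" using that by (simp add: field_simps)
    ultimately show ?thesis using that by simp
  qed
  from this[of "(real N)\<^sup>2" p] have "(1 / (real N)\<^sup>2 + 2 / p) * (p / 2 * (1 - 1 / (1 + 2 * (real N)\<^sup>2 / p))) = 1"
    using assms p_gt by simp
  moreover have "c * (w * h * t) = w * (c * (h * t))" for c w h t :: real by simp
  ultimately show ?thesis by (simp only: mult_1_right)
qed

lemma sol_vertex_Kirchhoff:
  assumes "0 < \<omega>" "1 \<le> N"
  shows "real N * (sqrt \<omega> * tanh (\<alpha> * shift N) * (sol \<omega> (shift N) 0)\<^sup>2) = sol \<omega> (shift N) 0 powr q"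
proof -
  define A where "A = sol \<omega> (shift N) 0"
  define n where "n = (real N)\<^sup>2"
  have A: "0 < A" unfolding A_def by (rule sol_pos[OF assms(1)])
  have n: "0 < n" using assms by (simp add: n_def)
  have T: "0 < tanh (\<alpha> * shift N)" using shift_pos[OF assms(2)] alpha_pos by simp
  have "(A powr \<alpha>)\<^sup>2 = A powr (p - 2)"
    unfolding p_eq using A by (simp add: power2_eq_square flip: powr_add)
  also have "\<dots> = \<omega> / (1 / n + 2 / p)"
    using sol_vertex_powr[OF assms] n p_gt unfolding A_def[symmetric] n_def[symmetric]
    by (simp add: field_simps add_pos_pos)
  also have "\<dots> = n * (\<omega> * (1 / (1 + 2 * n / p)))"
    using n by (simp add: field_simps)
  also have "\<dots> = (real N * (sqrt \<omega> * tanh (\<alpha> * shift N)))\<^sup>2"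
    using assms by (simp add: power_mult_distrib tanh_shift_sq n_def)
  finally have "A powr \<alpha> = real N * (sqrt \<omega> * tanh (\<alpha> * shift N))"
    using T assms by (simp add: power2_eq_iff_nonneg)
  moreover have "A powr q = A powr \<alpha> * A\<^sup>2" unfolding q_eq using A by (simp add: powr_add)
  ultimately show ?thesis unfolding A_def by simp
qed

lemma omega_powr: "0 < \<omega> \<Longrightarrow> \<omega> * \<omega> powr \<gamma> = \<omega> powr (1 / \<beta>)"
  unfolding beta_gamma[symmetric] by (simp add: powr_add)

text \<open>
  By the Kirchhoff condition the boundary terms cancel the point nonlinearity.
\<close>

lemma radial_action:
  assumes "0 < \<omega>" "1 \<le> N"
  shows "real N * G \<omega> (sol \<omega> (shift N) 0) - (1/q) * sol \<omega> (shift N) 0 powr q = \<beta> / 2 * radial_mass N * \<omega> powr (1 / \<beta>)"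
proof -
  have "real N * G \<omega> (sol \<omega> (shift N) 0) = (real N * (sqrt \<omega> * tanh (\<alpha> * shift N) * (sol \<omega> (shift N) 0)\<^sup>2) + \<alpha> * radial_mass N * (\<omega> * \<omega> powr \<gamma>)) / q"
    using G_sol[OF assms(1), of "shift N"] shift_pos[OF assms(2)] by (simp add: radial_mass_def algebra_simps)
  then show ?thesis
    unfolding sol_vertex_Kirchhoff[OF assms] omega_powr[OF assms(1)]
    by (simp add: \<beta>_def add_divide_distrib)
qed

lemma soliton_action:
  assumes "0 < \<omega>"
  shows "2 * G \<omega> (sol \<omega> 0 0) = \<beta> / 2 * (2 * \<kappa> 0) * \<omega> powr (1 / \<beta>)"
  unfolding omega_powr[OF assms, symmetric] using G_sol[OF assms, of 0] by (simp add: \<beta>_def)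

text \<open>
  Bernoulli's inequality with exponent 1 / \<beta> for the ratio of \<omega> to the frequency of the model.
\<close>

lemma level_le:
  assumes "0 < \<mu>" "0 < k" "0 < \<omega>"
  shows "level \<mu> k \<le> - (\<omega> / 2) * \<mu> + \<beta> / 2 * k * \<omega> powr (1 / \<beta>)"
    and "level \<mu> k = - (\<omega> / 2) * \<mu> + \<beta> / 2 * k * \<omega> powr (1 / \<beta>) \<Longrightarrow> \<omega> = freq \<mu> k"
proof -
  define \<omega>0 where "\<omega>0 = freq \<mu> k"
  have w0: "0 < \<omega>0" unfolding \<omega>0_def using assms by (intro freq_pos)
  define x where "x = \<omega> / \<omega>0"
  have x: "0 < x" using w0 assms by (simp add: x_def)
  have "\<omega>0 powr \<gamma> = \<mu> / k" using assms gamma_pos by (simp add: \<omega>0_def freq_def powr_powr)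
  then have k: "k * \<omega>0 powr (1 / \<beta>) = \<mu> * \<omega>0"
    using assms omega_powr[OF w0] by (metis mult.left_commute nonzero_mult_div_cancel_left less_irrefl times_divide_eq_right mult.commute)
  have "\<omega> powr (1 / \<beta>) = x powr (1 / \<beta>) * \<omega>0 powr (1 / \<beta>)"
    using x w0 by (simp add: x_def flip: powr_mult)
  then have "\<beta> / 2 * k * \<omega> powr (1 / \<beta>) = \<beta> / 2 * x powr (1 / \<beta>) * (\<mu> * \<omega>0)"
    using k by (metis mult.assoc mult.left_commute)
  then have diff: "(- (\<omega> / 2) * \<mu> + \<beta> / 2 * k * \<omega> powr (1 / \<beta>)) - level \<mu> k
     = \<mu> * \<omega>0 / 2 * ((1 - 1 / (1 / \<beta>)) - (x - x powr (1 / \<beta>) / (1 / \<beta>)))"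
    using w0 unfolding level_def \<omega>0_def[symmetric] by (simp add: x_def field_simps)
  have b: "1 < 1 / \<beta>" using beta_pos beta_lt by simp
  have mw: "0 < \<mu> * \<omega>0 / 2" using assms w0 by simp
  have "0 \<le> (- (\<omega> / 2) * \<mu> + \<beta> / 2 * k * \<omega> powr (1 / \<beta>)) - level \<mu> k"
    unfolding diff using mw Bernoulli_powr(1)[OF b x] by (intro mult_nonneg_nonneg) auto
  then show "level \<mu> k \<le> - (\<omega> / 2) * \<mu> + \<beta> / 2 * k * \<omega> powr (1 / \<beta>)" by simp
  assume "level \<mu> k = - (\<omega> / 2) * \<mu> + \<beta> / 2 * k * \<omega> powr (1 / \<beta>)"
  then have "\<mu> * \<omega>0 / 2 * ((1 - 1 / (1 / \<beta>)) - (x - x powr (1 / \<beta>) / (1 / \<beta>))) = 0"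
    using diff by simp
  then have "(1 - 1 / (1 / \<beta>)) - (x - x powr (1 / \<beta>) / (1 / \<beta>)) = 0"
    using mw by (metis mult_eq_0_iff less_irrefl)
  then have "x - x powr (1 / \<beta>) / (1 / \<beta>) = 1 - 1 / (1 / \<beta>)" by linarith
  then have "x = 1" by (rule Bernoulli_powr(2)[OF b x])
  then show "\<omega> = freq \<mu> k" using w0 by (simp add: x_def \<omega>0_def)
qed

lemma level_le_iff:
  assumes "0 < \<mu>" "0 < k" "0 < k'"
  shows "level \<mu> k \<le> level \<mu> k' \<longleftrightarrow> k \<le> k'"
proof -
  have "0 < (1 - \<beta>) / 2 * \<mu>" using beta_lt assms by simp
  then have "level \<mu> k \<le> level \<mu> k' \<longleftrightarrow> (\<mu> / k') powr (1 / \<gamma>) \<le> (\<mu> / k) powr (1 / \<gamma>)"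
    unfolding level_def freq_def using beta_lt assms by (simp add: mult_le_cancel_left_pos)
  also have "\<dots> \<longleftrightarrow> \<mu> / k' \<le> \<mu> / k"
  proof
    show "(\<mu> / k') powr (1 / \<gamma>) \<le> (\<mu> / k) powr (1 / \<gamma>)" if "\<mu> / k' \<le> \<mu> / k"
      using that assms gamma_pos by (intro powr_mono2) auto
    show "\<mu> / k' \<le> \<mu> / k" if le: "(\<mu> / k') powr (1 / \<gamma>) \<le> (\<mu> / k) powr (1 / \<gamma>)"
    proof (rule ccontr)
      assume "\<not> \<mu> / k' \<le> \<mu> / k"
      then have "(\<mu> / k) powr (1 / \<gamma>) < (\<mu> / k') powr (1 / \<gamma>)"
        using assms gamma_pos by (intro powr_less_mono2) auto
      with le show False by simp
    qed
  qed
  also have "\<dots> \<longleftrightarrow> k \<le> k'" using assms by (simp add: field_simps)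
  finally show ?thesis .
qed

lemma sol_0_threshold:
  assumes "0 < \<omega>"
  shows "(2 / p) * sol \<omega> 0 0 powr (p - 2) = \<omega>"
  unfolding sol_powr[OF assms] using p_gt by simp

lemma vertex_coeff_pos: "1 \<le> N \<Longrightarrow> 0 < 1 / (real N)\<^sup>2 + 2 / p"
  using p_gt by (intro add_pos_pos) auto

lemma powr_inj:
  assumes "0 < r" "0 < s" "c \<noteq> 0" "c * r powr (p - 2) = c * s powr (p - 2)"
  shows "r = s"
proof -
  have "r powr (p - 2) = s powr (p - 2)" using assms by simp
  then have "(r powr (p - 2)) powr (1 / (p - 2)) = (s powr (p - 2)) powr (1 / (p - 2))" by simp
  then show ?thesis using assms p_gt by (simp add: powr_powr)
qed

text \<open>
  If the frequency is raised so that the height of its soliton goes from M to m, then G at a fixed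
  height r > 0 gains an amount linear in m - M, whereas G between M and m is of smaller order because
  the slope vanishes at the top of the soliton.
\<close>

lemma frequency_gain_beats_loss:
  assumes N: "3 \<le> N" and r: "0 < r" "r \<le> M" 
  shows "\<exists>m>M. 2 * (G (2 / p * m powr (p - 2)) m - G (2 / p * m powr (p - 2)) M)
     < (real N - 2) * (G (2 / p * m powr (p - 2)) r - G (2 / p * M powr (p - 2)) r)"
proof -
  define w where "w m = 2 / p * m powr (p - 2)" for m
  have M: "0 < M" using r by simp
  have w_pos: "0 < w m" if "0 < m" for m using that p_gt by (simp add: w_def)
  define D where "D = 2 / p * ((p - 2) * M powr (p - 2 - 1))"
  have D: "0 < D" using p_gt M by (simp add: D_def)
  have dw: "(w has_real_derivative D) (at M)"
    unfolding w_def[abs_def] D_def by (intro DERIV_cmult has_real_derivative_powr M)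
  then have slope: "((\<lambda>m. (w m - w M) / (m - M)) \<longlongrightarrow> D) (at_right M)"
    unfolding has_field_derivative_iff by (rule filterlim_mono) (auto simp: at_le)
  have cw: "(w \<longlongrightarrow> w M) (at_right M)"
    using DERIV_isCont[OF dw] unfolding isCont_def by (rule filterlim_mono) (auto simp: at_le)
  define L where "L m = 2 * sqrt (w m * m\<^sup>2 - 2 / p * M powr p)" for m
  define R where "R m = (real N - 2) * (((w m - w M) / (m - M)) * r\<^sup>2 / (4 * sqrt (w m)))" for m
  have "(L \<longlongrightarrow> 2 * sqrt (w M * M\<^sup>2 - 2 / p * M powr p)) (at_right M)"
    unfolding L_def[abs_def] by (intro tendsto_intros cw)
  moreover have "w M * M\<^sup>2 - 2 / p * M powr p = 0"
    using M by (simp add: w_def powr_p_split)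
  ultimately have L: "(L \<longlongrightarrow> 0) (at_right M)" by simp
  have R: "(R \<longlongrightarrow> (real N - 2) * (D * r\<^sup>2 / (4 * sqrt (w M)))) (at_right M)"
    unfolding R_def[abs_def] using w_pos[OF M] by (intro tendsto_intros cw slope) auto
  have "0 < (real N - 2) * (D * r\<^sup>2 / (4 * sqrt (w M)))"
    using N D r w_pos[OF M] by simp
  then obtain e where e: "0 < e" "e < (real N - 2) * (D * r\<^sup>2 / (4 * sqrt (w M)))"
    using dense by blast
  have "\<forall>\<^sub>F m in at_right M. M < m \<and> L m < R m"
    using order_tendstoD(2)[OF L e(1)] order_tendstoD(1)[OF R e(2)] eventually_at_right_less[of M]
    by eventually_elim linarith
  then obtain m where m: "M < m" "L m < R m"
    using eventually_happens[of _ "at_right M"] trivial_limit_at_right_real by blast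
  have m0: "0 < m" using m M by simp
  have wm: "w M \<le> w m" unfolding w_def using m M p_gt by (intro mult_left_mono powr_mono2) auto
  obtain \<xi> where \<xi>: "min M m \<le> \<xi>" "\<xi> \<le> max M m" "G (w m) m - G (w m) M = g (w m) \<xi> * (m - M)"
    by (rule mean_value_halfline[OF DERIV_G, of M m]) (use M m in auto)
  have xi: "M \<le> \<xi>" "\<xi> \<le> m" using \<xi> m by auto
  have "(g (w m) \<xi>)\<^sup>2 = w m * \<xi>\<^sup>2 - 2 / p * \<xi> powr p"
    by (rule g_sq[OF _ powr_threshold_mono[OF _ xi(2)]]) (use xi M in \<open>auto simp: w_def\<close>)
  also have "\<dots> \<le> w m * m\<^sup>2 - 2 / p * M powr p"
  proof (rule diff_mono)
    show "w m * \<xi>\<^sup>2 \<le> w m * m\<^sup>2" using xi M w_pos[OF m0] by (intro mult_left_mono power_mono) auto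
    show "2 / p * M powr p \<le> 2 / p * \<xi> powr p" using xi M p_gt by (intro mult_left_mono powr_mono2) auto
  qed
  finally have "g (w m) \<xi> \<le> L m / 2"
    unfolding L_def using real_le_rsqrt by simp
  then have "2 * (g (w m) \<xi> * (m - M)) \<le> L m * (m - M)"
    using mult_right_mono[of "g (w m) \<xi>" "L m / 2" "m - M"] m by simp
  also have "\<dots> < R m * (m - M)" using m by simp
  also have "\<dots> = (real N - 2) * ((w m - w M) * r\<^sup>2 / (4 * sqrt (w m)))"
    using m by (simp add: R_def)
  also have "\<dots> \<le> (real N - 2) * (G (w m) r - G (w M) r)"
  proof (rule mult_left_mono)
    have "2 / p * r powr (p - 2) \<le> w M"
      by (rule powr_threshold_mono[of r M]) (use r in \<open>auto simp: w_def\<close>)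
    from G_frequency_gain[OF w_pos[OF M] wm _ this] r
    show "(w m - w M) * r\<^sup>2 / (4 * sqrt (w m)) \<le> G (w m) r - G (w M) r" by simp
  qed (use N in auto)
  finally show ?thesis using \<xi>(3) m(1) unfolding w_def[symmetric] by (intro exI[of _ m]) simp
qed

end

section \<open>The lower bound for the energy\<close>

context subcritical
begin

context
  fixes N :: nat and \<mu> :: real and u :: star_fun and j :: nat and x :: real
  assumes N: "1 \<le> N" and mu: "0 < \<mu>" and u: "u \<in> H1_star_mass N \<mu>"
    and j: "j \<in> {1..N}" "0 \<le> x"
    and peak: "\<And>i t. i \<in> {1..N} \<Longrightarrow> 0 \<le> t \<Longrightarrow> norm (u i t) \<le> norm (u j x)"
begin

lemma star_H1: "u \<in> H1_star N"
  using u by (simp add: H1_star_mass_def)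

lemma star_pair: "i \<in> {1..N} \<Longrightarrow> H1_pair (u i) (weak_deriv (u i))"
  using star_H1 by (intro H1_pair_weak_deriv) (auto simp: H1_star_def continuous_on_star_def)

lemma peak_vertex: "norm (u 1 0) \<le> norm (u j x)"
  using peak[of 1 0] N by simp

lemma peak_pos: "0 < norm (u j x)"
proof (rule ccontr)
  assume "\<not> 0 < norm (u j x)"
  then have "u i t = 0" if "i \<in> {1..N}" "0 \<le> t" for i t using peak[OF that] by simp
  then have "(LBINT t:{0<..}. (norm (u i t))\<^sup>2) = 0" if "i \<in> {1..N}" for i
    unfolding set_lebesgue_integral_def
    by (intro integral_eq_zero_AE AE_I2) (use that in \<open>auto simp: indicator_def\<close>)
  then have "star_mass N u = 0" by (simp add: star_mass_def)
  then show False using u mu by (simp add: H1_star_mass_def)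
qed

lemma star_defect_nonneg:
  assumes "0 \<le> \<omega>" "(2 / p) * norm (u j x) powr (p - 2) \<le> \<omega>"
  shows "i \<in> {1..N} \<Longrightarrow> 0 \<le> edge_defect \<omega> (u i)" "0 \<le> (\<Sum>i=1..N. edge_defect \<omega> (u i))"
proof -
  show *: "0 \<le> edge_defect \<omega> (u i)" if "i \<in> {1..N}" for i
    by (rule edge_defect_nonneg[OF star_pair[OF that] peak[OF that] assms])
  then show "0 \<le> (\<Sum>i=1..N. edge_defect \<omega> (u i))" by (intro sum_nonneg) auto
qed

lemma star_energy_ge:
  assumes "0 \<le> \<omega>" "(2 / p) * norm (u j x) powr (p - 2) \<le> \<omega>"
  shows "- (\<omega> / 2) * \<mu> + 2 * G \<omega> (norm (u j x)) + (real N - 2) * G \<omega> (norm (u 1 0))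
     - (1/q) * norm (u 1 0) powr q + (1/2) * (\<Sum>i=1..N. edge_defect \<omega> (u i)) \<le> energy p q N u"
  using star_energy[OF u N peak assms] star_flux_ge[OF star_H1 N j peak assms] by simp

text \<open>
  The frequency is the one whose radial profile has the same vertex value as u. In the case of
  equality Bernoulli's inequality identifies the frequency, strict monotonicity of G puts the maximum
  at the vertex, and all defects vanish.
\<close>

lemma energy_vertex_dominated:
  assumes dom: "(2 / p) * norm (u j x) powr (p - 2) \<le> (1 / (real N)\<^sup>2 + 2 / p) * norm (u 1 0) powr (p - 2)"
  shows "level \<mu> (radial_mass N) \<le> energy p q N u"
    and "energy p q N u = level \<mu> (radial_mass N) \<Longrightarrow> \<omega> = freq \<mu> (radial_mass N) \<Longrightarrow>
      norm (u 1 0) = sol \<omega> (shift N) 0 \<and> norm (u j x) = norm (u 1 0) \<and>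
      (\<forall>i\<in>{1..N}. edge_defect \<omega> (u i) = 0 \<and> edge_flux \<omega> (u i) = G \<omega> (norm (u 1 0)))"
proof -
  define r M w where "r = norm (u 1 0)" and "M = norm (u j x)" and "w = (1 / (real N)\<^sup>2 + 2 / p) * r powr (p - 2)"
  have M: "0 < M" unfolding M_def by (rule peak_pos)
  have th: "(2 / p) * M powr (p - 2) \<le> w" using dom by (simp add: M_def w_def r_def)
  have w: "0 < w" using th M p_gt by (smt (verit) divide_pos_pos mult_pos_pos powr_gt_zero)
  have r: "0 < r"
  proof (rule ccontr)
    assume "\<not> 0 < r"
    then have "r = 0" by (simp add: r_def)
    then show False using w by (simp add: w_def)
  qed
  have c: "1 / (real N)\<^sup>2 + 2 / p \<noteq> 0" using vertex_coeff_pos[OF N] by simp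
  have rsol: "r = sol w (shift N) 0"
    by (rule powr_inj[OF r sol_pos[OF w] c]) (simp only: sol_vertex_powr[OF w N] w_def[symmetric])
  have rM: "r \<le> M" unfolding r_def M_def by (rule peak_vertex)
  have GG: "G w r \<le> G w M" using G_mono[of r M w] r rM by simp
  define L where "L = - (w / 2) * \<mu> + \<beta> / 2 * radial_mass N * w powr (1 / \<beta>)"
  have Er: "L = - (w / 2) * \<mu> + real N * G w r - (1/q) * r powr q"
    using radial_action[OF w N] rsol by (simp add: L_def)
  note th' = less_imp_le[OF w] th[unfolded M_def]
  note defs = star_defect_nonneg[OF th']
  have ge: "- (w / 2) * \<mu> + 2 * G w M + (real N - 2) * G w r - (1/q) * r powr q
      + (1/2) * (\<Sum>i=1..N. edge_defect w (u i)) \<le> energy p q N u"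
    using star_energy_ge[OF th'] by (simp add: r_def M_def)
  have split: "2 * G w M + (real N - 2) * G w r = real N * G w r + 2 * (G w M - G w r)"
    by (simp add: algebra_simps)
  define d S where "d = G w M - G w r" and "S = (\<Sum>i=1..N. edge_defect w (u i))"
  have d: "0 \<le> d" using GG by (simp add: d_def)
  have S: "0 \<le> S" using defs(2) by (simp add: S_def)
  have "L + 2 * d + (1/2) * S = - (w / 2) * \<mu> + 2 * G w M + (real N - 2) * G w r - (1/q) * r powr q + (1/2) * S"
    using Er split by (simp add: d_def)
  with ge have E1: "L + 2 * d + (1/2) * S \<le> energy p q N u" by (simp only: S_def)
  note lev = level_le[OF mu radial_mass_pos[OF N] w, folded L_def]
  show "level \<mu> (radial_mass N) \<le> energy p q N u" using E1 lev(1) d S by linarith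
  assume eq: "energy p q N u = level \<mu> (radial_mass N)" and om: "\<omega> = freq \<mu> (radial_mass N)"
  have "level \<mu> (radial_mass N) = L"
    using E1 lev(1) d S eq by linarith
  note leveq = this
  then have wo: "w = \<omega>" unfolding om by (rule lev(2))
  have "d = 0" using E1 leveq d S eq by linarith
  then have "G w M = G w r" by (simp add: d_def)
  then have Mr: "M = r" using G_strict_mono[of r M w] r rM th by force
  have "(\<Sum>i=1..N. edge_defect w (u i)) = 0" using E1 leveq d S eq unfolding S_def[symmetric] by linarith
  then have d0: "\<forall>i\<in>{1..N}. edge_defect w (u i) = 0"
    using defs(1) by (subst (asm) sum_nonneg_eq_0_iff) auto
  have fl: "G w r \<le> edge_flux w (u i)" if "i \<in> {1..N}" for i
    using edge_flux_ge[OF star_pair[OF that] peak[OF that] th'] star_vertex[OF star_H1 that] by (simp add: r_def)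
  have "energy p q N u = (\<Sum>i=1..N. edge_flux w (u i)) - (w / 2) * \<mu> - (1/q) * r powr q"
    using star_energy[OF u N peak th'] d0 by (simp add: r_def)
  then have "(\<Sum>i=1..N. edge_flux w (u i)) = real N * G w r" using eq leveq Er by linarith
  then have "(\<Sum>i=1..N. edge_flux w (u i) - G w r) = 0" by (simp add: sum_subtractf)
  then have "\<forall>i\<in>{1..N}. edge_flux w (u i) - G w r = 0"
    using fl by (subst (asm) sum_nonneg_eq_0_iff) auto
  then show "norm (u 1 0) = sol \<omega> (shift N) 0 \<and> norm (u j x) = norm (u 1 0) \<and>
      (\<forall>i\<in>{1..N}. edge_defect \<omega> (u i) = 0 \<and> edge_flux \<omega> (u i) = G \<omega> (norm (u 1 0)))"
    using d0 rsol Mr unfolding wo by (simp add: r_def M_def)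
qed

text \<open>
  The frequency w is the one whose soliton has height M. Write h r = (N - 2) G r - r^q / q for the
  contribution of the vertex value r, and s for the vertex value of the radial profile of
  frequency w; here r < s < M. For N >= 2, homogeneity gives h r >= (r/s)^q h s, and for N = 1, h is
  decreasing. So if h s < 0, then h r >= h s, and the bound is above that of the radial profile, strictly
  because G s < G M. If h s >= 0, then N >= 3, h r >= 0, and the bound is that of the soliton. It is strict for r > 0, since raising
  the frequency slightly improves it, and for r = 0 too, since otherwise the half-line with the maximum
  would carry a nonzero solution of |u'| <= sqrt w |u| that starts at 0.
\<close>

lemma energy_peak_dominated:
  assumes dom: "(1 / (real N)\<^sup>2 + 2 / p) * norm (u 1 0) powr (p - 2) < (2 / p) * norm (u j x) powr (p - 2)"
  shows "min (level \<mu> (radial_mass N)) (level \<mu> (2 * \<kappa> 0)) < energy p q N u"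
proof -
  define r M w where "r = norm (u 1 0)" and "M = norm (u j x)" and "w = (2 / p) * M powr (p - 2)"
  have M: "0 < M" unfolding M_def by (rule peak_pos)
  have w: "0 < w" using M p_gt by (simp add: w_def)
  have r0: "0 \<le> r" by (simp add: r_def)
  have rM: "r \<le> M" unfolding r_def M_def by (rule peak_vertex)
  have Msol: "M = sol w 0 0"
    by (rule powr_inj[OF M sol_pos[OF w], of "2 / p"]) (use p_gt sol_0_threshold[OF w] in \<open>auto simp: w_def\<close>)
  define s where "s = sol w (shift N) 0"
  have s: "0 < s" unfolding s_def by (rule sol_pos[OF w])
  note cpos = vertex_coeff_pos[OF N]
  \<comment> \<open>This is the hypothesis, by the formula for the vertex value of the radial profile.\<close>
  have rs: "r < s"
  proof (rule ccontr)
    assume "\<not> r < s"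
    then have "s powr (p - 2) \<le> r powr (p - 2)" using s p_gt by (intro powr_mono2) auto
    then have "(1 / (real N)\<^sup>2 + 2 / p) * s powr (p - 2) \<le> (1 / (real N)\<^sup>2 + 2 / p) * r powr (p - 2)"
      using cpos by (intro mult_left_mono) auto
    then show False using dom sol_vertex_powr[OF w N] by (simp add: s_def r_def w_def M_def)
  qed
  have sM: "s < M"
  proof (rule ccontr)
    assume "\<not> s < M"
    then have "M powr (p - 2) \<le> s powr (p - 2)" using M p_gt by (intro powr_mono2) auto
    then have "w \<le> (2 / p) * s powr (p - 2)" unfolding w_def using p_gt by (intro mult_left_mono) auto
    also have "\<dots> < (1 / (real N)\<^sup>2 + 2 / p) * s powr (p - 2)"
      using N s by (intro mult_strict_right_mono) auto
    finally show False using sol_vertex_powr[OF w N] by (simp add: s_def)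
  qed
  have thM: "(2 / p) * M powr (p - 2) \<le> w" by (simp add: w_def)
  have ths: "(2 / p) * s powr (p - 2) \<le> w" by (rule powr_threshold_mono[OF _ _ thM]) (use s sM in auto)
  define h where "h \<omega> t = (real N - 2) * G \<omega> t - (1/q) * t powr q" for \<omega> t
  have ge: "- (\<omega> / 2) * \<mu> + 2 * G \<omega> M + h \<omega> r + (1/2) * (\<Sum>i=1..N. edge_defect \<omega> (u i)) \<le> energy p q N u"
    and dn: "0 \<le> (\<Sum>i=1..N. edge_defect \<omega> (u i))"
    if "0 \<le> \<omega>" "(2 / p) * M powr (p - 2) \<le> \<omega>" for \<omega>
    using star_energy_ge[of \<omega>] star_defect_nonneg(2)[of \<omega>] that by (auto simp: r_def M_def h_def)
  have k0: "0 < 2 * \<kappa> 0" by (simp add: \<kappa>_pos)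
  have solit: "level \<mu> (2 * \<kappa> 0) \<le> - (\<omega> / 2) * \<mu> + 2 * G \<omega> (sol \<omega> 0 0)" if "0 < \<omega>" for \<omega>
    using level_le(1)[OF mu k0 that] soliton_action[OF that] by simp
  have hs: "real N * G w s - (1/q) * s powr q = h w s + 2 * G w s"
    by (simp add: h_def algebra_simps)
  have scale: "(r / s) powr q * h w s \<le> h w r" if N2: "2 \<le> N"
  proof -
    define c where "c = r / s"
    have c: "0 \<le> c" "c \<le> 1" "c * s = r" using r0 s rs by (auto simp: c_def)
    have "(real N - 2) * (c powr q * G w s) \<le> (real N - 2) * G w r"
      using G_scaling_le[OF less_imp_le[OF s] c(1,2) ths] c(3) N2 by (intro mult_left_mono) auto
    moreover have "r powr q = c powr q * s powr q" using c s by (simp add: powr_mult flip: c(3))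
    ultimately show ?thesis unfolding c_def[symmetric] by (simp add: h_def algebra_simps)
  qed
  show ?thesis
  proof (cases "h w s < 0")
    case True
    have "h w s \<le> h w r"
    proof (cases "2 \<le> N")
      case True': True
      have "(r / s) powr q \<le> 1" using s r0 rs q_pos powr_mono2[of q "r / s" 1] by simp
      then have "1 * h w s \<le> (r / s) powr q * h w s" using True by (intro mult_right_mono_neg) auto
      with scale[OF True'] show ?thesis by simp
    next
      case False
      then have N1: "N = 1" using N by simp
      have "G w r \<le> G w s" "r powr q \<le> s powr q"
        using r0 rs q_pos by (auto intro!: G_mono powr_mono2)
      moreover from this(2) have "(1/q) * r powr q \<le> (1/q) * s powr q"
        using q_pos by (intro mult_left_mono) auto
      ultimately show ?thesis by (simp add: h_def N1)
    qed
    moreover have "G w s < G w M" using G_strict_mono[OF less_imp_le[OF s] sM thM] .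
    moreover have "- (w / 2) * \<mu> + 2 * G w M + h w r \<le> energy p q N u"
      using ge[OF less_imp_le[OF w] thM] dn[OF less_imp_le[OF w] thM] by linarith
    moreover have "level \<mu> (radial_mass N) \<le> - (w / 2) * \<mu> + (real N * G w s - (1/q) * s powr q)"
      using level_le(1)[OF mu radial_mass_pos[OF N] w] unfolding s_def radial_action[OF w N] .
    ultimately have "level \<mu> (radial_mass N) < energy p q N u" using hs by linarith
    then show ?thesis by simp
  next
    case False
    have N3: "3 \<le> N"
    proof (rule ccontr)
      assume "\<not> 3 \<le> N"
      then have "(real N - 2) * G w s \<le> 0" using G_nonneg[of s w] s by (intro mult_nonpos_nonneg) auto
      moreover have "0 < (1/q) * s powr q" using s q_pos by simp
      ultimately show False using False by (simp add: h_def)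
    qed
    have "0 \<le> (r / s) powr q * h w s" using False by simp
    then have hr: "0 \<le> h w r" using scale N3 by simp
    have "level \<mu> (2 * \<kappa> 0) < energy p q N u"
    proof (cases "r = 0")
      case True
      have h0: "h w r = 0" using True by (simp add: h_def G_0)
      have ge': "level \<mu> (2 * \<kappa> 0) + (1/2) * (\<Sum>i=1..N. edge_defect w (u i)) \<le> energy p q N u"
        using ge[OF less_imp_le[OF w] thM] solit[OF w] h0 Msol by simp
      show ?thesis
      proof (rule ccontr)
        assume "\<not> ?thesis"
        then have "(\<Sum>i=1..N. edge_defect w (u i)) = 0"
          using ge' dn[OF less_imp_le[OF w] thM] by linarith
        then have "\<forall>i\<in>{1..N}. edge_defect w (u i) = 0"
          using star_defect_nonneg(1)[OF less_imp_le[OF w] thM[unfolded M_def]] by (subst (asm) sum_nonneg_eq_0_iff) auto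
        then have dj: "edge_defect w (u j) = 0" using j by simp
        have "AE t in lborel. 0 < t \<longrightarrow> norm (weak_deriv (u j) t) = g w (norm (u j t))"
          by (rule edge_defect_zero[OF star_pair[OF j(1)] peak[OF j(1)] less_imp_le[OF w] thM[unfolded M_def] dj])
        then have "AE t in lborel. 0 < t \<longrightarrow> norm (weak_deriv (u j) t) \<le> sqrt w * norm (u j t)"
        proof eventually_elim
          case (elim t)
          show ?case
          proof
            assume "0 < t"
            with elim have "norm (weak_deriv (u j) t) = g w (norm (u j t))" by blast
            also have "\<dots> \<le> sqrt w * norm (u j t)" using w by (intro g_le) auto
            finally show "norm (weak_deriv (u j) t) \<le> sqrt w * norm (u j t)" .
          qed
        qed
        moreover have "norm (u j 0) = 0" unfolding star_vertex[OF star_H1 j(1)] using True by (simp only: r_def)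
        then have "u j 0 = 0" by (simp only: norm_eq_zero)
        moreover have "0 \<le> sqrt w" using w by simp
        ultimately have "u j x = 0"
          using j(2) zero_of_sublinear_derivative[OF star_pair[OF j(1)]] by blast
        then show False using M by (simp add: M_def)
      qed
    next
      case False
      then have r: "0 < r" using r0 by simp
      \<comment> \<open>The soliton of the raised frequency has height m.\<close>
      obtain m where m: "M < m" "2 * (G (2 / p * m powr (p - 2)) m - G (2 / p * m powr (p - 2)) M)
          < (real N - 2) * (G (2 / p * m powr (p - 2)) r - G (2 / p * M powr (p - 2)) r)"
        using frequency_gain_beats_loss[OF N3 r rM] by blast
      define w' where "w' = 2 / p * m powr (p - 2)"
      have w': "0 < w'" using m M p_gt by (simp add: w'_def)
      have thM': "(2 / p) * M powr (p - 2) \<le> w'"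
        unfolding w'_def using m M p_gt by (intro mult_left_mono powr_mono2) auto
      have msol: "m = sol w' 0 0"
        by (rule powr_inj[OF _ sol_pos[OF w'], of _ "2 / p"]) (use m M p_gt sol_0_threshold[OF w'] in \<open>auto simp: w'_def\<close>)
      have hh: "h w' r - h w r = (real N - 2) * (G w' r - G w r)" by (simp add: h_def algebra_simps)
      have "2 * (G w' m - G w' M) < (real N - 2) * (G w' r - G w r)"
        using m(2) by (simp add: w'_def w_def)
      moreover have "level \<mu> (2 * \<kappa> 0) \<le> - (w' / 2) * \<mu> + 2 * G w' m"
        using solit[OF w'] msol by simp
      ultimately have "level \<mu> (2 * \<kappa> 0) < - (w' / 2) * \<mu> + 2 * G w' M + h w' r"
        using hh hr by (simp add: right_diff_distrib)
      then show ?thesis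
        using ge[OF less_imp_le[OF w'] thM'] dn[OF less_imp_le[OF w'] thM'] by linarith
    qed
    then show ?thesis by simp
  qed
qed

end

end

section \<open>Ground states\<close>

lemma ground_state_iff:
  "ground_state p q N \<mu> u \<longleftrightarrow>
     u \<in> H1_star_mass N \<mu> \<and> (\<forall>v\<in>H1_star_mass N \<mu>. energy p q N u \<le> energy p q N v)"
proof
  assume "ground_state p q N \<mu> u"
  then show "u \<in> H1_star_mass N \<mu> \<and> (\<forall>v\<in>H1_star_mass N \<mu>. energy p q N u \<le> energy p q N v)"
    unfolding ground_state_def by (metis INF_lower ereal_less_eq(3))
next
  assume R: "u \<in> H1_star_mass N \<mu> \<and> (\<forall>v\<in>H1_star_mass N \<mu>. energy p q N u \<le> energy p q N v)"
  then show "ground_state p q N \<mu> u"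
    unfolding ground_state_def by (auto intro!: antisym INF_greatest intro: INF_lower)
qed

context subcritical
begin

text \<open>
  Both the radial profile and the escaping soliton are of this form.
\<close>

definition sol_star :: "real \<Rightarrow> (nat \<Rightarrow> real) \<Rightarrow> star_fun" where
  "sol_star \<omega> a i x = of_real (sol \<omega> (a i) x)"

lemma sol_star_properties:
  assumes om: "0 < \<omega>" and N: "1 \<le> N" and a: "\<And>i. i \<in> {1..N} \<Longrightarrow> Q (a i) = Q (a 1)"
  shows "sol_star \<omega> a \<in> H1_star_mass N (\<omega> powr \<gamma> * (\<Sum>i=1..N. \<kappa> (a i)))"
    and "energy p q N (sol_star \<omega> a) =
      (1/q) * (sqrt \<omega> * (\<Sum>i=1..N. tanh (\<alpha> * a i)) * (sol \<omega> (a 1) 0)\<^sup>2 - sol \<omega> (a 1) 0 powr q)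
      - (1 - \<beta>) / 2 * \<omega> * (\<omega> powr \<gamma> * (\<Sum>i=1..N. \<kappa> (a i)))"
proof -
  have v: "sol \<omega> (a i) 0 = sol \<omega> (a 1) 0" if "i \<in> {1..N}" for i
    using a[OF that] by (simp add: sol_def)
  have fn: "sol_star \<omega> a i = (\<lambda>x. of_real (sol \<omega> (a i) x))" for i by (rule ext) (simp add: sol_star_def)
  have "continuous_on_star N (sol_star \<omega> a)"
    unfolding continuous_on_star_def
  proof (intro conjI ballI)
    show "continuous_on {0..} (sol_star \<omega> a i)" for i
      unfolding fn by (intro continuous_intros continuous_on_sol[OF om])
    show "sol_star \<omega> a i 0 = sol_star \<omega> a j 0" if "i \<in> {1..N}" "j \<in> {1..N}" for i j
      using v[OF that(1)] v[OF that(2)] by (simp only: sol_star_def)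
  qed
  then have H: "sol_star \<omega> a \<in> H1_star N"
    unfolding H1_star_def fn using sol_H1[OF om] by simp
  have m: "star_mass N (sol_star \<omega> a) = \<omega> powr \<gamma> * (\<Sum>i=1..N. \<kappa> (a i))"
    unfolding star_mass_def fn by (simp add: sol_mass[OF om] sum_distrib_left)
  show "sol_star \<omega> a \<in> H1_star_mass N (\<omega> powr \<gamma> * (\<Sum>i=1..N. \<kappa> (a i)))"
    using H m by (simp add: H1_star_mass_def)
  have abs: "\<bar>sol \<omega> b x\<bar> = sol \<omega> b x" for b x using sol_pos[OF om, of b x] by simp
  have "(1/2) * (\<Sum>i=1..N. LBINT x:{0<..}. (norm (weak_deriv (sol_star \<omega> a i) x))\<^sup>2)
     - (1/p) * (\<Sum>i=1..N. LBINT x:{0<..}. norm (sol_star \<omega> a i x) powr p)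
    = (\<Sum>i=1..N. (1/2) * (LBINT x:{0<..}. (sol' \<omega> (a i) x)\<^sup>2) - (1/p) * (LBINT x:{0<..}. sol \<omega> (a i) x powr p))"
    unfolding fn sol_weak_deriv[OF om] norm_of_real abs by (simp only: sum_distrib_left sum_subtractf)
  also have "\<dots> = (\<Sum>i=1..N. sqrt \<omega> * tanh (\<alpha> * a i) * (sol \<omega> (a 1) 0)\<^sup>2 / q - (1 - \<beta>) / 2 * \<omega> * (\<omega> powr \<gamma> * \<kappa> (a i)))"
    by (intro sum.cong refl) (simp only: sol_energy[OF om] v)
  also have "\<dots> = sqrt \<omega> * (\<Sum>i=1..N. tanh (\<alpha> * a i)) * (sol \<omega> (a 1) 0)\<^sup>2 / q - (1 - \<beta>) / 2 * \<omega> * (\<omega> powr \<gamma> * (\<Sum>i=1..N. \<kappa> (a i)))"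
    by (simp only: sum_subtractf sum_distrib_left sum_distrib_right sum_divide_distrib)
  finally show "energy p q N (sol_star \<omega> a) =
      (1/q) * (sqrt \<omega> * (\<Sum>i=1..N. tanh (\<alpha> * a i)) * (sol \<omega> (a 1) 0)\<^sup>2 - sol \<omega> (a 1) 0 powr q)
      - (1 - \<beta>) / 2 * \<omega> * (\<omega> powr \<gamma> * (\<Sum>i=1..N. \<kappa> (a i)))"
    unfolding energy_def by (simp add: fn abs diff_divide_distrib)
qed

definition radial :: "nat \<Rightarrow> real \<Rightarrow> star_fun" where
  "radial N \<mu> = sol_star (freq \<mu> (radial_mass N)) (\<lambda>_. shift N)"

lemma radial_energy:
  assumes mu: "0 < \<mu>" and N: "1 \<le> N"
  shows "radial N \<mu> \<in> H1_star_mass N \<mu>" "energy p q N (radial N \<mu>) = level \<mu> (radial_mass N)"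
proof -
  have w: "0 < freq \<mu> (radial_mass N)" by (rule freq_pos[OF mu radial_mass_pos[OF N]])
  have K: "(\<Sum>i=1..N. \<kappa> (shift N)) = radial_mass N" by (simp add: radial_mass_def)
  note m = freq_mass[OF mu radial_mass_pos[OF N]]
  note S = sol_star_properties[OF w N, of "\<lambda>_. shift N", OF refl, folded radial_def, unfolded K m]
  show "radial N \<mu> \<in> H1_star_mass N \<mu>" by (rule S(1))
  have "sqrt (freq \<mu> (radial_mass N)) * (\<Sum>i=1..N. tanh (\<alpha> * shift N)) * (sol (freq \<mu> (radial_mass N)) (shift N) 0)\<^sup>2
     = sol (freq \<mu> (radial_mass N)) (shift N) 0 powr q"
    unfolding sol_vertex_Kirchhoff[OF w N, symmetric] by simp
  then show "energy p q N (radial N \<mu>) = level \<mu> (radial_mass N)"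
    unfolding S(2) level_def by simp
qed

text \<open>
  On the first half-line the soliton is centred at distance b in the rescaled variable, and the other
  half-lines carry its tail; the frequency is adjusted to keep the mass. The vertex value and the mass of
  the tails tend to 0 as b tends to infinity.
\<close>

lemma escaping_soliton:
  assumes mu: "0 < \<mu>" and N: "2 \<le> N" and e: "level \<mu> (2 * \<kappa> 0) < e"
  shows "\<exists>v\<in>H1_star_mass N \<mu>. energy p q N v < e"
proof -
  define k where "k b = 2 * \<kappa> 0 + (real N - 2) * \<kappa> b" for b
  define s :: "real \<Rightarrow> nat \<Rightarrow> real" where "s b i = (if i = 1 then - b else b)" for b i
  define w where "w b = freq \<mu> (k b)" for b
  define B where "B b = (1/q) * (sqrt (w b) * (real N - 2) * (sol (w b) b 0)\<^sup>2) + level \<mu> (k b)" for b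
  have k0: "0 < 2 * \<kappa> 0" by (simp add: \<kappa>_pos)
  have kpos: "0 < k b" for b
    unfolding k_def using N \<kappa>_pos[of b] k0 by (intro add_pos_nonneg) auto
  have klim: "(k \<longlongrightarrow> 2 * \<kappa> 0 + (real N - 2) * 0) at_top"
    unfolding k_def[abs_def] by (intro tendsto_intros \<kappa>_tendsto_0)
  then have klim: "(k \<longlongrightarrow> 2 * \<kappa> 0) at_top" by simp
  have wlim: "(w \<longlongrightarrow> freq \<mu> (2 * \<kappa> 0)) at_top"
    unfolding w_def[abs_def] freq_def using k0 mu
    by (intro tendsto_intros klim) auto
  have w0: "0 < freq \<mu> (2 * \<kappa> 0)" by (rule freq_pos[OF mu k0])
  have "((\<lambda>b. (1/q) * (sqrt (w b) * (real N - 2) * (w b powr (1 / (2 * \<alpha>)) * Q b)\<^sup>2) + (- ((1 - \<beta>) / 2 * w b * \<mu>)))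
     \<longlongrightarrow> (1/q) * (sqrt (freq \<mu> (2 * \<kappa> 0)) * (real N - 2) * (freq \<mu> (2 * \<kappa> 0) powr (1 / (2 * \<alpha>)) * 0)\<^sup>2) + (- ((1 - \<beta>) / 2 * freq \<mu> (2 * \<kappa> 0) * \<mu>))) at_top"
    using w0 by (intro tendsto_intros wlim Q_tendsto_0) auto
  then have "(B \<longlongrightarrow> level \<mu> (2 * \<kappa> 0)) at_top"
    unfolding B_def[abs_def] level_def w_def[symmetric] by (simp add: sol_def)
  from order_tendstoD(2)[OF this e] have "\<forall>\<^sub>F b in at_top. 0 \<le> b \<and> B b < e"
    using eventually_ge_at_top[of 0] by eventually_elim simp
  then obtain b where b: "0 \<le> b" "B b < e"
    using eventually_happens[of _ "at_top"] trivial_limit_at_top_linorder by blast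
  have w: "0 < w b" unfolding w_def by (rule freq_pos[OF mu kpos])
  have N1: "1 \<le> N" using N by simp
  have Qs: "Q (s b i) = Q (s b 1)" for i by (simp add: s_def Q_even)
  have split: "(\<Sum>i=1..N. f (s b i)) = f (- b) + (real N - 1) * f b" for f :: "real \<Rightarrow> real"
  proof -
    have "(\<Sum>i=1..N. f (s b i)) = f (s b 1) + (\<Sum>i\<in>{1..N} - {1}. f (s b i))"
      using N1 by (subst sum.remove[of "{1..N}" 1]) auto
    also have "(\<Sum>i\<in>{1..N} - {1}. f (s b i)) = (\<Sum>i\<in>{1..N} - {1}. f b)"
      by (intro sum.cong) (auto simp: s_def)
    also have "\<dots> = (real N - 1) * f b" using N1 by (simp add: of_nat_diff)
    finally show ?thesis by (simp add: s_def)
  qed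
  have Ks: "(\<Sum>i=1..N. \<kappa> (s b i)) = k b"
    unfolding split \<kappa>_reflect[OF b(1)] k_def by (simp add: algebra_simps)
  have Ts: "(\<Sum>i=1..N. tanh (\<alpha> * s b i)) = (real N - 2) * tanh (\<alpha> * b)"
    unfolding split[of "\<lambda>y. tanh (\<alpha> * y)"] by (simp add: algebra_simps)
  have sol1: "sol (w b) (s b 1) 0 = sol (w b) b 0" by (simp add: sol_def s_def Q_even)
  have m: "w b powr \<gamma> * k b = \<mu>" unfolding w_def by (rule freq_mass[OF mu kpos])
  note S = sol_star_properties[OF w N1, of "s b", OF Qs, unfolded Ks Ts sol1 m]
  have "energy p q N (sol_star (w b) (s b)) \<le> B b"
  proof -
    have "sqrt (w b) * ((real N - 2) * tanh (\<alpha> * b)) * (sol (w b) b 0)\<^sup>2 - sol (w b) b 0 powr q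
       \<le> sqrt (w b) * (real N - 2) * (sol (w b) b 0)\<^sup>2"
    proof -
      have "(real N - 2) * tanh (\<alpha> * b) \<le> (real N - 2) * 1"
        using N tanh_real_lt_1[of "\<alpha> * b"] by (intro mult_left_mono) auto
      then have "sqrt (w b) * ((real N - 2) * tanh (\<alpha> * b)) * (sol (w b) b 0)\<^sup>2 \<le> sqrt (w b) * ((real N - 2) * 1) * (sol (w b) b 0)\<^sup>2"
        by (rule mult_right_mono[OF mult_left_mono]) (use w in auto)
      moreover have "0 \<le> sol (w b) b 0 powr q" by simp
      ultimately show ?thesis unfolding mult_1_right by linarith
    qed
    then have "(1/q) * (sqrt (w b) * ((real N - 2) * tanh (\<alpha> * b)) * (sol (w b) b 0)\<^sup>2 - sol (w b) b 0 powr q)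
       \<le> (1/q) * (sqrt (w b) * (real N - 2) * (sol (w b) b 0)\<^sup>2)"
      using q_pos by (intro mult_left_mono) auto
    then show ?thesis unfolding S(2) B_def level_def w_def[symmetric] by linarith
  qed
  then show ?thesis using S(1) b(2) by (intro bexI[of _ "sol_star (w b) (s b)"]) auto
qed

text \<open>
  In terms of \<theta> = sqrt (\<omega> - (2 / p) * r powr (p - 2)) the equation becomes the Riccati equation
  \<theta>' = \<alpha> (\<omega> - \<theta>^2), and the square of the difference of two nonnegative solutions is
  nonincreasing.
\<close>

lemma slope_ode_unique:
  assumes om: "0 < \<omega>" and a: "0 < a" and t: "0 \<le> t"
    and rpos: "\<And>x. 0 \<le> x \<Longrightarrow> 0 < r x" and r0: "r 0 = sol \<omega> a 0"
    and thr: "\<And>x. 0 \<le> x \<Longrightarrow> (2 / p) * r x powr (p - 2) < \<omega>"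
    and Dr: "\<And>x. 0 \<le> x \<Longrightarrow> (r has_real_derivative - g \<omega> (r x)) (at x within {0..})"
  shows "r t = sol \<omega> a t"
proof -
  define \<theta> \<eta> where "\<theta> x = sqrt (\<omega> - (2 / p) * r x powr (p - 2))" and "\<eta> x = sqrt \<omega> * tanh (\<alpha> * (sqrt \<omega> * x + a))" for x
  have th_sq: "(\<theta> x)\<^sup>2 = \<omega> - (2 / p) * r x powr (p - 2)" if "0 \<le> x" for x
    using thr[OF that] by (simp add: \<theta>_def)
  have th_pos: "0 < \<theta> x" if "0 \<le> x" for x using thr[OF that] by (simp add: \<theta>_def)
  have g_th: "g \<omega> (r x) = r x * \<theta> x" if "0 \<le> x" for x
  proof -
    have "(g \<omega> (r x))\<^sup>2 = (r x * \<theta> x)\<^sup>2"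
      using g_sq[of "r x" \<omega>] rpos[OF that] thr[OF that]
      by (simp add: power_mult_distrib th_sq[OF that] powr_p_split algebra_simps)
    then show ?thesis using g_nonneg[of \<omega> "r x"] rpos[OF that] th_pos[OF that]
      by (simp add: power2_eq_iff_nonneg)
  qed
  have D\<theta>: "(\<theta> has_real_derivative \<alpha> * (\<omega> - (\<theta> x)\<^sup>2)) (at x within {0..})" if x: "0 \<le> x" for x
  proof -
    have 1: "((\<lambda>s. s powr (p - 2)) has_real_derivative (p - 2) * r x powr (p - 2 - 1)) (at (r x))"
      by (rule has_real_derivative_powr[OF rpos[OF x]])
    have 2: "((\<lambda>x. r x powr (p - 2)) has_real_derivative (p - 2) * r x powr (p - 2 - 1) * (- g \<omega> (r x))) (at x within {0..})"
      by (rule DERIV_chain2[OF 1 Dr[OF x]])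
    have 3: "((\<lambda>x. \<omega> - (2 / p) * r x powr (p - 2)) has_real_derivative 0 - (2 / p) * ((p - 2) * r x powr (p - 2 - 1) * (- g \<omega> (r x)))) (at x within {0..})"
      by (intro DERIV_diff DERIV_const DERIV_cmult 2)
    have "0 < \<omega> - (2 / p) * r x powr (p - 2)" using thr[OF x] by simp
    from DERIV_chain2[OF DERIV_real_sqrt[OF this] 3]
    have "(\<theta> has_real_derivative inverse (\<theta> x) / 2 * (0 - (2 / p) * ((p - 2) * r x powr (p - 2 - 1) * (- g \<omega> (r x))))) (at x within {0..})"
      unfolding \<theta>_def .
    moreover have "inverse (\<theta> x) / 2 * (0 - (2 / p) * ((p - 2) * r x powr (p - 2 - 1) * (- g \<omega> (r x)))) = \<alpha> * (\<omega> - (\<theta> x)\<^sup>2)"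
    proof -
      have e: "r x powr (p - 2 - 1) * r x = r x powr (p - 2)"
        using powr_add[of "r x" "p - 2 - 1" 1] rpos[OF x] by simp
      have "inverse (\<theta> x) / 2 * (0 - (2 / p) * ((p - 2) * r x powr (p - 2 - 1) * (- g \<omega> (r x))))
         = (inverse (\<theta> x) * \<theta> x) * ((p - 2) / 2) * ((2 / p) * (r x powr (p - 2 - 1) * r x))"
        unfolding g_th[OF x] by (simp add: mult_ac)
      also have "\<dots> = (p - 2) / 2 * ((2 / p) * r x powr (p - 2))"
        unfolding e using th_pos[OF x] by simp
      also have "\<dots> = \<alpha> * (\<omega> - (\<theta> x)\<^sup>2)" unfolding th_sq[OF x] \<alpha>_def by simp
      finally show ?thesis .
    qed
    ultimately show ?thesis by simp
  qed
  have s2: "sqrt \<omega> * sqrt \<omega> = \<omega>" using om by simp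
  have D\<eta>: "(\<eta> has_real_derivative \<alpha> * (\<omega> - (\<eta> x)\<^sup>2)) (at x within {0..})" for x
  proof -
    have "((\<lambda>x. tanh (\<alpha> * (sqrt \<omega> * x + a))) has_real_derivative (1 - (tanh (\<alpha> * (sqrt \<omega> * x + a)))\<^sup>2) * (\<alpha> * sqrt \<omega>)) (at x)"
      by (rule derivative_eq_intros refl | simp)+
    from DERIV_cmult[OF this, of "sqrt \<omega>"]
    have "(\<eta> has_real_derivative sqrt \<omega> * ((1 - (tanh (\<alpha> * (sqrt \<omega> * x + a)))\<^sup>2) * (\<alpha> * sqrt \<omega>))) (at x)"
      unfolding \<eta>_def[abs_def] .
    moreover have "sqrt \<omega> * ((1 - (tanh (\<alpha> * (sqrt \<omega> * x + a)))\<^sup>2) * (\<alpha> * sqrt \<omega>)) = \<alpha> * ((sqrt \<omega> * sqrt \<omega>) - (\<eta> x)\<^sup>2)"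
      by (simp only: \<eta>_def power2_eq_square) (simp only: algebra_simps)
    ultimately show ?thesis unfolding s2 by (metis has_field_derivative_at_within)
  qed
  have eta_pos: "0 \<le> \<eta> x" if "0 \<le> x" for x
    using that om a alpha_pos by (simp add: \<eta>_def)
  have init: "\<theta> 0 = \<eta> 0"
  proof -
    have "(\<theta> 0)\<^sup>2 = \<omega> - (2 / p) * (\<omega> * (p / 2) * (1 - (tanh (\<alpha> * a))\<^sup>2))"
      unfolding th_sq[OF order_refl] r0 sol_powr[OF om] by simp
    also have "\<dots> = (\<eta> 0)\<^sup>2"
      using p_gt om by (simp add: \<eta>_def power_mult_distrib algebra_simps)
    finally show ?thesis using th_pos[of 0] eta_pos[of 0] by (simp add: power2_eq_iff_nonneg)
  qed
  have "- ((\<theta> 0 - \<eta> 0)\<^sup>2) \<le> - ((\<theta> t - \<eta> t)\<^sup>2)"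
  proof (rule nonneg_derivative_imp_le[where F = "\<lambda>x. - ((\<theta> x - \<eta> x)\<^sup>2)" and f = "\<lambda>x. 2 * \<alpha> * (\<theta> x + \<eta> x) * (\<theta> x - \<eta> x)\<^sup>2"])
    fix x :: real assume x: "0 \<le> x"
    have d: "((\<lambda>x. \<theta> x - \<eta> x) has_real_derivative \<alpha> * (\<omega> - (\<theta> x)\<^sup>2) - \<alpha> * (\<omega> - (\<eta> x)\<^sup>2)) (at x within {0..})"
      by (intro DERIV_diff D\<theta> D\<eta> x)
    have "((\<lambda>x. - ((\<theta> x - \<eta> x) * (\<theta> x - \<eta> x))) has_real_derivative
       - ((\<alpha> * (\<omega> - (\<theta> x)\<^sup>2) - \<alpha> * (\<omega> - (\<eta> x)\<^sup>2)) * (\<theta> x - \<eta> x) + (\<alpha> * (\<omega> - (\<theta> x)\<^sup>2) - \<alpha> * (\<omega> - (\<eta> x)\<^sup>2)) * (\<theta> x - \<eta> x))) (at x within {0..})"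
      by (intro DERIV_minus DERIV_mult d)
    then show "((\<lambda>x. - ((\<theta> x - \<eta> x)\<^sup>2)) has_real_derivative 2 * \<alpha> * (\<theta> x + \<eta> x) * (\<theta> x - \<eta> x)\<^sup>2) (at x within {0..})"
      by (simp add: power2_eq_square algebra_simps)
  next
    fix x assume "0 \<le> x" "x \<le> t"
    then show "0 \<le> 2 * \<alpha> * (\<theta> x + \<eta> x) * (\<theta> x - \<eta> x)\<^sup>2"
      using th_pos[of x] eta_pos[of x] alpha_pos by (intro mult_nonneg_nonneg) auto
  qed (use t in auto)
  then have "(\<theta> t - \<eta> t)\<^sup>2 \<le> 0" using init by simp
  then have th_eq: "\<theta> t = \<eta> t" by simp
  have "(2 / p) * r t powr (p - 2) = \<omega> - (\<eta> t)\<^sup>2" using th_sq[OF t] th_eq by simp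
  also have "\<dots> = (2 / p) * sol \<omega> a t powr (p - 2)"
    unfolding sol_powr[OF om] using p_gt om by (simp add: \<eta>_def power_mult_distrib algebra_simps)
  finally show "r t = sol \<omega> a t"
    by (intro powr_inj[OF rpos[OF t] sol_pos[OF om], of "2 / p"]) (use p_gt in auto)
qed

text \<open>
  Vanishing defect means |f'| = g(f) almost everywhere. The flux equals G at the initial height, so by
  the chain rule the integral of g(f) (|f'| + Re f') vanishes: Re f' = - g(f) almost everywhere. As g(f)
  is continuous, f is differentiable and solves the soliton equation of first order.
\<close>

lemma edge_profile_unique:
  assumes f: "H1_pair f (weak_deriv f)" and om: "0 < \<omega>" and a: "0 < a"
    and pos: "\<And>t. 0 \<le> t \<Longrightarrow> f t \<in> \<real> \<and> 0 < Re (f t)"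
    and le: "\<And>t. 0 \<le> t \<Longrightarrow> norm (f t) \<le> sol \<omega> a 0" and f0: "norm (f 0) = sol \<omega> a 0"
    and def0: "edge_defect \<omega> f = 0" and flux: "edge_flux \<omega> f = G \<omega> (norm (f 0))"
    and t: "0 \<le> t"
  shows "f t = of_real (sol \<omega> a t)"
proof -
  let ?h = "weak_deriv f"
  define A where "A = sol \<omega> a 0"
  define r where "r t = Re (f t)" for t
  have rn: "norm (f t) = r t" if "0 \<le> t" for t
    using pos[OF that] by (auto simp: r_def elim!: Reals_cases)
  have rpos: "0 < r t" and rA: "r t \<le> A" if "0 \<le> t" for t
    using pos[OF that] le[OF that] rn[OF that] by (auto simp: r_def A_def)
  have r0: "r 0 = A" using f0 rn[of 0] by (simp add: A_def)
  have tanh_a: "0 < tanh (\<alpha> * a)" using a alpha_pos by simp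
  have thA: "(2 / p) * A powr (p - 2) < \<omega>"
  proof -
    have "(2 / p) * A powr (p - 2) = \<omega> * (1 - (tanh (\<alpha> * a))\<^sup>2)"
      unfolding A_def sol_powr[OF om] using p_gt by simp
    also have "\<dots> < \<omega> * 1" using om tanh_a by (intro mult_strict_left_mono) auto
    finally show ?thesis by simp
  qed
  have thr: "(2 / p) * r t powr (p - 2) < \<omega>" if "0 \<le> t" for t
  proof -
    have "r t powr (p - 2) \<le> A powr (p - 2)" using rpos[OF that] rA[OF that] p_gt by (intro powr_mono2) auto
    then have "(2 / p) * r t powr (p - 2) \<le> (2 / p) * A powr (p - 2)" using p_gt by (intro mult_left_mono) auto
    then show ?thesis using thA by linarith
  qed
  have gpos: "0 < g \<omega> (r t)" if "0 \<le> t" for t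
    by (rule g_pos[OF rpos[OF that] thr[OF that]])
  note om' = less_imp_le[OF om]
  note thA' = less_imp_le[OF thA[unfolded A_def]]
  have cr: "continuous_on {0..} r"
    unfolding r_def[abs_def] by (intro continuous_intros H1_pair_continuous[OF f])
  have cgr: "continuous_on {0..} (\<lambda>t. g \<omega> (r t))"
    by (rule continuous_on_compose2[OF continuous_on_g cr]) (use rpos in \<open>auto intro: less_imp_le\<close>)
  have hi: "set_integrable lborel {x<..y} (\<lambda>t. Re (?h t))"
    and rinc: "r y - r x = (LBINT t:{x<..y}. Re (?h t))" if "0 \<le> x" "x \<le> y" for x y
  proof -
    have i: "integrable lborel (\<lambda>t. indicator {x<..y} t *\<^sub>R ?h t)"
      using ac_primitiveD(1)[OF H1_pair_primitive[OF f] that] by (simp add: set_integrable_def)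
    show "set_integrable lborel {x<..y} (\<lambda>t. Re (?h t))"
      using integrable_Re[OF i] by (simp add: set_integrable_def)
    have "r y - r x = Re (f y - f x)" by (simp add: r_def)
    also have "f y - f x = (LBINT t. indicator {x<..y} t *\<^sub>R ?h t)"
      using ac_primitiveD(2)[OF H1_pair_primitive[OF f] that] by (simp add: set_lebesgue_integral_def)
    also have "Re \<dots> = (LBINT t. Re (indicator {x<..y} t *\<^sub>R ?h t))" by (rule integral_Re[OF i, symmetric])
    finally show "r y - r x = (LBINT t:{x<..y}. Re (?h t))" by (simp add: set_lebesgue_integral_def)
  qed
  define W where "W t = g \<omega> (r t) * Re (?h t)" for t
  define V where "V t = g \<omega> (norm (f t)) * norm (?h t)" for t
  have Vi: "set_integrable lborel {0<..} V"
    unfolding V_def by (rule edge_integrable(2)[OF f le om' thA'])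
  have Wi: "set_integrable lborel {0<..} W"
    unfolding set_integrable_def
  proof (rule Bochner_Integration.integrable_bound)
    show "integrable lborel (\<lambda>t. indicator {0<..} t *\<^sub>R V t)" using Vi by (simp add: set_integrable_def)
    have 1: "(\<lambda>t. indicator {0<..} t *\<^sub>R g \<omega> (r t)) \<in> borel_measurable borel"
      by (intro borel_measurable_continuous_on_indicator continuous_on_subset[OF cgr]) auto
    have "(\<lambda>t. indicator {0<..} t *\<^sub>R ?h t) \<in> borel_measurable borel"
      using f by (simp add: H1_pair_def L2_halfline_def set_borel_measurable_def)
    then have 2: "(\<lambda>t. Re (indicator {0<..} t *\<^sub>R ?h t)) \<in> borel_measurable borel"
      by (rule measurable_compose) simp
    have "(\<lambda>t. indicator {0<..} t *\<^sub>R W t) = (\<lambda>t. (indicator {0<..} t *\<^sub>R g \<omega> (r t)) * Re (indicator {0<..} t *\<^sub>R ?h t))"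
      by (auto simp: W_def indicator_def fun_eq_iff)
    then show "(\<lambda>t. indicator {0<..} t *\<^sub>R W t) \<in> borel_measurable lborel"
      using borel_measurable_times[OF 1 2] by simp
    show "AE t in lborel. norm (indicator {0<..} t *\<^sub>R W t) \<le> norm (indicator {0<..} t *\<^sub>R V t)"
    proof (intro AE_I2)
      fix t :: real
      show "norm (indicator {0<..} t *\<^sub>R W t) \<le> norm (indicator {0<..} t *\<^sub>R V t)"
        using rn[of t] abs_Re_le_cmod[of "?h t"] g_nonneg[of \<omega> "r t"]
        by (auto simp: indicator_def W_def V_def abs_mult intro!: mult_left_mono)
    qed
  qed
  \<comment> \<open>The signed flux is the total decrease of G along r.\<close>
  have "(LBINT t:{0<..}. W t) = - G \<omega> A"
  proof (rule tendsto_unique[OF trivial_limit_at_top_linorder tendsto_set_integral_Ioc_at_top[OF Wi]])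
    note continuous_on_G
    moreover have "(r \<longlongrightarrow> 0) at_top"
    proof (rule Lim_transform_eventually[OF H1_pair_vanishes[OF f]])
      show "\<forall>\<^sub>F t in at_top. norm (f t) = r t"
        using eventually_ge_at_top[of 0] by eventually_elim (rule rn)
    qed
    moreover have "\<forall>\<^sub>F t in at_top. r t \<in> {0..}"
      using eventually_ge_at_top[of 0] by eventually_elim (use rpos in \<open>auto intro: less_imp_le\<close>)
    ultimately have "((\<lambda>y. G \<omega> (r y)) \<longlongrightarrow> G \<omega> 0) at_top"
      by (intro continuous_on_tendsto_compose[where f = "G \<omega>" and s = "{0..}"]) auto
    then have lim: "((\<lambda>y. G \<omega> (r y) - G \<omega> A) \<longlongrightarrow> - G \<omega> A) at_top"
      using tendsto_diff[OF _ tendsto_const[of "G \<omega> A"]] by (force simp: G_0)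
    have "G \<omega> (r y) - G \<omega> A = (LBINT t:{0<..y}. W t)" if "0 \<le> y" for y
      unfolding W_def r0[symmetric]
      by (rule chain_rule_eq[OF DERIV_G continuous_on_g g_nonneg])
         (use that hi rinc rpos in \<open>auto intro: continuous_on_subset[OF cr] less_imp_le\<close>)
    then have "\<forall>\<^sub>F y in at_top. G \<omega> (r y) - G \<omega> A = (LBINT t:{0<..y}. W t)"
      by (rule eventually_mono[OF eventually_ge_at_top[of 0]])
    with lim show "((\<lambda>y. LBINT t:{0<..y}. W t) \<longlongrightarrow> - G \<omega> A) at_top"
      by (rule Lim_transform_eventually)
  qed
  moreover have "(LBINT t:{0<..}. V t) = G \<omega> A"
    using flux f0 by (simp add: edge_flux_def V_def A_def)
  ultimately have "(LBINT t:{0<..}. V t + W t) = 0"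
    using set_integral_add(2)[OF Vi Wi] by simp
  moreover have VW: "0 \<le> indicator {0<..} t *\<^sub>R (V t + W t)" for t
  proof (cases "0 < t")
    case True
    have "V t + W t = g \<omega> (r t) * (norm (?h t) + Re (?h t))"
      using True rn[of t] by (simp add: V_def W_def algebra_simps)
    moreover have "0 \<le> norm (?h t) + Re (?h t)" using abs_Re_le_cmod[of "?h t"] by linarith
    ultimately show ?thesis using g_nonneg[of \<omega> "r t"] by simp
  qed simp
  moreover have "integrable lborel (\<lambda>t. indicator {0<..} t *\<^sub>R (V t + W t))"
    using set_integral_add(1)[OF Vi Wi] by (simp add: set_integrable_def)
  ultimately have "AE t in lborel. indicator {0<..} t *\<^sub>R (V t + W t) = 0"
    unfolding set_lebesgue_integral_def by (subst (asm) integral_nonneg_eq_0_iff_AE) auto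
  moreover have "AE t in lborel. 0 < t \<longrightarrow> norm (?h t) = g \<omega> (norm (f t))"
    by (rule edge_defect_zero[OF f le om' thA' def0])
  ultimately have AEh: "AE t in lborel. 0 < t \<longrightarrow> Re (?h t) = - g \<omega> (r t)"
  proof eventually_elim
    case (elim t)
    show ?case
    proof
      assume t: "0 < t"
      then have "V t + W t = 0" using elim(1) by simp
      then have "g \<omega> (r t) * (g \<omega> (r t) + Re (?h t)) = 0"
        using elim(2) t rn[of t] by (simp add: V_def W_def distrib_left)
      then show "Re (?h t) = - g \<omega> (r t)" using gpos[of t] t by auto
    qed
  qed
  define I where "I x = integral {0..x} (\<lambda>t. g \<omega> (r t))" for x
  have rI: "r x = A - I x" if x: "0 \<le> x" for x
  proof -
    have gi: "set_integrable lborel {0..x} (\<lambda>t. g \<omega> (r t))"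
      by (intro set_integrable_continuous_Icc continuous_on_subset[OF cgr]) auto
    have gi': "set_integrable lborel {0<..x} (\<lambda>t. - g \<omega> (r t))"
    proof -
      have "set_integrable lborel {0<..x} (\<lambda>t. g \<omega> (r t))"
        by (rule set_integrable_subset[OF gi]) auto
      then show ?thesis by (simp add: set_integrable_def)
    qed
    have "r x - r 0 = (LBINT t:{0<..x}. - g \<omega> (r t))"
      unfolding rinc[OF order_refl x] set_lebesgue_integral_def
    proof (rule integral_cong_AE)
      show "AE t in lborel. indicator {0<..x} t *\<^sub>R Re (?h t) = indicator {0<..x} t *\<^sub>R (- g \<omega> (r t))"
        using AEh by eventually_elim (auto simp: indicator_def)
    qed (use hi[OF order_refl x] gi' in \<open>auto simp: set_integrable_def\<close>)
    also have "\<dots> = - (LBINT t:{0<..x}. g \<omega> (r t))" by (simp add: set_lebesgue_integral_def)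
    also have "(LBINT t:{0<..x}. g \<omega> (r t)) = I x"
      unfolding I_def set_integral_Ioc_eq_Icc[OF gi] by (rule set_borel_integral_eq_integral(2)[OF gi])
    finally show ?thesis by (simp add: r0)
  qed
  have Dr: "(r has_real_derivative - g \<omega> (r x)) (at x within {0..})" if x: "0 \<le> x" for x
  proof -
    have "(I has_real_derivative g \<omega> (r x)) (at x within {0..})"
      unfolding I_def[abs_def] by (rule DERIV_integral_halfline[OF cgr x])
    then have "((\<lambda>x. A - I x) has_real_derivative 0 - g \<omega> (r x)) (at x within {0..})"
      by (intro DERIV_diff DERIV_const) simp
    then show ?thesis
      using has_field_derivative_transform_within[of "\<lambda>x. A - I x" _ x "{0..}" 1 r] rI x by simp
  qed
  have "r t = sol \<omega> a t"
    using slope_ode_unique[OF om a t rpos _ thr Dr] r0 unfolding A_def by blast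
  then show ?thesis using pos[OF t] by (auto simp: r_def elim!: Reals_cases)
qed

lemma sol_strict_antimono:
  assumes om: "0 < \<omega>" and a: "0 < a"
  shows "strict_antimono_on {0..} (sol \<omega> a)"
proof (rule monotone_onI)
  fix x y :: real assume "x \<in> {0..}" "y \<in> {0..}" "x < y"
  show "sol \<omega> a y < sol \<omega> a x"
  proof (rule DERIV_neg_imp_decreasing[OF \<open>x < y\<close>])
    fix z assume "x \<le> z" "z \<le> y"
    then have "0 \<le> z" using \<open>x \<in> {0..}\<close> by simp
    then have "0 < sqrt \<omega> * z + a" using om a by (intro add_nonneg_pos) auto
    then have "sol' \<omega> a z < 0"
      unfolding sol'_def using om alpha_pos sol_pos[OF om, of a z] by (simp add: mult_neg_pos)
    then show "\<exists>d. (sol \<omega> a has_real_derivative d) (at z) \<and> d < 0"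
      using DERIV_sol[OF om] by blast
  qed
qed

lemma energy_dichotomy:
  assumes N: "1 \<le> N" and mu: "0 < \<mu>" and u: "u \<in> H1_star_mass N \<mu>"
  shows "level \<mu> (radial_mass N) \<le> energy p q N u \<or> min (level \<mu> (radial_mass N)) (level \<mu> (2 * \<kappa> 0)) < energy p q N u"
proof -
  have "u \<in> H1_star N" using u by (simp add: H1_star_mass_def)
  then obtain j x where "j \<in> {1..N}" "0 \<le> x" "\<And>i t. i \<in> {1..N} \<Longrightarrow> 0 \<le> t \<Longrightarrow> norm (u i t) \<le> norm (u j x)"
    using star_peak[OF _ N] by blast
  note J = energy_vertex_dominated(1)[OF N mu u this] energy_peak_dominated[OF N mu u this]
  show ?thesis using J by (meson not_le)
qed

lemma ground_states_exist:
  assumes N: "1 \<le> N" and mu: "0 < \<mu>" and k: "radial_mass N \<le> 2 * \<kappa> 0"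
  shows "ground_state p q N \<mu> (radial N \<mu>)"
proof -
  have "level \<mu> (radial_mass N) \<le> level \<mu> (2 * \<kappa> 0)"
    using k level_le_iff[OF mu radial_mass_pos[OF N]] \<kappa>_pos[of 0] by simp
  then have "level \<mu> (radial_mass N) \<le> energy p q N v" if "v \<in> H1_star_mass N \<mu>" for v
    using energy_dichotomy[OF N mu that] by auto
  then show ?thesis
    unfolding ground_state_iff using radial_energy[OF mu N] by simp
qed

lemma ground_states_do_not_exist:
  assumes N: "2 \<le> N" and mu: "0 < \<mu>" and k: "2 * \<kappa> 0 < radial_mass N"
  shows "\<not> ground_state p q N \<mu> u"
proof
  assume gs: "ground_state p q N \<mu> u"
  have N1: "1 \<le> N" using N by simp
  have "level \<mu> (2 * \<kappa> 0) < level \<mu> (radial_mass N)"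
    using k level_le_iff[OF mu radial_mass_pos[OF N1], of "2 * \<kappa> 0"] \<kappa>_pos[of 0] by simp
  then have "level \<mu> (2 * \<kappa> 0) < energy p q N u"
    using energy_dichotomy[OF N1 mu, of u] gs by (auto simp: ground_state_iff)
  from escaping_soliton[OF mu N this] gs show False
    by (auto simp: ground_state_iff not_less[symmetric])
qed

lemma positive_ground_state_unique:
  assumes N: "1 \<le> N" and mu: "0 < \<mu>" and k: "radial_mass N \<le> 2 * \<kappa> 0"
    and gs: "ground_state p q N \<mu> v" and pos: "positive_on_star N v"
  shows "eq_on_star N v (radial N \<mu>)"
proof -
  have v: "v \<in> H1_star_mass N \<mu>" using gs by (simp add: ground_state_iff)
  have v': "v \<in> H1_star N" using v by (simp add: H1_star_mass_def)
  have lev: "level \<mu> (radial_mass N) \<le> level \<mu> (2 * \<kappa> 0)"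
    using k level_le_iff[OF mu radial_mass_pos[OF N]] \<kappa>_pos[of 0] by simp
  have "energy p q N v \<le> level \<mu> (radial_mass N)"
    using gs radial_energy[OF mu N] by (auto simp: ground_state_iff)
  obtain j x where jx: "j \<in> {1..N}" "0 \<le> x" "\<And>i t. i \<in> {1..N} \<Longrightarrow> 0 \<le> t \<Longrightarrow> norm (v i t) \<le> norm (v j x)"
    using star_peak[OF v' N] by blast
  have dom: "(2 / p) * norm (v j x) powr (p - 2) \<le> (1 / (real N)\<^sup>2 + 2 / p) * norm (v 1 0) powr (p - 2)"
  proof (rule ccontr)
    assume "\<not> ?thesis"
    then have "min (level \<mu> (radial_mass N)) (level \<mu> (2 * \<kappa> 0)) < energy p q N v"
      using energy_peak_dominated[OF N mu v jx] by simp
    then show False using lev \<open>energy p q N v \<le> level \<mu> (radial_mass N)\<close> by simp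
  qed
  define w where "w = freq \<mu> (radial_mass N)"
  have w: "0 < w" unfolding w_def by (rule freq_pos[OF mu radial_mass_pos[OF N]])
  have "energy p q N v = level \<mu> (radial_mass N)"
    using energy_vertex_dominated(1)[OF N mu v jx dom] \<open>energy p q N v \<le> level \<mu> (radial_mass N)\<close> by simp
  from energy_vertex_dominated(2)[OF N mu v jx dom this w_def]
  have E: "norm (v 1 0) = sol w (shift N) 0" "norm (v j x) = norm (v 1 0)"
    "\<And>i. i \<in> {1..N} \<Longrightarrow> edge_defect w (v i) = 0"
    "\<And>i. i \<in> {1..N} \<Longrightarrow> edge_flux w (v i) = G w (norm (v 1 0))" by auto
  have "v i t = of_real (sol w (shift N) t)" if i: "i \<in> {1..N}" and t: "0 \<le> t" for i t
  proof (rule edge_profile_unique[OF _ w shift_pos[OF N] _ _ _ E(3)[OF i] _ t])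
    show "H1_pair (v i) (weak_deriv (v i))"
      using v' i by (intro H1_pair_weak_deriv) (auto simp: H1_star_def continuous_on_star_def)
    show "v i s \<in> \<real> \<and> 0 < Re (v i s)" if "0 \<le> s" for s
      using pos i that by (auto simp: positive_on_star_def)
    show "norm (v i s) \<le> sol w (shift N) 0" if "0 \<le> s" for s
      using jx(3)[OF i that] E(1,2) by simp
    show "norm (v i 0) = sol w (shift N) 0" "edge_flux w (v i) = G w (norm (v i 0))"
      unfolding star_vertex[OF v' i] by (rule E(1), rule E(4)[OF i])
  qed
  then show ?thesis by (simp add: eq_on_star_def radial_def sol_star_def w_def)
qed

lemma radial_positive_decreasing:
  assumes "0 < \<mu>" "1 \<le> N"
  shows "positive_on_star N (radial N \<mu>)" "radial_decreasing N (radial N \<mu>)"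
proof -
  have w: "0 < freq \<mu> (radial_mass N)" by (rule freq_pos[OF assms(1) radial_mass_pos[OF assms(2)]])
  show "positive_on_star N (radial N \<mu>)"
    using sol_pos[OF w] by (simp add: positive_on_star_def radial_def sol_star_def)
  show "radial_decreasing N (radial N \<mu>)"
    unfolding radial_decreasing_def
    using sol_strict_antimono[OF w shift_pos[OF assms(2)]]
    by (intro exI[of _ "sol (freq \<mu> (radial_mass N)) (shift N)"]) (simp add: radial_def sol_star_def)
qed

text \<open>
  The predecessor of the least N whose radial profile is heavier than the full soliton.
\<close>

lemma critical_number_exists:
  "\<exists>Np::nat. 2 \<le> Np \<and> (\<forall>N\<ge>1. N \<le> Np \<longleftrightarrow> radial_mass N \<le> 2 * \<kappa> 0)"
proof -
  define P where "P N \<longleftrightarrow> 1 \<le> N \<and> 2 * \<kappa> 0 < radial_mass N" for N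
  obtain N0 where "P N0" using radial_mass_unbounded[of "2 * \<kappa> 0"] by (auto simp: P_def)
  define n where "n = (LEAST N. P N)"
  have n: "P n" unfolding n_def by (rule LeastI) fact
  have least: "\<not> P N" if "N < n" for N using that not_less_Least unfolding n_def by blast
  have "2 < n"
  proof (rule ccontr)
    assume "\<not> 2 < n"
    then have "radial_mass n \<le> radial_mass 2" using n by (intro radial_mass_mono) (auto simp: P_def)
    then show False using n radial_mass_2 by (simp add: P_def)
  qed
  moreover have "N \<le> n - 1 \<longleftrightarrow> radial_mass N \<le> 2 * \<kappa> 0" if N: "1 \<le> N" for N
  proof
    assume "N \<le> n - 1"
    then have "N < n" using \<open>2 < n\<close> by simp
    from least[OF this] show "radial_mass N \<le> 2 * \<kappa> 0" using N by (simp add: P_def not_less)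
  next
    assume le: "radial_mass N \<le> 2 * \<kappa> 0"
    show "N \<le> n - 1"
    proof (rule ccontr)
      assume "\<not> N \<le> n - 1"
      then have "radial_mass n \<le> radial_mass N" using n by (intro radial_mass_mono) (auto simp: P_def)
      then show False using le n by (simp add: P_def)
    qed
  qed
  moreover from \<open>2 < n\<close> have "2 \<le> n - 1" by simp
  ultimately show ?thesis by blast
qed

end

theorem theorem1p2:
  fixes p q :: real
  assumes "2 < p" and "p < 6" and "q = p / 2 + 1"
  shows "\<exists>Np::nat. Np \<ge> 2 \<and>
    (\<forall>N::nat. N \<ge> 1 \<longrightarrow>
      (N \<le> Np \<longrightarrow> (\<forall>\<mu>::real. \<mu> > 0 \<longrightarrow> (\<exists>u. ground_state p q N \<mu> u))) \<and>
      (N > Np \<longrightarrow> (\<forall>\<mu>::real. \<mu> > 0 \<longrightarrow> \<not> (\<exists>u. ground_state p q N \<mu> u))) \<and>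
      (\<forall>\<mu>::real. \<mu> > 0 \<and> (\<exists>u. ground_state p q N \<mu> u) \<longrightarrow>
        (\<exists>u. ground_state p q N \<mu> u \<and> positive_on_star N u \<and> radial_decreasing N u \<and>
          (\<forall>v. ground_state p q N \<mu> v \<and> positive_on_star N v \<longrightarrow> eq_on_star N v u))))"
proof -
  interpret S: subcritical p by unfold_locales fact+
  have q: "q = S.q" using assms(3) by (simp add: S.q_def)
  obtain Np where Np: "2 \<le> Np" and crit: "\<And>N. 1 \<le> N \<Longrightarrow> N \<le> Np \<longleftrightarrow> S.radial_mass N \<le> 2 * S.\<kappa> 0"
    using S.critical_number_exists by blast
  have ex: "ground_state p q N \<mu> (S.radial N \<mu>)" if "1 \<le> N" "N \<le> Np" "0 < \<mu>" for N \<mu>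
    unfolding q using S.ground_states_exist[OF that(1,3)] crit[OF that(1)] that(2) by blast
  have nex: "\<not> ground_state p q N \<mu> u" if "1 \<le> N" "Np < N" "0 < \<mu>" for N \<mu> u
    unfolding q
    by (rule S.ground_states_do_not_exist) (use Np crit[OF that(1)] that in auto)
  have uniq: "eq_on_star N v (S.radial N \<mu>)"
    if "1 \<le> N" "N \<le> Np" "0 < \<mu>" "ground_state p q N \<mu> v" "positive_on_star N v" for N \<mu> v
    using S.positive_ground_state_unique[OF that(1,3)] crit[OF that(1)] that unfolding q by blast
  show ?thesis
  proof (intro exI[of _ Np] conjI allI impI)
    show "2 \<le> Np" by fact
    fix N :: nat assume N: "1 \<le> N"
    show "\<exists>u. ground_state p q N \<mu> u" if "N \<le> Np" "0 < \<mu>" for \<mu>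
      using ex[OF N that] by blast
    show "\<not> (\<exists>u. ground_state p q N \<mu> u)" if "Np < N" "0 < \<mu>" for \<mu>
      using nex[OF N that] by blast
    fix \<mu> :: real assume "0 < \<mu> \<and> (\<exists>u. ground_state p q N \<mu> u)"
    then have mu: "0 < \<mu>" and "N \<le> Np" using nex[OF N] by (auto simp: not_less[symmetric])
    then show "\<exists>u. ground_state p q N \<mu> u \<and> positive_on_star N u \<and> radial_decreasing N u \<and>
          (\<forall>v. ground_state p q N \<mu> v \<and> positive_on_star N v \<longrightarrow> eq_on_star N v u)"
      using ex[OF N _ mu] uniq[OF N _ mu] S.radial_positive_decreasing[OF mu N] by blast
  qed
qed

end
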